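(* Consider the half-duplex bi-directional multiple-relay channel under the two-phase $(m,2)$ DF MABC protocol described in the context, with fixed durations $\Delta_1,\Delta_2\ge 0$, $\Delta_1+\Delta_2=1$, and fixed subsets $\mathcal{A},\mathcal{B}\subseteq\mathcal{R}$. Let $Q$ be a random variable on a finite set $\mathcal{Q}$ with $|\mathcal{Q}|\le 3m+2$, and consider any joint distribution of the form $$p(q)\,p^{(1)}(x_a|q)\,p^{(1)}(x_b|q)\,p^{(1)}(y_{\mathcal{R}}|x_a,x_b)\,p^{(2)}(x_{\mathcal{A}\cap\mathcal{B}}|q)\,p^{(2)}(x_{\mathcal{A}\setminus\mathcal{B}}|q)\,p^{(2)}(x_{\mathcal{B}\setminus\mathcal{A}}|q)\,p^{(2)}(y_a,y_b|x_{\mathcal{A}\cup\mathcal{B}}),$$ where $p^{(1)}(y_{\mathcal R}|x_a,x_b)$ and $p^{(2)}(y_a,y_b|x_{\mathcal A\cup\mathcal B})$ are the channel laws (inputs of relays inside each of the three sets may be arbitrarily jointly distributed). Then every rate pair $(R_a,R_b)$ with $R_a,R_b\ge 0$ satisfying $$R_a<\min\Big\{\Delta_1\min_{r\in\mathcal{A}\cap\mathcal{B}}I(X_a^{(1)};Y_r^{(1)}|X_b^{(1)},Q),\ \Delta_1\min_{r\in\mathcal{A}\setminus\mathcal{B}}I(X_a^{(1)};Y_r^{(1)}|Q),\ \Delta_2 I(X_{\mathcal{A}}^{(2)};Y_b^{(2)}|Q)\Big\},$$ $$R_b<\min\Big\{\Delta_1\min_{r\in\mathcal{A}\cap\mathcal{B}}I(X_b^{(1)};Y_r^{(1)}|X_a^{(1)},Q),\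 \Delta_1\min_{r\in\mathcal{B}\setminus\mathcal{A}}I(X_b^{(1)};Y_r^{(1)}|Q),\ \Delta_2 I(X_{\mathcal{B}}^{(2)};Y_a^{(2)}|Q)\Big\},$$ $$R_a+R_b<\Delta_1\min_{r\in\mathcal{A}\cap\mathcal{B}}I(X_a^{(1)},X_b^{(1)};Y_r^{(1)}|Q)$$ is achievable; i.e. the closure of the set of such pairs is an achievable rate region.
   Context: Network: nodes $r_0=a$, $r_{m+1}=b$ (terminals) and relays $\mathcal{R}=\{r_1,\dots,r_m\}$. Each node $r$ has finite input alphabet $\mathcal{X}_r$ and finite output alphabet $\mathcal{Y}_r$; a special symbol $\varnothing$ means "no input/no output". A protocol with $t$ phases specifies for each phase $\ell$ a set $T_\ell$ of transmitting nodes; nodes not in $T_\ell$ receive (half-duplex: transmitters have output $\varnothing$, receivers have input $\varnothing$), and during phase $\ell$ the channel is discrete memoryless with law $p^{(\ell)}(y_{\text{receivers}}|x_{T_\ell})$. $X_r^{(\ell)},Y_r^{(\ell)}$ denote the input/output of node $r$ in a generic channel use of phase $\ell$, and $X_S^{(\ell)}=\{X_r^{(\ell)}:r\in S\}$; variables equal to $\varnothing$ are dropped from information quantities (so a mutual information with empty input set is $0$). Messages $W_a$ (at $a$, wanted at $b$) and $W_b$ (at $b$, wanted at $a$) are independent and uniform on $\{0,\dots,\lfloor 2^{nR_a}\rfloor-1\}$ and $\{0,\dots,\lfloor 2^{nR_b}\rfloor-1\}$. A code of length $n$ with phase durations $(\Delta_\ell)$ assigns $n_\ell$ channel uses to phase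 $\ell$ ($\sum n_\ell=n$); each transmitting node's input at time $k$ is a function of its own message (if any) and its previously received outputs; $a$ decodes $\tilde W_b$ from its outputs and $W_a$, and $b$ decodes $\tilde W_a$ similarly. $(R_a,R_b)$ is achievable if there are codes with $n_\ell/n\to\Delta_\ell$ for all $\ell$ and both error probabilities $\to 0$. The $(m,2)$ DF MABC protocol: phase 1, $T_1=\{a,b\}$ and the relays receive via $p^{(1)}(y_{\mathcal R}|x_a,x_b)$; phase 2, the relays in $\mathcal{A}\cup\mathcal{B}$ transmit and $a,b$ receive via $p^{(2)}(y_a,y_b|x_{\mathcal{A}\cup\mathcal{B}})$. A minimum over an empty index set is $+\infty$ (the corresponding constraint is absent). *)

theory Defs
  imports Complex_Main "HOL-Library.FuncSet"
begin

(* Nodes: a = 0, relays 1..m, b = Suc m.  Input/output alphabets of node r are the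
   finite sets X r and Y r (inside ambient types 'x and 'y).  Channel symbols
   "no input/no output" are simply not modelled: in phase 1 only a,b transmit and
   only the relays receive; in phase 2 only the relays in A \<union> B transmit and a,b
   receive. *)

definition is_pmf :: "'a set \<Rightarrow> ('a \<Rightarrow> real) \<Rightarrow> bool" where
  "is_pmf S p \<longleftrightarrow> (\<forall>x\<in>S. 0 \<le> p x) \<and> sum p S = 1"

definition mabc_channel1 :: "nat \<Rightarrow> (nat \<Rightarrow> 'x set) \<Rightarrow> (nat \<Rightarrow> 'y set)
      \<Rightarrow> ('x \<Rightarrow> 'x \<Rightarrow> (nat \<Rightarrow> 'y) \<Rightarrow> real) \<Rightarrow> bool" where
  "mabc_channel1 m X Y W1 \<longleftrightarrow>
     (\<forall>xa\<in>X 0. \<forall>xb\<in>X (Suc m). is_pmf (Pi\<^sub>E {1..m} Y) (W1 xa xb))"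

definition mabc_channel2 :: "nat \<Rightarrow> (nat \<Rightarrow> 'x set) \<Rightarrow> (nat \<Rightarrow> 'y set) \<Rightarrow> nat set \<Rightarrow> nat set
      \<Rightarrow> ((nat \<Rightarrow> 'x) \<Rightarrow> 'y \<times> 'y \<Rightarrow> real) \<Rightarrow> bool" where
  "mabc_channel2 m X Y A B W2 \<longleftrightarrow>
     (\<forall>x\<in>Pi\<^sub>E (A \<union> B) X. is_pmf (Y 0 \<times> Y (Suc m)) (W2 x))"

definition marg :: "('o \<Rightarrow> real) \<Rightarrow> 'o set \<Rightarrow> ('o \<Rightarrow> 'v) \<Rightarrow> 'v \<Rightarrow> real" where
  "marg P S f v = (\<Sum>\<omega>\<in>{\<omega>\<in>S. f \<omega> = v}. P \<omega>)"

definition cmi :: "('o \<Rightarrow> real) \<Rightarrow> 'o set \<Rightarrow> ('o \<Rightarrow> 'u) \<Rightarrow> ('o \<Rightarrow> 'v) \<Rightarrow> ('o \<Rightarrow> 'w) \<Rightarrow> real" where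
  "cmi P S U V W =
     (\<Sum>\<omega>\<in>S. if P \<omega> = 0 then 0 else
        P \<omega> * log 2 ((marg P S (\<lambda>\<omega>. (U \<omega>, V \<omega>, W \<omega>)) (U \<omega>, V \<omega>, W \<omega>) * marg P S W (W \<omega>))
                     / (marg P S (\<lambda>\<omega>. (U \<omega>, W \<omega>)) (U \<omega>, W \<omega>) * marg P S (\<lambda>\<omega>. (V \<omega>, W \<omega>)) (V \<omega>, W \<omega>))))"

definition space1 :: "'q set \<Rightarrow> nat \<Rightarrow> (nat \<Rightarrow> 'x set) \<Rightarrow> (nat \<Rightarrow> 'y set)
      \<Rightarrow> ('q \<times> 'x \<times> 'x \<times> (nat \<Rightarrow> 'y)) set" where
  "space1 Qs m X Y = Qs \<times> X 0 \<times> X (Suc m) \<times> Pi\<^sub>E {1..m} Y"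

definition dist1 :: "('q \<Rightarrow> real) \<Rightarrow> ('q \<Rightarrow> 'x \<Rightarrow> real) \<Rightarrow> ('q \<Rightarrow> 'x \<Rightarrow> real)
      \<Rightarrow> ('x \<Rightarrow> 'x \<Rightarrow> (nat \<Rightarrow> 'y) \<Rightarrow> real) \<Rightarrow> ('q \<times> 'x \<times> 'x \<times> (nat \<Rightarrow> 'y)) \<Rightarrow> real" where
  "dist1 pq pa pb W1 = (\<lambda>(q, xa, xb, y). pq q * pa q xa * pb q xb * W1 xa xb y)"

definition space2 :: "'q set \<Rightarrow> nat \<Rightarrow> (nat \<Rightarrow> 'x set) \<Rightarrow> (nat \<Rightarrow> 'y set) \<Rightarrow> nat set \<Rightarrow> nat set
      \<Rightarrow> ('q \<times> (nat \<Rightarrow> 'x) \<times> ('y \<times> 'y)) set" where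
  "space2 Qs m X Y A B = Qs \<times> Pi\<^sub>E (A \<union> B) X \<times> (Y 0 \<times> Y (Suc m))"

definition dist2 :: "nat set \<Rightarrow> nat set \<Rightarrow> ('q \<Rightarrow> real) \<Rightarrow> ('q \<Rightarrow> (nat \<Rightarrow> 'x) \<Rightarrow> real)
      \<Rightarrow> ('q \<Rightarrow> (nat \<Rightarrow> 'x) \<Rightarrow> real) \<Rightarrow> ('q \<Rightarrow> (nat \<Rightarrow> 'x) \<Rightarrow> real)
      \<Rightarrow> ((nat \<Rightarrow> 'x) \<Rightarrow> 'y \<times> 'y \<Rightarrow> real) \<Rightarrow> ('q \<times> (nat \<Rightarrow> 'x) \<times> ('y \<times> 'y)) \<Rightarrow> real" where
  "dist2 A B pq pAB pAnB pBnA W2 = (\<lambda>(q, x, yy).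
      pq q * pAB q (restrict x (A \<inter> B)) * pAnB q (restrict x (A - B))
           * pBnA q (restrict x (B - A)) * W2 x yy)"

definition msgs :: "nat \<Rightarrow> real \<Rightarrow> nat" where
  "msgs n R = nat \<lfloor>2 powr (real n * R)\<rfloor>"

(* ea w k : input of a at time k of phase 1 (function of its message only, since a
   receives nothing before);  eb likewise;  fr r j obs : input of relay r \<in> A \<union> B at time j
   of phase 2, function of its phase-1 received sequence obs. *)
definition valid_code :: "nat \<Rightarrow> (nat \<Rightarrow> 'x set) \<Rightarrow> nat set \<Rightarrow> nat set \<Rightarrow> nat \<Rightarrow> nat \<Rightarrow> nat \<Rightarrow> nat
      \<Rightarrow> (nat \<Rightarrow> nat \<Rightarrow> 'x) \<Rightarrow> (nat \<Rightarrow> nat \<Rightarrow> 'x) \<Rightarrow> (nat \<Rightarrow> nat \<Rightarrow> (nat \<Rightarrow> 'y) \<Rightarrow> 'x) \<Rightarrow> bool" where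
  "valid_code m X A B n1 n2 Ma Mb ea eb fr \<longleftrightarrow>
     (\<forall>w<Ma. \<forall>k<n1. ea w k \<in> X 0) \<and> (\<forall>w<Mb. \<forall>k<n1. eb w k \<in> X (Suc m)) \<and>
     (\<forall>r\<in>A \<union> B. \<forall>j<n2. \<forall>obs. fr r j obs \<in> X r)"

definition trans_prob :: "nat set \<Rightarrow> nat set \<Rightarrow> ('x \<Rightarrow> 'x \<Rightarrow> (nat \<Rightarrow> 'y) \<Rightarrow> real)
      \<Rightarrow> ((nat \<Rightarrow> 'x) \<Rightarrow> 'y \<times> 'y \<Rightarrow> real) \<Rightarrow> nat \<Rightarrow> nat
      \<Rightarrow> (nat \<Rightarrow> nat \<Rightarrow> 'x) \<Rightarrow> (nat \<Rightarrow> nat \<Rightarrow> 'x) \<Rightarrow> (nat \<Rightarrow> nat \<Rightarrow> (nat \<Rightarrow> 'y) \<Rightarrow> 'x)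
      \<Rightarrow> nat \<Rightarrow> nat \<Rightarrow> (nat \<Rightarrow> nat \<Rightarrow> 'y) \<Rightarrow> (nat \<Rightarrow> 'y \<times> 'y) \<Rightarrow> real" where
  "trans_prob A B W1 W2 n1 n2 ea eb fr wa wb ys z =
     (\<Prod>k<n1. W1 (ea wa k) (eb wb k) (ys k)) *
     (\<Prod>j<n2. W2 (\<lambda>r\<in>A \<union> B. fr r j (\<lambda>k\<in>{..<n1}. ys k r)) (z j))"

definition err_at_b :: "nat \<Rightarrow> (nat \<Rightarrow> 'x set) \<Rightarrow> (nat \<Rightarrow> 'y set) \<Rightarrow> nat set \<Rightarrow> nat set
      \<Rightarrow> ('x \<Rightarrow> 'x \<Rightarrow> (nat \<Rightarrow> 'y) \<Rightarrow> real) \<Rightarrow> ((nat \<Rightarrow> 'x) \<Rightarrow> 'y \<times> 'y \<Rightarrow> real)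
      \<Rightarrow> nat \<Rightarrow> nat \<Rightarrow> nat \<Rightarrow> nat
      \<Rightarrow> (nat \<Rightarrow> nat \<Rightarrow> 'x) \<Rightarrow> (nat \<Rightarrow> nat \<Rightarrow> 'x) \<Rightarrow> (nat \<Rightarrow> nat \<Rightarrow> (nat \<Rightarrow> 'y) \<Rightarrow> 'x)
      \<Rightarrow> (nat \<Rightarrow> (nat \<Rightarrow> 'y) \<Rightarrow> nat) \<Rightarrow> real" where
  "err_at_b m X Y A B W1 W2 n1 n2 Ma Mb ea eb fr db =
     (1 / (real Ma * real Mb)) *
     (\<Sum>wa<Ma. \<Sum>wb<Mb. \<Sum>ys\<in>Pi\<^sub>E {..<n1} (\<lambda>_. Pi\<^sub>E {1..m} Y).
        \<Sum>z\<in>Pi\<^sub>E {..<n2} (\<lambda>_. Y 0 \<times> Y (Suc m)).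
          (if db wb (\<lambda>j\<in>{..<n2}. snd (z j)) \<noteq> wa
           then trans_prob A B W1 W2 n1 n2 ea eb fr wa wb ys z else 0))"

definition err_at_a :: "nat \<Rightarrow> (nat \<Rightarrow> 'x set) \<Rightarrow> (nat \<Rightarrow> 'y set) \<Rightarrow> nat set \<Rightarrow> nat set
      \<Rightarrow> ('x \<Rightarrow> 'x \<Rightarrow> (nat \<Rightarrow> 'y) \<Rightarrow> real) \<Rightarrow> ((nat \<Rightarrow> 'x) \<Rightarrow> 'y \<times> 'y \<Rightarrow> real)
      \<Rightarrow> nat \<Rightarrow> nat \<Rightarrow> nat \<Rightarrow> nat
      \<Rightarrow> (nat \<Rightarrow> nat \<Rightarrow> 'x) \<Rightarrow> (nat \<Rightarrow> nat \<Rightarrow> 'x) \<Rightarrow> (nat \<Rightarrow> nat \<Rightarrow> (nat \<Rightarrow> 'y) \<Rightarrow> 'x)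
      \<Rightarrow> (nat \<Rightarrow> (nat \<Rightarrow> 'y) \<Rightarrow> nat) \<Rightarrow> real" where
  "err_at_a m X Y A B W1 W2 n1 n2 Ma Mb ea eb fr da =
     (1 / (real Ma * real Mb)) *
     (\<Sum>wa<Ma. \<Sum>wb<Mb. \<Sum>ys\<in>Pi\<^sub>E {..<n1} (\<lambda>_. Pi\<^sub>E {1..m} Y).
        \<Sum>z\<in>Pi\<^sub>E {..<n2} (\<lambda>_. Y 0 \<times> Y (Suc m)).
          (if da wa (\<lambda>j\<in>{..<n2}. fst (z j)) \<noteq> wb
           then trans_prob A B W1 W2 n1 n2 ea eb fr wa wb ys z else 0))"

definition mabc_achievable :: "nat \<Rightarrow> (nat \<Rightarrow> 'x set) \<Rightarrow> (nat \<Rightarrow> 'y set) \<Rightarrow> nat set \<Rightarrow> nat set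
      \<Rightarrow> ('x \<Rightarrow> 'x \<Rightarrow> (nat \<Rightarrow> 'y) \<Rightarrow> real) \<Rightarrow> ((nat \<Rightarrow> 'x) \<Rightarrow> 'y \<times> 'y \<Rightarrow> real)
      \<Rightarrow> real \<Rightarrow> real \<Rightarrow> real \<Rightarrow> real \<Rightarrow> bool" where
  "mabc_achievable m X Y A B W1 W2 D1 D2 Ra Rb \<longleftrightarrow>
     (\<exists>(N :: nat \<Rightarrow> nat) (n1 :: nat \<Rightarrow> nat) (n2 :: nat \<Rightarrow> nat)
        (ea :: nat \<Rightarrow> nat \<Rightarrow> nat \<Rightarrow> 'x) (eb :: nat \<Rightarrow> nat \<Rightarrow> nat \<Rightarrow> 'x)
        (fr :: nat \<Rightarrow> nat \<Rightarrow> nat \<Rightarrow> (nat \<Rightarrow> 'y) \<Rightarrow> 'x)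
        (da :: nat \<Rightarrow> nat \<Rightarrow> (nat \<Rightarrow> 'y) \<Rightarrow> nat) (db :: nat \<Rightarrow> nat \<Rightarrow> (nat \<Rightarrow> 'y) \<Rightarrow> nat).
        filterlim N at_top sequentially \<and>
        (\<forall>i. n1 i + n2 i = N i) \<and>
        (\<lambda>i. real (n1 i) / real (N i)) \<longlonglongrightarrow> D1 \<and>
        (\<lambda>i. real (n2 i) / real (N i)) \<longlonglongrightarrow> D2 \<and>
        (\<forall>i. valid_code m X A B (n1 i) (n2 i) (msgs (N i) Ra) (msgs (N i) Rb) (ea i) (eb i) (fr i)) \<and>
        (\<lambda>i. err_at_b m X Y A B W1 W2 (n1 i) (n2 i) (msgs (N i) Ra) (msgs (N i) Rb)
               (ea i) (eb i) (fr i) (db i)) \<longlonglongrightarrow> 0 \<and>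
        (\<lambda>i. err_at_a m X Y A B W1 W2 (n1 i) (n2 i) (msgs (N i) Ra) (msgs (N i) Rb)
               (ea i) (eb i) (fr i) (da i)) \<longlonglongrightarrow> 0)"

end

theory Submission
  imports Defs
begin

text \<open>
  The two phases decouple by a union bound: the terminals fail only if some relay decodes wrongly
  in phase 1, or the phase-2 code fails when its relays know the messages. So it suffices to
  find, separately for each phase, a code with small average error, and both come from one random
  coding argument. Draw a time-sharing sequence from \<open>p(q)\<close> and, conditionally on it, independent
  codewords \<open>u(wa, wb)\<close>, \<open>v(wa)\<close>, \<open>t(wb)\<close>. In phase 1, \<open>u\<close> is trivial and \<open>v\<close>, \<open>t\<close> are the inputs of
  \<open>a\<close>, \<open>b\<close>; in phase 2 they are the inputs of the relays in \<open>A \<inter> B\<close>, \<open>A - B\<close>, \<open>B - A\<close>. A receiver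
  looks for a message pair whose information density exceeds a threshold slightly below the mutual
  information. The sent pair fails this test with exponentially small probability by a Chernoff
  bound, and a rival pair passes it with probability at most \<open>2 powr (- n g)\<close> by a change of
  measure. The code at different times being independent, every such probability is the \<open>n\<close>-th
  power of a single-letter one. For the terminal \<open>b\<close>, which knows \<open>wb\<close>, the rivals of \<open>(wa, wb)\<close> are
  the \<open>(wa', wb)\<close>, whose \<open>u\<close> and \<open>v\<close> are fresh; hence the rate \<open>I(X_A; Y_b | Q)\<close>.
\<close>


section \<open>Weighted sums over finite sets\<close>

text \<open>A wrong pair reuses the letters of whatever message it has right. What is reused belongs
  to the condition of a mutual information, what is fresh is its input; hence the three classes of
  rivals and the three phase-1 terms at a relay in \<open>A \<inter> B\<close>. A relay that decodes
  a single message conditions on \<open>Q\<close> only and treats the other input as noise.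

  The time-sharing letter couples all codewords, so these are not independent. A codebook is
  therefore drawn by columns: one draw holds \<open>q\<close> and the letters of all messages at one
  time, and the columns are independent and identically distributed.

  The information density is kept as a likelihood ratio. Both error events then obey Markov bounds
  for products over time, and typical sets never appear. A threshold exponent \<open>g\<close> with
  \<open>R < D * g\<close> outweighs the number of rivals, and \<open>g\<close> below the mutual
  information leaves room for a Chernoff exponent; the strict rate inequalities are exactly what
  makes such a \<open>g\<close> exist. Errors of all receivers and all message pairs are added
  before averaging, so that one codebook is good for all of them.\<close>

definition wsum :: "'a set \<Rightarrow> ('a \<Rightarrow> real) \<Rightarrow> ('a \<Rightarrow> real) \<Rightarrow> real" where
  "wsum S p f = (\<Sum>x\<in>S. p x * f x)"

lemma is_pmf_finite: "is_pmf S p \<Longrightarrow> finite S"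
  unfolding is_pmf_def by (metis sum.infinite zero_neq_one)

lemma is_pmf_nonneg: "is_pmf S p \<Longrightarrow> x \<in> S \<Longrightarrow> 0 \<le> p x"
  unfolding is_pmf_def by blast

lemma wsum_const [simp]: "is_pmf S p \<Longrightarrow> wsum S p (\<lambda>_. c) = c"
  unfolding wsum_def is_pmf_def by (simp flip: sum_distrib_right)

lemma wsum_cong:
  "S = S' \<Longrightarrow> (\<And>x. x \<in> S' \<Longrightarrow> p x = p' x) \<Longrightarrow> (\<And>x. x \<in> S' \<Longrightarrow> f x = f' x) \<Longrightarrow> wsum S p f = wsum S' p' f'"
  unfolding wsum_def by simp

text \<open>The comparison is asked only where the weight is positive, because densities are known
  to be positive only on the support of the law.\<close>

lemma wsum_mono:
  assumes "\<And>x. x \<in> S \<Longrightarrow> 0 \<le> p x" "\<And>x. x \<in> S \<Longrightarrow> 0 < p x \<Longrightarrow> f x \<le> g x"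
  shows "wsum S p f \<le> wsum S p g"
  unfolding wsum_def
proof (rule sum_mono)
  fix x assume "x \<in> S"
  with assms show "p x * f x \<le> p x * g x"
    by (cases "p x = 0") (auto intro!: mult_left_mono simp: order_less_le)
qed

lemma wsum_nonneg:
  "(\<And>x. x \<in> S \<Longrightarrow> 0 \<le> p x) \<Longrightarrow> (\<And>x. x \<in> S \<Longrightarrow> 0 \<le> f x) \<Longrightarrow> 0 \<le> wsum S p f"
  unfolding wsum_def by (intro sum_nonneg) simp

lemma wsum_add: "wsum S p (\<lambda>x. f x + g x) = wsum S p f + wsum S p g"
  unfolding wsum_def by (simp add: algebra_simps sum.distrib)

lemma wsum_sum: "wsum S p (\<lambda>x. \<Sum>i\<in>I. f i x) = (\<Sum>i\<in>I. wsum S p (f i))"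
  unfolding wsum_def by (simp add: sum_distrib_left sum.swap[of _ S])

lemma wsum_cmult: "wsum S p (\<lambda>x. c * f x) = c * wsum S p f"
  unfolding wsum_def by (simp add: sum_distrib_left algebra_simps)

lemma wsum_swap:
  "wsum S p (\<lambda>x. wsum T r (\<lambda>y. f x y)) = wsum T r (\<lambda>y. wsum S p (\<lambda>x. f x y))"
  unfolding wsum_def
  by (simp add: sum_distrib_left sum.swap[of _ S T] algebra_simps)

text \<open>The second weight is a kernel that may depend on the first coordinate. Iterated, the
  equation turns a chain-rule factorisation into nested sums, which is why the laws below are
  written with nested pairs.\<close>

lemma wsum_Times:
  "wsum (S \<times> T) (\<lambda>(x, y). p x * r x y) f = wsum S p (\<lambda>x. wsum T (r x) (\<lambda>y. f (x, y)))"
  unfolding wsum_def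
  by (simp add: sum.cartesian_product sum_distrib_left case_prod_unfold mult.assoc)

lemma is_pmf_Times:
  assumes "is_pmf S p" "\<And>x. x \<in> S \<Longrightarrow> is_pmf T (r x)"
  shows "is_pmf (S \<times> T) (\<lambda>(x, y). p x * r x y)"
proof -
  have "wsum S p (\<lambda>x. wsum T (r x) (\<lambda>y. 1)) = wsum S p (\<lambda>x. 1)"
    by (rule wsum_cong) (use assms in auto)
  then have "wsum (S \<times> T) (\<lambda>(x, y). p x * r x y) (\<lambda>_. 1) = 1"
    using assms(1) by (simp add: wsum_Times)
  then show ?thesis
    using assms unfolding is_pmf_def wsum_def by auto
qed

text \<open>The averaging principle behind random coding. If every value exceeded the mean, the
  weighted deviations from it would be nonnegative with sum zero, so every weight would vanish,
  against total mass one.\<close>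

lemma exists_le_wsum:
  assumes "is_pmf S p"
  shows "\<exists>x\<in>S. f x \<le> wsum S p f"
proof (rule ccontr)
  define e where "e = wsum S p f"
  assume "\<not> ?thesis"
  then have gt: "\<And>x. x \<in> S \<Longrightarrow> e < f x" unfolding e_def by force
  have "(\<Sum>x\<in>S. p x * (f x - e)) = wsum S p f - wsum S p (\<lambda>_. e)"
    unfolding wsum_def by (simp add: algebra_simps sum_subtractf)
  then have "(\<Sum>x\<in>S. p x * (f x - e)) = 0"
    using assms unfolding e_def by simp
  then have "\<forall>x\<in>S. p x * (f x - e) = 0"
    by (subst (asm) sum_nonneg_eq_0_iff)
       (use assms gt in \<open>auto simp: is_pmf_finite is_pmf_nonneg less_imp_le\<close>)
  then have "\<forall>x\<in>S. p x = 0" using gt by force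
  then show False using assms by (simp add: is_pmf_def)
qed

lemma wsum_PiE:
  assumes "finite I" "\<And>i. i \<in> I \<Longrightarrow> finite (S i)"
  shows "wsum (Pi\<^sub>E I S) (\<lambda>c. \<Prod>i\<in>I. p i (c i)) (\<lambda>c. \<Prod>i\<in>I. h i (c i)) = (\<Prod>i\<in>I. wsum (S i) (p i) (h i))"
  unfolding wsum_def by (simp add: assms prod_sum_PiE prod.distrib)

lemma is_pmf_PiE:
  assumes "finite I" "\<And>i. i \<in> I \<Longrightarrow> is_pmf (S i) (p i)"
  shows "is_pmf (Pi\<^sub>E I S) (\<lambda>c. \<Prod>i\<in>I. p i (c i))"
proof -
  have "wsum (Pi\<^sub>E I S) (\<lambda>c. \<Prod>i\<in>I. p i (c i)) (\<lambda>c. \<Prod>i\<in>I. 1) = (\<Prod>i\<in>I. wsum (S i) (p i) (\<lambda>_. 1))"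
    by (rule wsum_PiE) (use assms is_pmf_finite in auto)
  also have "\<dots> = 1" using assms by simp
  finally show ?thesis
    using assms unfolding is_pmf_def wsum_def by (auto intro!: prod_nonneg)
qed

lemma wsum_PiE_component:
  assumes "finite I" "is_pmf S p" "j \<in> I"
  shows "wsum (Pi\<^sub>E I (\<lambda>_. S)) (\<lambda>c. \<Prod>i\<in>I. p (c i)) (\<lambda>c. G (c j)) = wsum S p G"
proof -
  let ?h = "\<lambda>i x. if i = j then G x else 1"
  have "wsum (Pi\<^sub>E I (\<lambda>_. S)) (\<lambda>c. \<Prod>i\<in>I. p (c i)) (\<lambda>c. G (c j))
      = wsum (Pi\<^sub>E I (\<lambda>_. S)) (\<lambda>c. \<Prod>i\<in>I. p (c i)) (\<lambda>c. \<Prod>i\<in>I. ?h i (c i))"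
    by (rule wsum_cong) (use assms in \<open>auto simp: prod.delta\<close>)
  also have "\<dots> = (\<Prod>i\<in>I. wsum S p (?h i))"
    by (rule wsum_PiE) (use assms is_pmf_finite in auto)
  also have "\<dots> = (\<Prod>i\<in>I. if i = j then wsum S p G else 1)"
    by (rule prod.cong) (use assms in auto)
  finally show ?thesis using assms by simp
qed

text \<open>\<open>G (c i) (c j)\<close> is not a product over coordinates. Summing over the
  possible values \<open>x\<close> of \<open>c i\<close> writes it as a sum of the products of the
  indicator of \<open>c i = x\<close> with \<open>G x (c j)\<close>, and \<open>wsum_PiE\<close>
  applies to each of them.\<close>

lemma wsum_PiE_two_components:
  assumes I: "finite I" and p: "is_pmf S p" and ij: "i \<in> I" "j \<in> I" "i \<noteq> j"
  shows "wsum (Pi\<^sub>E I (\<lambda>_. S)) (\<lambda>c. \<Prod>i\<in>I. p (c i)) (\<lambda>c. G (c i) (c j))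
       = wsum S p (\<lambda>x. wsum S p (G x))"
proof -
  note fin = is_pmf_finite[OF p]
  let ?E = "wsum (Pi\<^sub>E I (\<lambda>_. S)) (\<lambda>c. \<Prod>i\<in>I. p (c i))"
  let ?h = "\<lambda>x l z. if l = i then of_bool (z = x) else if l = j then G x z else 1"
  have prodh: "(\<Prod>l\<in>I. if l = i then a else if l = j then b else 1) = a * b" for a b :: real
  proof -
    have "(\<Prod>l\<in>I. if l = i then a else if l = j then b else 1)
        = (\<Prod>l\<in>I. (if l = i then a else 1) * (if l = j then b else 1))"
      by (rule prod.cong) (use ij in auto)
    then show ?thesis using I ij by (simp add: prod.distrib)
  qed
  have "?E (\<lambda>c. G (c i) (c j)) = ?E (\<lambda>c. \<Sum>x\<in>S. \<Prod>l\<in>I. ?h x l (c l))"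
  proof (rule wsum_cong)
    fix c assume "c \<in> Pi\<^sub>E I (\<lambda>_. S)"
    then have ci: "c i \<in> S" using ij by auto
    have "(\<Prod>l\<in>I. ?h x l (c l)) = of_bool (c i = x) * G x (c j)" for x
    proof -
      have "(\<Prod>l\<in>I. ?h x l (c l))
          = (\<Prod>l\<in>I. if l = i then of_bool (c i = x) else if l = j then G x (c j) else 1)"
        by (rule prod.cong) auto
      then show ?thesis by (simp only: prodh)
    qed
    then have "(\<Sum>x\<in>S. \<Prod>l\<in>I. ?h x l (c l)) = (\<Sum>x\<in>S. if c i = x then G x (c j) else 0)"
      by (intro sum.cong) auto
    then show "G (c i) (c j) = (\<Sum>x\<in>S. \<Prod>l\<in>I. ?h x l (c l))"
      using fin ci by simp
  qed auto
  also have "\<dots> = (\<Sum>x\<in>S. ?E (\<lambda>c. \<Prod>l\<in>I. ?h x l (c l)))"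
    by (rule wsum_sum)
  also have "\<dots> = (\<Sum>x\<in>S. p x * wsum S p (G x))"
  proof (rule sum.cong)
    fix x assume x: "x \<in> S"
    have "?E (\<lambda>c. \<Prod>l\<in>I. ?h x l (c l)) = (\<Prod>l\<in>I. wsum S p (?h x l))"
      by (rule wsum_PiE) (use I fin in auto)
    also have "\<dots> = (\<Prod>l\<in>I. if l = i then p x else if l = j then wsum S p (G x) else 1)"
    proof (rule prod.cong)
      fix l
      have "wsum S p (\<lambda>z. of_bool (z = x)) = p x"
        unfolding wsum_def using fin x by (simp add: of_bool_def if_distrib cong: if_cong)
      then show "wsum S p (?h x l) = (if l = i then p x else if l = j then wsum S p (G x) else 1)"
        using p ij by auto
    qed auto
    finally show "?E (\<lambda>c. \<Prod>l\<in>I. ?h x l (c l)) = p x * wsum S p (G x)"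
      by (simp only: prodh)
  qed auto
  finally show ?thesis by (simp add: wsum_def)
qed

lemma wsum_pick:
  "finite S \<Longrightarrow> wsum S p (\<lambda>x. if x = x0 then f x else 0) = (if x0 \<in> S then p x0 * f x0 else 0)"
  unfolding wsum_def by (simp add: if_distrib cong: if_cong)

lemma wsum_if: "wsum S p (\<lambda>x. if b then f x else 0) = (if b then wsum S p f else 0)"
  unfolding wsum_def by simp

lemma mult_if_zero: "(a::real) * (if b then x else 0) = (if b then a * x else 0)"
  by simp

section \<open>Information density\<close>

text \<open>The ratio p(v|u,w) / p(v|w), whose logarithm is the information density. Without the
  logarithm it multiplies over time. It takes values rather than a sample point, since a rival
  codeword supplies \<open>u\<close> while the output caused by the sent one supplies
  \<open>v\<close>.\<close>

definition dens :: "('o \<Rightarrow> real) \<Rightarrow> 'o set \<Rightarrow> ('o \<Rightarrow> 'u) \<Rightarrow> ('o \<Rightarrow> 'v) \<Rightarrow> ('o \<Rightarrow> 'w) \<Rightarrow> 'u \<Rightarrow> 'v \<Rightarrow> 'w \<Rightarrow> real" where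
  "dens P S U V W u v w =
     (marg P S (\<lambda>\<omega>. (U \<omega>, V \<omega>, W \<omega>)) (u, v, w) * marg P S W w)
     / (marg P S (\<lambda>\<omega>. (U \<omega>, W \<omega>)) (u, w) * marg P S (\<lambda>\<omega>. (V \<omega>, W \<omega>)) (v, w))"

lemma cmi_eq_wsum_dens:
  "cmi P S U V W = wsum S P (\<lambda>\<omega>. log 2 (dens P S U V W (U \<omega>) (V \<omega>) (W \<omega>)))"
  unfolding cmi_def wsum_def dens_def by (rule sum.cong) auto

lemma marg_nonneg: "(\<And>\<omega>. \<omega> \<in> S \<Longrightarrow> 0 \<le> P \<omega>) \<Longrightarrow> 0 \<le> marg P S f v"
  unfolding marg_def by (intro sum_nonneg) auto

lemma marg_pos:
  assumes "finite S" "\<And>\<omega>. \<omega> \<in> S \<Longrightarrow> 0 \<le> P \<omega>" "\<omega> \<in> S" "0 < P \<omega>" "f \<omega> = v"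
  shows "0 < marg P S f v"
  unfolding marg_def by (rule sum_pos2[of _ \<omega>]) (use assms in auto)

lemma dens_nonneg: "(\<And>\<omega>. \<omega> \<in> S \<Longrightarrow> 0 \<le> P \<omega>) \<Longrightarrow> 0 \<le> dens P S U V W u v w"
  unfolding dens_def by (intro divide_nonneg_nonneg mult_nonneg_nonneg marg_nonneg)

lemma dens_pos:
  assumes "finite S" "\<And>\<omega>. \<omega> \<in> S \<Longrightarrow> 0 \<le> P \<omega>" "\<omega> \<in> S" "0 < P \<omega>"
  shows "0 < dens P S U V W (U \<omega>) (V \<omega>) (W \<omega>)"
  unfolding dens_def
  by (intro divide_pos_pos mult_pos_pos marg_pos[of S P \<omega>]) (use assms in auto)

text \<open>Change of measure: under the conditional law \<open>f\<close> of \<open>U\<close> given \<open>W = w\<close>, but with \<open>U\<close>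
  drawn independently of \<open>V\<close>, the density has mean at most one.\<close>

lemma wsum_dens_le_1:
  assumes S: "finite S" "\<And>\<omega>. \<omega> \<in> S \<Longrightarrow> 0 \<le> P \<omega>" and F: "finite F"
    and f: "\<And>u. u \<in> F \<Longrightarrow> marg P S (\<lambda>\<omega>. (U \<omega>, W \<omega>)) (u, w) = f u * marg P S W w"
  shows "wsum F f (\<lambda>u. dens P S U V W u v w) \<le> 1"
proof -
  let ?uvw = "\<lambda>u. marg P S (\<lambda>\<omega>. (U \<omega>, V \<omega>, W \<omega>)) (u, v, w)"
  let ?vw = "marg P S (\<lambda>\<omega>. (V \<omega>, W \<omega>)) (v, w)"
  note nn = marg_nonneg[of S P, OF S(2)]
  have "wsum F f (\<lambda>u. dens P S U V W u v w) \<le> (\<Sum>u\<in>F. ?uvw u / ?vw)"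
    unfolding wsum_def
  proof (rule sum_mono)
    fix u assume u: "u \<in> F"
    have eq: "f u * dens P S U V W u v w
        = (f u * marg P S W w / marg P S (\<lambda>\<omega>. (U \<omega>, W \<omega>)) (u, w)) * (?uvw u / ?vw)"
      unfolding dens_def by simp
    \<comment> \<open>The quotient is 1, or 0 by the convention for division when the marginal
      vanishes; hence an inequality.\<close>
    have le: "f u * marg P S W w / marg P S (\<lambda>\<omega>. (U \<omega>, W \<omega>)) (u, w) \<le> 1"
      unfolding f[OF u] by simp
    have "0 \<le> ?uvw u / ?vw"
      by (intro divide_nonneg_nonneg nn)
    then show "f u * dens P S U V W u v w \<le> ?uvw u / ?vw"
      unfolding eq using mult_right_mono[OF le] by fastforce
  qed
  also have "\<dots> = (\<Sum>u\<in>F. ?uvw u) / ?vw" by (simp add: sum_divide_distrib)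
  also have "\<dots> \<le> 1"
  proof -
    have "(\<Sum>u\<in>F. ?uvw u) = sum P (\<Union>u\<in>F. {\<omega> \<in> S. (U \<omega>, V \<omega>, W \<omega>) = (u, v, w)})"
      unfolding marg_def by (rule sum.UNION_disjoint[symmetric]) (use S F in auto)
    also have "\<dots> \<le> ?vw"
      unfolding marg_def by (rule sum_mono2) (use S in auto)
    finally show ?thesis
      using nn[of "\<lambda>\<omega>. (V \<omega>, W \<omega>)" "(v, w)"] by (simp add: divide_le_eq)
  qed
  finally show ?thesis .
qed

lemma marg_eq_wsum: "finite S \<Longrightarrow> marg P S f v = wsum S P (\<lambda>\<omega>. of_bool (f \<omega> = v))"
  unfolding marg_def wsum_def
  by (simp add: sum.inter_filter of_bool_def if_distrib cong: if_cong)

text \<open>With \<open>d = ln 2 * (g - log 2 L)\<close>, the moment generating function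
  \<open>h s\<close> of \<open>d\<close> is 1 at 0 and has derivative \<open>ln 2\<close> times
  \<open>g\<close> minus the mean of \<open>log 2 L\<close> there. This is negative, so
  \<open>h\<close> drops below 1 at some small positive \<open>s\<close>, and that value serves as
  \<rho>.\<close>

lemma chernoff_exponent:
  assumes P: "is_pmf S P" and g: "g < wsum S P (\<lambda>\<omega>. log 2 (L \<omega>))"
    and pos: "\<And>\<omega>. \<omega> \<in> S \<Longrightarrow> 0 < P \<omega> \<Longrightarrow> 0 < L \<omega>"
  shows "\<exists>s>0. \<exists>\<rho>. 0 \<le> \<rho> \<and> \<rho> < 1 \<and> wsum S P (\<lambda>\<omega>. (2 powr g / L \<omega>) powr s) \<le> \<rho>"
proof -
  define d where "d \<omega> = g * ln 2 - ln (L \<omega>)" for \<omega>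
  define h where "h s = wsum S P (\<lambda>\<omega>. exp (s * d \<omega>))" for s
  have "(h has_real_derivative (\<Sum>\<omega>\<in>S. P \<omega> * (exp (0 * d \<omega>) * d \<omega>))) (at 0)"
    unfolding h_def wsum_def by (auto intro!: derivative_eq_intros sum.cong)
  moreover have "(\<Sum>\<omega>\<in>S. P \<omega> * (exp (0 * d \<omega>) * d \<omega>)) < 0"
  proof -
    have "(\<Sum>\<omega>\<in>S. P \<omega> * (exp (0 * d \<omega>) * d \<omega>)) = wsum S P (\<lambda>_. g * ln 2) + wsum S P (\<lambda>\<omega>. - ln 2 * log 2 (L \<omega>))"
      unfolding wsum_add[symmetric] unfolding wsum_def d_def log_def by (intro sum.cong) auto
    also have "\<dots> = ln 2 * (g - wsum S P (\<lambda>\<omega>. log 2 (L \<omega>)))"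
      by (subst wsum_cmult) (simp add: P algebra_simps)
    also have "\<dots> < 0" using g by (intro mult_pos_neg) auto
    finally show ?thesis .
  qed
  ultimately obtain e where e: "e > 0" "\<And>s. 0 < s \<Longrightarrow> s < e \<Longrightarrow> h (0 + s) < h 0"
    using DERIV_neg_dec_right by blast
  define s where "s = e / 2"
  have s: "s > 0" "h s < 1"
    using e(1) e(2)[of s] P by (auto simp: s_def h_def)
  have "wsum S P (\<lambda>\<omega>. (2 powr g / L \<omega>) powr s) \<le> h s"
    unfolding h_def
  proof (rule wsum_mono)
    fix \<omega> assume "\<omega> \<in> S" "0 < P \<omega>"
    then have "0 < L \<omega>" by (rule pos)
    then show "(2 powr g / L \<omega>) powr s \<le> exp (s * d \<omega>)"
      unfolding d_def by (simp add: powr_def ln_div exp_diff)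
  qed (use P in \<open>auto simp: is_pmf_nonneg\<close>)
  moreover have "0 \<le> h s"
    unfolding h_def by (rule wsum_nonneg) (use P in \<open>auto simp: is_pmf_nonneg\<close>)
  ultimately show ?thesis using s by blast
qed

section \<open>Random coding\<close>

text \<open>The failure event of one threshold test against one class of rivals. A receiver that
  runs several tests is reliable as soon as none of its events occurs.\<close>

definition confusable :: "nat \<Rightarrow> real \<Rightarrow> ('x \<Rightarrow> 'y \<Rightarrow> real) \<Rightarrow> (nat \<Rightarrow> 'w \<Rightarrow> 'x) \<Rightarrow> 'w set \<Rightarrow> 'w
    \<Rightarrow> (nat \<Rightarrow> 'y) \<Rightarrow> bool" where
  "confusable n g L x V w y \<longleftrightarrow>
     (\<Prod>k<n. L (x k w) (y k)) < 2 powr (real n * g) \<or>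
     (\<exists>w'\<in>V. 2 powr (real n * g) \<le> (\<Prod>k<n. L (x k w') (y k)))"

text \<open>Given the columns, the outputs are independent over time, and so are the columns
  themselves. This reduces every block estimate to a single letter.\<close>

lemma wsum_iterated_PiE:
  assumes "finite \<Omega>" "finite S"
  shows "wsum (Pi\<^sub>E {..<n} (\<lambda>_. \<Omega>)) (\<lambda>C. \<Prod>k<n. P (C k))
           (\<lambda>C. wsum (Pi\<^sub>E {..<n} (\<lambda>_. S)) (\<lambda>y. \<Prod>k<n. K (C k) (y k)) (\<lambda>y. \<Prod>k<n. h (C k) (y k)))
         = wsum \<Omega> P (\<lambda>c. wsum S (K c) (h c)) ^ n"
proof -
  have "wsum (Pi\<^sub>E {..<n} (\<lambda>_. S)) (\<lambda>y. \<Prod>k<n. K (C k) (y k)) (\<lambda>y. \<Prod>k<n. h (C k) (y k))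
      = (\<Prod>k<n. wsum S (K (C k)) (h (C k)))" for C
    by (rule wsum_PiE) (use assms in auto)
  moreover have "wsum (Pi\<^sub>E {..<n} (\<lambda>_. \<Omega>)) (\<lambda>C. \<Prod>k<n. P (C k)) (\<lambda>C. \<Prod>k<n. wsum S (K (C k)) (h (C k)))
      = (\<Prod>k<n. wsum \<Omega> P (\<lambda>c. wsum S (K c) (h c)))"
    by (rule wsum_PiE) (use assms in auto)
  ultimately show ?thesis by simp
qed

text \<open>Here \<open>c\<close> is the random column of one time, \<open>cw c w\<close> the letter
  that it gives to message \<open>w\<close>, and \<open>J\<close> lists the tests of all receivers.
  Failure of the sent word is bounded by the \<open>s\<close>-th power of threshold over density,
  success of a rival by density over threshold; both bounds are products over time. The sum over
  messages and tests is averaged as a whole, so a single codebook controls all of them.\<close>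

lemma random_coding:
  fixes cw :: "'c \<Rightarrow> 'w \<Rightarrow> 'x" and L :: "'j \<Rightarrow> 'x \<Rightarrow> 'y \<Rightarrow> real"
  assumes \<Omega>: "is_pmf \<Omega> P" and S: "finite S" and J: "finite J"
    and K: "\<And>c w. c \<in> \<Omega> \<Longrightarrow> w \<in> M \<Longrightarrow> is_pmf S (K (cw c w))"
    and V: "\<And>j w. j \<in> J \<Longrightarrow> w \<in> M \<Longrightarrow> finite (V j w)"
    and L: "\<And>j x y. j \<in> J \<Longrightarrow> 0 \<le> L j x y"
    and pos: "\<And>j c w y. j \<in> J \<Longrightarrow> c \<in> \<Omega> \<Longrightarrow> w \<in> M \<Longrightarrow> y \<in> S \<Longrightarrow> 0 < P c \<Longrightarrow> 0 < K (cw c w) y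
               \<Longrightarrow> 0 < L j (cw c w) y"
    and s: "\<And>j. j \<in> J \<Longrightarrow> 0 < s j"
    and sent: "\<And>j w. j \<in> J \<Longrightarrow> w \<in> M \<Longrightarrow>
        wsum \<Omega> P (\<lambda>c. wsum S (K (cw c w)) (\<lambda>y. (2 powr g j / L j (cw c w) y) powr s j)) \<le> \<rho> j"
    and rival: "\<And>j w w'. j \<in> J \<Longrightarrow> w \<in> M \<Longrightarrow> w' \<in> V j w \<Longrightarrow>
        wsum \<Omega> P (\<lambda>c. wsum S (K (cw c w)) (\<lambda>y. L j (cw c w') y)) \<le> 1"
  shows "\<exists>C\<in>Pi\<^sub>E {..<n} (\<lambda>_. \<Omega>).
      (\<Sum>w\<in>M. wsum (Pi\<^sub>E {..<n} (\<lambda>_. S)) (\<lambda>y. \<Prod>k<n. K (cw (C k) w) (y k))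
         (\<lambda>y. \<Sum>j\<in>J. of_bool (confusable n (g j) (L j) (\<lambda>k. cw (C k)) (V j w) w y)))
      \<le> (\<Sum>w\<in>M. \<Sum>j\<in>J. \<rho> j ^ n + real (card (V j w)) * 2 powr (- (real n * g j)))"
proof -
  let ?C = "Pi\<^sub>E {..<n} (\<lambda>_. \<Omega>)" and ?P = "\<lambda>C. \<Prod>k<n. P (C k)"
  let ?Y = "Pi\<^sub>E {..<n} (\<lambda>_. S)" and ?K = "\<lambda>w C y. \<Prod>k<n. K (cw (C k) w) (y k)"
  let ?E = "\<lambda>w f. wsum ?C ?P (\<lambda>C. wsum ?Y (?K w C) (f C))"
  let ?bad = "\<lambda>j w C y. confusable n (g j) (L j) (\<lambda>k. cw (C k)) (V j w) w y"
  note fin\<Omega> = is_pmf_finite[OF \<Omega>]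
  have pmfC: "is_pmf ?C ?P" by (rule is_pmf_PiE) (use \<Omega> in auto)
  have Pnn: "0 \<le> ?P C" if "C \<in> ?C" for C using is_pmf_nonneg[OF pmfC that] .
  have Knn: "0 \<le> ?K w C y" if "C \<in> ?C" "w \<in> M" "y \<in> ?Y" for C w y
    using that by (intro prod_nonneg) (auto intro!: is_pmf_nonneg[OF K])
  have P0: "0 \<le> P c" if "c \<in> \<Omega>" for c
    using is_pmf_nonneg[OF \<Omega> that] .
  have K0: "0 \<le> K (cw c w) y" if "c \<in> \<Omega>" "w \<in> M" "y \<in> S" for c w y
    using is_pmf_nonneg[OF K[OF that(1,2)] that(3)] .
  have bound: "?E w (\<lambda>C y. of_bool (?bad j w C y))
      \<le> \<rho> j ^ n + real (card (V j w)) * 2 powr (- (real n * g j))"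
    if j: "j \<in> J" and w: "w \<in> M" for j w
  proof -
    let ?lo = "\<lambda>C y. \<Prod>k<n. (2 powr g j / L j (cw (C k) w) (y k)) powr s j"
    let ?hi = "\<lambda>w' C y. 2 powr (- (real n * g j)) * (\<Prod>k<n. L j (cw (C k) w') (y k))"
    have "?E w (\<lambda>C y. of_bool (?bad j w C y)) \<le> ?E w (\<lambda>C y. ?lo C y + (\<Sum>w'\<in>V j w. ?hi w' C y))"
    proof (intro wsum_mono Pnn Knn[OF _ w])
      fix C y assume C: "C \<in> ?C" and PC: "0 < ?P C" and y: "y \<in> ?Y" and Ky: "0 < ?K w C y"
      \<comment> \<open>Positive weight of the whole block puts each letter in the support. This
        matters because a vanishing density would turn the quotient in \<open>?lo\<close> into 0 by
        the division convention, and \<open>?lo\<close> would no longer dominate the failure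
        event.\<close>
      have Lpos: "0 < L j (cw (C k) w) (y k)" if k: "k < n" for k
      proof (rule pos[OF j _ w])
        show "C k \<in> \<Omega>" "y k \<in> S" using C y k by auto
        have "P (C k) \<noteq> 0" "K (cw (C k) w) (y k) \<noteq> 0" using PC Ky k by (metis finite_lessThan lessThan_iff less_irrefl prod_zero)+
        then show "0 < P (C k)" "0 < K (cw (C k) w) (y k)"
          using is_pmf_nonneg[OF \<Omega>, of "C k"] is_pmf_nonneg[OF K, of "C k" w "y k"] C w y k
          by (auto simp: PiE_iff order_less_le)
      qed
      have lo: "of_bool ((\<Prod>k<n. L j (cw (C k) w) (y k)) < 2 powr (real n * g j)) \<le> ?lo C y"
      proof -
        have "?lo C y = (\<Prod>k<n. 2 powr g j / L j (cw (C k) w) (y k)) powr s j"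
          by (rule prod_powr_distrib[symmetric])
        also have "(\<Prod>k<n. 2 powr g j / L j (cw (C k) w) (y k))
            = 2 powr (real n * g j) / (\<Prod>k<n. L j (cw (C k) w) (y k))"
          by (simp add: prod_dividef powr_realpow[symmetric] powr_powr mult.commute)
        finally have eq: "?lo C y = (2 powr (real n * g j) / (\<Prod>k<n. L j (cw (C k) w) (y k))) powr s j" .
        have "0 < (\<Prod>k<n. L j (cw (C k) w) (y k))" using Lpos by (intro prod_pos) auto
        then show ?thesis
          unfolding eq using s[OF j] by (auto simp: of_bool_def intro!: ge_one_powr_ge_zero)
      qed
      have hi: "of_bool (2 powr (real n * g j) \<le> (\<Prod>k<n. L j (cw (C k) w') (y k))) \<le> ?hi w' C y" for w'
      proof (cases "2 powr (real n * g j) \<le> (\<Prod>k<n. L j (cw (C k) w') (y k))")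
        case True
        then have "2 powr (- (real n * g j)) * 2 powr (real n * g j) \<le> ?hi w' C y"
          by (intro mult_left_mono) auto
        then show ?thesis using True by (simp flip: powr_add)
      qed (auto intro!: mult_nonneg_nonneg prod_nonneg L j)
      have nn: "0 \<le> ?lo C y" "\<And>w'. 0 \<le> ?hi w' C y"
        by (auto intro!: mult_nonneg_nonneg prod_nonneg L j)
      show "of_bool (?bad j w C y) \<le> ?lo C y + (\<Sum>w'\<in>V j w. ?hi w' C y)"
      proof (cases "(\<Prod>k<n. L j (cw (C k) w) (y k)) < 2 powr (real n * g j)")
        case True
        then have "1 \<le> ?lo C y" using lo by simp
        moreover have "0 \<le> (\<Sum>w'\<in>V j w. ?hi w' C y)" by (intro sum_nonneg nn)
        ultimately show ?thesis by (simp add: of_bool_def)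
      next
        case False
        show ?thesis
        proof (cases "?bad j w C y")
          case True
          then obtain w' where w': "w' \<in> V j w" "2 powr (real n * g j) \<le> (\<Prod>k<n. L j (cw (C k) w') (y k))"
            using False unfolding confusable_def by blast
          then have "1 \<le> ?hi w' C y" using hi[of w'] by simp
          also have "\<dots> \<le> (\<Sum>w'\<in>V j w. ?hi w' C y)"
            by (rule member_le_sum) (use w' V j w nn in auto)
          finally show ?thesis using nn(1) by (simp add: of_bool_def)
        next
          case False
          then show ?thesis using nn by (simp add: sum_nonneg)
        qed
      qed
    qed
    also have "\<dots> = ?E w ?lo + (\<Sum>w'\<in>V j w. ?E w (?hi w'))"
      by (simp only: wsum_add wsum_sum)
    also have "\<dots> \<le> \<rho> j ^ n + (\<Sum>w'\<in>V j w. 2 powr (- (real n * g j)))"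
    proof (rule add_mono)
      have "?E w ?lo = wsum \<Omega> P (\<lambda>c. wsum S (K (cw c w)) (\<lambda>y. (2 powr g j / L j (cw c w) y) powr s j)) ^ n"
        by (rule wsum_iterated_PiE[OF fin\<Omega> S, where K="\<lambda>c. K (cw c w)"
              and h="\<lambda>c y. (2 powr g j / L j (cw c w) y) powr s j"])
      also have "\<dots> \<le> \<rho> j ^ n"
        by (rule power_mono[OF sent[OF j w]]) (intro wsum_nonneg P0 K0[OF _ w] powr_ge_zero)
      finally show "?E w ?lo \<le> \<rho> j ^ n" .
    next
      show "(\<Sum>w'\<in>V j w. ?E w (?hi w')) \<le> (\<Sum>w'\<in>V j w. 2 powr (- (real n * g j)))"
      proof (rule sum_mono)
        fix w' assume w': "w' \<in> V j w"
        let ?r = "wsum \<Omega> P (\<lambda>c. wsum S (K (cw c w)) (\<lambda>y. L j (cw c w') y))"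
        have "?E w (?hi w') = 2 powr (- (real n * g j)) * ?E w (\<lambda>C y. \<Prod>k<n. L j (cw (C k) w') (y k))"
          by (simp only: wsum_cmult)
        moreover have "?E w (\<lambda>C y. \<Prod>k<n. L j (cw (C k) w') (y k)) = ?r ^ n"
          by (rule wsum_iterated_PiE[OF fin\<Omega> S, where K="\<lambda>c. K (cw c w)" and h="\<lambda>c y. L j (cw c w') y"])
        moreover have "?r ^ n \<le> 1"
          by (rule power_le_one[OF _ rival[OF j w w']]) (intro wsum_nonneg P0 K0[OF _ w] L[OF j])
        ultimately show "?E w (?hi w') \<le> 2 powr (- (real n * g j))" by simp
      qed
    qed
    finally show ?thesis by simp
  qed
  let ?tot = "\<lambda>C. \<Sum>w\<in>M. wsum ?Y (?K w C) (\<lambda>y. \<Sum>j\<in>J. of_bool (?bad j w C y))"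
  from exists_le_wsum[OF pmfC, of ?tot] obtain C where C: "C \<in> ?C" "?tot C \<le> wsum ?C ?P ?tot"
    by (elim bexE)
  note C(2)
  also have "wsum ?C ?P ?tot = (\<Sum>w\<in>M. \<Sum>j\<in>J. ?E w (\<lambda>C y. of_bool (?bad j w C y)))"
    by (simp only: wsum_sum)
  also have "\<dots> \<le> (\<Sum>w\<in>M. \<Sum>j\<in>J. \<rho> j ^ n + real (card (V j w)) * 2 powr (- (real n * g j)))"
    by (intro sum_mono bound)
  finally show ?thesis by (rule bexI[OF _ C(1)])
qed

section \<open>Wrong message pairs, sorted by the messages in which they differ from the sent
  pair\<close>

datatype contention = First | Second | Both

text \<open>The classes are kept apart because each one has its own fresh letters, hence its own
  change of measure and its own exponent.\<close>

fun rivals :: "contention \<Rightarrow> nat \<Rightarrow> nat \<Rightarrow> nat \<times> nat \<Rightarrow> (nat \<times> nat) set" where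
  "rivals First Ma Mb (wa, wb) = ({..<Ma} - {wa}) \<times> {wb}"
| "rivals Second Ma Mb (wa, wb) = {wa} \<times> ({..<Mb} - {wb})"
| "rivals Both Ma Mb (wa, wb) = ({..<Ma} - {wa}) \<times> ({..<Mb} - {wb})"

fun num_rivals :: "contention \<Rightarrow> nat \<Rightarrow> nat \<Rightarrow> nat" where
  "num_rivals First Ma Mb = Ma"
| "num_rivals Second Ma Mb = Mb"
| "num_rivals Both Ma Mb = Ma * Mb"

lemma finite_rivals: "finite (rivals c Ma Mb w)"
  by (cases c; cases w) auto

lemma card_rivals_le: "card (rivals c Ma Mb w) \<le> num_rivals c Ma Mb"
proof -
  obtain wa wb where w: "w = (wa, wb)" by force
  have d: "card ({..<k} - {i}) \<le> k" for k i :: nat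
    using card_mono[of "{..<k}" "{..<k} - {i}"] by auto
  show ?thesis
    by (cases c) (simp_all add: w card_cartesian_product mult_le_mono d)
qed

text \<open>\<open>q\<close> is part of every word: it is common knowledge, and every density is
  conditioned on it. The letter \<open>u\<close> belongs to the pair and therefore changes as soon
  as one of the messages does.\<close>

fun word :: "'q \<times> (nat \<times> nat \<Rightarrow> 'u) \<times> (nat \<Rightarrow> 'v) \<times> (nat \<Rightarrow> 't) \<Rightarrow> nat \<times> nat \<Rightarrow> 'q \<times> 'u \<times> 'v \<times> 't" where
  "word (q, u, v, t) (wa, wb) = (q, u (wa, wb), v wa, t wb)"

section \<open>The random code ensemble and its one-letter averages\<close>

locale ensemble =
  fixes Q :: "'q set" and pq :: "'q \<Rightarrow> real"
    and U :: "'u set" and pu :: "'q \<Rightarrow> 'u \<Rightarrow> real"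
    and V :: "'v set" and pv :: "'q \<Rightarrow> 'v \<Rightarrow> real"
    and T :: "'t set" and pt :: "'q \<Rightarrow> 't \<Rightarrow> real"
  assumes Q: "is_pmf Q pq"
    and U: "q \<in> Q \<Longrightarrow> is_pmf U (pu q)"
    and V: "q \<in> Q \<Longrightarrow> is_pmf V (pv q)"
    and T: "q \<in> Q \<Longrightarrow> is_pmf T (pt q)"
begin

definition mean :: "('q \<times> 'u \<times> 'v \<times> 't \<Rightarrow> real) \<Rightarrow> real" where
  "mean F = wsum Q pq (\<lambda>q. wsum U (pu q) (\<lambda>u. wsum V (pv q) (\<lambda>v. wsum T (pt q) (\<lambda>t. F (q, u, v, t)))))"

text \<open>A column: everything the code uses at one time, for all messages at once. Columns are
  independent over time, whereas codewords of different messages are independent only given the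
  time-sharing letters.\<close>

definition letters :: "nat \<Rightarrow> nat \<Rightarrow> ('q \<times> (nat \<times> nat \<Rightarrow> 'u) \<times> (nat \<Rightarrow> 'v) \<times> (nat \<Rightarrow> 't)) set" where
  "letters Ma Mb = Q \<times> (Pi\<^sub>E ({..<Ma} \<times> {..<Mb}) (\<lambda>_. U) \<times> (Pi\<^sub>E {..<Ma} (\<lambda>_. V) \<times> Pi\<^sub>E {..<Mb} (\<lambda>_. T)))"

definition letter_prob :: "nat \<Rightarrow> nat \<Rightarrow> 'q \<times> (nat \<times> nat \<Rightarrow> 'u) \<times> (nat \<Rightarrow> 'v) \<times> (nat \<Rightarrow> 't) \<Rightarrow> real" where
  "letter_prob Ma Mb = (\<lambda>(q, r). pq q * (\<lambda>(u, r). (\<Prod>w\<in>{..<Ma} \<times> {..<Mb}. pu q (u w)) *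
     (\<lambda>(v, t). (\<Prod>w<Ma. pv q (v w)) * (\<Prod>w<Mb. pt q (t w))) r) r)"

lemma wsum_letters:
  "wsum (letters Ma Mb) (letter_prob Ma Mb) F =
     wsum Q pq (\<lambda>q.
       wsum (Pi\<^sub>E ({..<Ma} \<times> {..<Mb}) (\<lambda>_. U)) (\<lambda>u. \<Prod>w\<in>{..<Ma} \<times> {..<Mb}. pu q (u w)) (\<lambda>u.
         wsum (Pi\<^sub>E {..<Ma} (\<lambda>_. V)) (\<lambda>v. \<Prod>w<Ma. pv q (v w)) (\<lambda>v.
           wsum (Pi\<^sub>E {..<Mb} (\<lambda>_. T)) (\<lambda>t. \<Prod>w<Mb. pt q (t w)) (\<lambda>t. F (q, u, v, t)))))"
  unfolding letters_def letter_prob_def wsum_Times ..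

lemma is_pmf_letters: "is_pmf (letters Ma Mb) (letter_prob Ma Mb)"
  unfolding letters_def letter_prob_def
  by (intro is_pmf_Times is_pmf_PiE Q) (auto simp: U V T)

lemma word_in:
  "c \<in> letters Ma Mb \<Longrightarrow> w \<in> {..<Ma} \<times> {..<Mb} \<Longrightarrow> word c w \<in> Q \<times> U \<times> V \<times> T"
  by (cases c; cases w) (auto simp: letters_def)

lemma word_prob_pos:
  assumes c: "c \<in> letters Ma Mb" and pos: "0 < letter_prob Ma Mb c" and w: "w \<in> {..<Ma} \<times> {..<Mb}"
    and x: "word c w = (q, u, v, t)"
  shows "0 < pq q" "0 < pu q u" "0 < pv q v" "0 < pt q t"
proof -
  obtain wa wb where w': "w = (wa, wb)" "wa < Ma" "wb < Mb" using w by force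
  obtain q' u' v' t' where c': "c = (q', u', v', t')" by (cases c)
  have xs: "q' = q" "u' (wa, wb) = u" "v' wa = v" "t' wb = t" using x by (simp_all add: c' w')
  have q: "q \<in> Q" "u \<in> U" "v \<in> V" "t \<in> T" using word_in[OF c w] by (simp_all add: x)
  have "letter_prob Ma Mb c \<noteq> 0" using pos by simp
  then have "pq q \<noteq> 0" "pu q (u' (wa, wb)) \<noteq> 0" "pv q (v' wa) \<noteq> 0" "pt q (t' wb) \<noteq> 0"
    using w' by (auto simp: letter_prob_def c' xs(1))
  then have "pq q \<noteq> 0" "pu q u \<noteq> 0" "pv q v \<noteq> 0" "pt q t \<noteq> 0"
    by (simp_all add: xs)
  then show "0 < pq q" "0 < pu q u" "0 < pv q v" "0 < pt q t"
    using is_pmf_nonneg[OF Q q(1)] is_pmf_nonneg[OF U[OF q(1)] q(2)]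
      is_pmf_nonneg[OF V[OF q(1)] q(3)] is_pmf_nonneg[OF T[OF q(1)] q(4)] by auto
qed

lemma wsum_letters_word:
  assumes "w \<in> {..<Ma} \<times> {..<Mb}"
  shows "wsum (letters Ma Mb) (letter_prob Ma Mb) (\<lambda>c. F (word c w)) = mean F"
proof -
  obtain wa wb where w: "w = (wa, wb)" "wa < Ma" "wb < Mb" using assms by force
  show ?thesis
    unfolding wsum_letters mean_def w word.simps
  proof (rule wsum_cong)
    fix q assume q: "q \<in> Q"
    note T' = wsum_PiE_component[OF finite_lessThan T[OF q], of wb Mb]
    note V' = wsum_PiE_component[OF finite_lessThan V[OF q], of wa Ma]
    note U' = wsum_PiE_component[OF _ U[OF q], of "{..<Ma} \<times> {..<Mb}" "(wa, wb)"]
    show "wsum (Pi\<^sub>E ({..<Ma} \<times> {..<Mb}) (\<lambda>_. U)) (\<lambda>u. \<Prod>w\<in>{..<Ma} \<times> {..<Mb}. pu q (u w)) (\<lambda>u.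
         wsum (Pi\<^sub>E {..<Ma} (\<lambda>_. V)) (\<lambda>v. \<Prod>w<Ma. pv q (v w)) (\<lambda>v.
           wsum (Pi\<^sub>E {..<Mb} (\<lambda>_. T)) (\<lambda>t. \<Prod>w<Mb. pt q (t w)) (\<lambda>t. F (q, u (wa, wb), v wa, t wb))))
        = wsum U (pu q) (\<lambda>u. wsum V (pv q) (\<lambda>v. wsum T (pt q) (\<lambda>t. F (q, u, v, t))))"
      using w
      by (simp add: T'[where G="\<lambda>t. F (q, _, _, t)"] 
          V'[where G="\<lambda>v. wsum T (pt q) (\<lambda>t. F (q, _, v, t))"]
          U'[where G="\<lambda>u. wsum V (pv q) (\<lambda>v. wsum T (pt q) (\<lambda>t. F (q, u, v, t)))"])
  qed auto
qed

end

text \<open>Moves the fresh letters of the rival inside the channel sum, so that the rival is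
  averaged for a fixed output. The sets and weights of the rival have names of their own, although
  they will be instantiated with those of the sent pair: this way the swaps move only the sums of
  the rival.\<close>

lemma wsum_swap_rivals:
  "wsum U p (\<lambda>u. wsum U' p' (\<lambda>u'. wsum V r (\<lambda>v. wsum V' r' (\<lambda>v'. wsum T a (\<lambda>t. wsum T' a' (\<lambda>t'.
     wsum S (K u v t) (\<lambda>y. f u' v' t' y)))))))
   = wsum U p (\<lambda>u. wsum V r (\<lambda>v. wsum T a (\<lambda>t. wsum S (K u v t) (\<lambda>y.
       wsum U' p' (\<lambda>u'. wsum V' r' (\<lambda>v'. wsum T' a' (\<lambda>t'. f u' v' t' y)))))))"
  by (simp only: wsum_swap[of U' p' V r] wsum_swap[of U' p' T a] wsum_swap[of U' p' S b for b]
      wsum_swap[of V' r' T a] wsum_swap[of V' r' S b for b] wsum_swap[of T' a' S b for b])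

lemma wsum_swap_rivals_first:
  "wsum U p (\<lambda>u. wsum U' p' (\<lambda>u'. wsum V r (\<lambda>v. wsum V' r' (\<lambda>v'. wsum T a (\<lambda>t.
     wsum S (K u v t) (\<lambda>y. f u' v' t y))))))
   = wsum U p (\<lambda>u. wsum V r (\<lambda>v. wsum T a (\<lambda>t. wsum S (K u v t) (\<lambda>y.
       wsum U' p' (\<lambda>u'. wsum V' r' (\<lambda>v'. f u' v' t y))))))"
  by (simp only: wsum_swap[of U' p' V r] wsum_swap[of U' p' T a] wsum_swap[of U' p' S b for b]
      wsum_swap[of V' r' T a] wsum_swap[of V' r' S b for b])

lemma wsum_swap_rivals_second:
  "wsum U p (\<lambda>u. wsum U' p' (\<lambda>u'. wsum V r (\<lambda>v. wsum T a (\<lambda>t. wsum T' a' (\<lambda>t'.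
     wsum S (K u v t) (\<lambda>y. f u' v t' y))))))
   = wsum U p (\<lambda>u. wsum V r (\<lambda>v. wsum T a (\<lambda>t. wsum S (K u v t) (\<lambda>y.
       wsum U' p' (\<lambda>u'. wsum T' a' (\<lambda>t'. f u' v t' y))))))"
  by (simp only: wsum_swap[of U' p' V r] wsum_swap[of U' p' T a] wsum_swap[of U' p' S b for b]
      wsum_swap[of T' a' S b for b])

context ensemble
begin

text \<open>The conditional mean over the letters of a rival, given those of the sent pair.
  \<open>u\<close> is redrawn in every class, since it is indexed by the pair; \<open>v\<close> or
  \<open>t\<close> is kept where the message agrees.\<close>

fun rival_mean :: "contention \<Rightarrow> 'q \<times> 'u \<times> 'v \<times> 't \<Rightarrow> ('q \<times> 'u \<times> 'v \<times> 't \<Rightarrow> real) \<Rightarrow> real" where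
  "rival_mean First (q, u, v, t) F = wsum U (pu q) (\<lambda>u'. wsum V (pv q) (\<lambda>v'. F (q, u', v', t)))"
| "rival_mean Second (q, u, v, t) F = wsum U (pu q) (\<lambda>u'. wsum T (pt q) (\<lambda>t'. F (q, u', v, t')))"
| "rival_mean Both (q, u, v, t) F =
     wsum U (pu q) (\<lambda>u'. wsum V (pv q) (\<lambda>v'. wsum T (pt q) (\<lambda>t'. F (q, u', v', t'))))"

text \<open>Given \<open>q\<close>, the letters at two distinct indices are independent, and a
  message on which both pairs agree contributes one common letter. So two components are extracted
  where the pairs differ and one component where they agree.\<close>

lemma wsum_letters_rival:
  assumes w: "w \<in> {..<Ma} \<times> {..<Mb}" and w': "w' \<in> rivals c Ma Mb w"
  shows "wsum (letters Ma Mb) (letter_prob Ma Mb) (\<lambda>l. wsum S (K (word l w)) (\<lambda>y. L (word l w') y))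
       = mean (\<lambda>x. wsum S (K x) (\<lambda>y. rival_mean c x (\<lambda>x'. L x' y)))"
proof -
  obtain wa wb wa' wb' where [simp]: "w = (wa, wb)" "w' = (wa', wb')" by (cases w; cases w')
  have lt: "wa < Ma" "wb < Mb" using w by auto
  let ?I = "{..<Ma} \<times> {..<Mb}"
  show ?thesis
    unfolding wsum_letters mean_def \<open>w = _\<close> \<open>w' = _\<close> word.simps
  proof (rule wsum_cong)
    fix q assume q: "q \<in> Q"
    note T1 = wsum_PiE_component[OF finite_lessThan T[OF q], of wb Mb]
    note T2 = wsum_PiE_two_components[OF finite_lessThan T[OF q], of wb Mb wb']
    note V1 = wsum_PiE_component[OF finite_lessThan V[OF q], of wa Ma]
    note V2 = wsum_PiE_two_components[OF finite_lessThan V[OF q], of wa Ma wa']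
    note U2 = wsum_PiE_two_components[OF _ U[OF q], of ?I "(wa, wb)" j for j]
    let ?F = "\<lambda>u v t u' v' t'. wsum S (K (q, u, v, t)) (L (q, u', v', t'))"
    let ?PT = "wsum T (pt q)" and ?PV = "wsum V (pv q)" and ?PU = "wsum U (pu q)"
    show "wsum (Pi\<^sub>E ?I (\<lambda>_. U)) (\<lambda>u. \<Prod>w\<in>?I. pu q (u w)) (\<lambda>u.
         wsum (Pi\<^sub>E {..<Ma} (\<lambda>_. V)) (\<lambda>v. \<Prod>w<Ma. pv q (v w)) (\<lambda>v.
           wsum (Pi\<^sub>E {..<Mb} (\<lambda>_. T)) (\<lambda>t. \<Prod>w<Mb. pt q (t w)) (\<lambda>t.
             ?F (u (wa, wb)) (v wa) (t wb) (u (wa', wb')) (v wa') (t wb'))))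
        = ?PU (\<lambda>u. ?PV (\<lambda>v. ?PT (\<lambda>t.
            wsum S (K (q, u, v, t)) (\<lambda>y. rival_mean c (q, u, v, t) (\<lambda>x'. L x' y)))))"
    proof (cases c)
      case First
      then have n: "wa' < Ma" "wa \<noteq> wa'" "wb' = wb" using w' by auto
      show ?thesis
        using lt n First
        by (simp add: T1[where G="\<lambda>t. ?F _ _ t _ _ t"]
            V2[where G="\<lambda>v v'. ?PT (\<lambda>t. ?F _ v t _ v' t)"]
            U2[where G="\<lambda>u u'. ?PV (\<lambda>v. ?PV (\<lambda>v'. ?PT (\<lambda>t. ?F u v t u' v' t)))"]
            wsum_swap_rivals_first)
    next
      case Second
      then have n: "wb' < Mb" "wb \<noteq> wb'" "wa' = wa" using w' by auto
      show ?thesis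
        using lt n Second
        by (simp add: T2[where G="\<lambda>t t'. ?F _ _ t _ _ t'"]
            V1[where G="\<lambda>v. ?PT (\<lambda>t. ?PT (\<lambda>t'. ?F _ v t _ v t'))"]
            U2[where G="\<lambda>u u'. ?PV (\<lambda>v. ?PT (\<lambda>t. ?PT (\<lambda>t'. ?F u v t u' v t')))"]
            wsum_swap_rivals_second)
    next
      case Both
      then have n: "wb' < Mb" "wb \<noteq> wb'" "wa' < Ma" "wa \<noteq> wa'" using w' by auto
      show ?thesis
        using lt n Both
        by (simp add: T2[where G="\<lambda>t t'. ?F _ _ t _ _ t'"]
            V2[where G="\<lambda>v v'. ?PT (\<lambda>t. ?PT (\<lambda>t'. ?F _ v t _ v' t'))"]
            U2[where G="\<lambda>u u'. ?PV (\<lambda>v. ?PV (\<lambda>v'. ?PT (\<lambda>t. ?PT (\<lambda>t'. ?F u v t u' v' t'))))"]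
            wsum_swap_rivals)
    qed
  qed auto
qed

lemma mean_mono:
  assumes "\<And>q u v t. q \<in> Q \<Longrightarrow> u \<in> U \<Longrightarrow> v \<in> V \<Longrightarrow> t \<in> T \<Longrightarrow> F (q, u, v, t) \<le> G (q, u, v, t)"
  shows "mean F \<le> mean G"
  unfolding mean_def
  by (intro wsum_mono assms) (auto intro: is_pmf_nonneg[OF Q] is_pmf_nonneg[OF U] is_pmf_nonneg[OF V] is_pmf_nonneg[OF T])

lemma mean_one: "mean (\<lambda>_. 1) = 1"
proof -
  have "mean (\<lambda>_. 1) = wsum Q pq (\<lambda>_. 1)"
    unfolding mean_def by (rule wsum_cong) (auto simp: U V T)
  then show ?thesis by (simp add: Q)
qed

text \<open>At time \<open>k\<close>, the symbol triple of message pair \<open>(wa, wb)\<close> is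
  \<open>(u k (wa, wb), v k wa, t k wb)\<close>.\<close>

definition codebook :: "nat \<Rightarrow> nat \<Rightarrow> nat \<Rightarrow> (nat \<Rightarrow> 'q \<times> (nat \<times> nat \<Rightarrow> 'u) \<times> (nat \<Rightarrow> 'v) \<times> (nat \<Rightarrow> 't)) set" where
  "codebook n Ma Mb = Pi\<^sub>E {..<n} (\<lambda>_. letters Ma Mb)"

text \<open>The bound on rivals is required for each fixed sent word and output; averaging it over
  these keeps the bound 1, because their law has total mass one.\<close>

lemma codebook_exists:
  fixes K :: "'q \<times> 'u \<times> 'v \<times> 't \<Rightarrow> 'y \<Rightarrow> real" and L :: "'j \<Rightarrow> 'q \<times> 'u \<times> 'v \<times> 't \<Rightarrow> 'y \<Rightarrow> real"
  assumes J: "finite J" and S: "finite S"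
    and K: "\<And>x. x \<in> Q \<times> U \<times> V \<times> T \<Longrightarrow> is_pmf S (K x)"
    and L: "\<And>j x y. j \<in> J \<Longrightarrow> 0 \<le> L j x y"
    and pos: "\<And>j q u v t y. j \<in> J \<Longrightarrow> (q, u, v, t) \<in> Q \<times> U \<times> V \<times> T \<Longrightarrow> y \<in> S \<Longrightarrow> 0 < pq q \<Longrightarrow> 0 < pu q u
       \<Longrightarrow> 0 < pv q v \<Longrightarrow> 0 < pt q t \<Longrightarrow> 0 < K (q, u, v, t) y \<Longrightarrow> 0 < L j (q, u, v, t) y"
    and s: "\<And>j. j \<in> J \<Longrightarrow> 0 < s j"
    and sent: "\<And>j. j \<in> J \<Longrightarrow>
       mean (\<lambda>x. wsum S (K x) (\<lambda>y. (2 powr g j / L j x y) powr s j)) \<le> \<rho> j"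
    and rival: "\<And>j x y. j \<in> J \<Longrightarrow> x \<in> Q \<times> U \<times> V \<times> T \<Longrightarrow> y \<in> S \<Longrightarrow>
       rival_mean (cls j) x (\<lambda>x'. L j x' y) \<le> 1"
  shows "\<exists>C\<in>codebook n Ma Mb.
      (\<Sum>w\<in>{..<Ma} \<times> {..<Mb}. wsum (Pi\<^sub>E {..<n} (\<lambda>_. S)) (\<lambda>y. \<Prod>k<n. K (word (C k) w) (y k))
         (\<lambda>y. \<Sum>j\<in>J. of_bool (confusable n (g j) (L j) (\<lambda>k. word (C k)) (rivals (cls j) Ma Mb w) w y)))
      \<le> real (Ma * Mb) * (\<Sum>j\<in>J. \<rho> j ^ n + real (num_rivals (cls j) Ma Mb) * 2 powr (- (real n * g j)))"
proof -
  let ?M = "{..<Ma} \<times> {..<Mb}"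
  have "\<exists>C\<in>Pi\<^sub>E {..<n} (\<lambda>_. letters Ma Mb).
      (\<Sum>w\<in>?M. wsum (Pi\<^sub>E {..<n} (\<lambda>_. S)) (\<lambda>y. \<Prod>k<n. K (word (C k) w) (y k))
         (\<lambda>y. \<Sum>j\<in>J. of_bool (confusable n (g j) (L j) (\<lambda>k. word (C k)) (rivals (cls j) Ma Mb w) w y)))
      \<le> (\<Sum>w\<in>?M. \<Sum>j\<in>J. \<rho> j ^ n + real (card (rivals (cls j) Ma Mb w)) * 2 powr (- (real n * g j)))"
  proof (rule random_coding[where V="\<lambda>j. rivals (cls j) Ma Mb", OF is_pmf_letters S J _ _ L _ s])
    fix c w assume c: "c \<in> letters Ma Mb" and w: "w \<in> ?M"
    show "is_pmf S (K (word c w))" by (rule K) (rule word_in[OF c w])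
    fix j y assume j: "j \<in> J" and y: "y \<in> S" and p: "0 < letter_prob Ma Mb c" and k: "0 < K (word c w) y"
    obtain q u v t where x: "word c w = (q, u, v, t)" by (cases "word c w")
    show "0 < L j (word c w) y"
      unfolding x
      by (rule pos[OF j]) (use word_in[OF c w] word_prob_pos[OF c p w x] y k in \<open>auto simp: x\<close>)
  next
    fix j w assume j: "j \<in> J" and w: "w \<in> ?M"
    show "finite (rivals (cls j) Ma Mb w)" by (rule finite_rivals)
    show "wsum (letters Ma Mb) (letter_prob Ma Mb)
        (\<lambda>c. wsum S (K (word c w)) (\<lambda>y. (2 powr g j / L j (word c w) y) powr s j)) \<le> \<rho> j"
      using sent[OF j] wsum_letters_word[OF w, of "\<lambda>x. wsum S (K x) (\<lambda>y. (2 powr g j / L j x y) powr s j)"]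
      by simp
    fix w' assume w': "w' \<in> rivals (cls j) Ma Mb w"
    have "mean (\<lambda>x. wsum S (K x) (\<lambda>y. rival_mean (cls j) x (\<lambda>x'. L j x' y))) \<le> mean (\<lambda>_. 1)"
    proof (rule mean_mono)
      fix q u v t assume "q \<in> Q" "u \<in> U" "v \<in> V" "t \<in> T"
      then have x: "(q, u, v, t) \<in> Q \<times> U \<times> V \<times> T" by simp
      have "wsum S (K (q, u, v, t)) (\<lambda>y. rival_mean (cls j) (q, u, v, t) (\<lambda>x'. L j x' y))
          \<le> wsum S (K (q, u, v, t)) (\<lambda>_. 1)"
        by (intro wsum_mono rival[OF j x]) (use is_pmf_nonneg[OF K[OF x]] in auto)
      then show "wsum S (K (q, u, v, t)) (\<lambda>y. rival_mean (cls j) (q, u, v, t) (\<lambda>x'. L j x' y)) \<le> 1"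
        using K[OF x] by simp
    qed
    then show "wsum (letters Ma Mb) (letter_prob Ma Mb)
        (\<lambda>c. wsum S (K (word c w)) (\<lambda>y. L j (word c w') y)) \<le> 1"
      unfolding wsum_letters_rival[OF w w'] mean_one .
  qed
  then obtain C where C: "C \<in> Pi\<^sub>E {..<n} (\<lambda>_. letters Ma Mb)" and le:
    "(\<Sum>w\<in>?M. wsum (Pi\<^sub>E {..<n} (\<lambda>_. S)) (\<lambda>y. \<Prod>k<n. K (word (C k) w) (y k))
         (\<lambda>y. \<Sum>j\<in>J. of_bool (confusable n (g j) (L j) (\<lambda>k. word (C k)) (rivals (cls j) Ma Mb w) w y)))
      \<le> (\<Sum>w\<in>?M. \<Sum>j\<in>J. \<rho> j ^ n + real (card (rivals (cls j) Ma Mb w)) * 2 powr (- (real n * g j)))"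
    by blast
  note le
  also have "(\<Sum>w\<in>?M. \<Sum>j\<in>J. \<rho> j ^ n + real (card (rivals (cls j) Ma Mb w)) * 2 powr (- (real n * g j)))
      \<le> (\<Sum>w\<in>?M. \<Sum>j\<in>J. \<rho> j ^ n + real (num_rivals (cls j) Ma Mb) * 2 powr (- (real n * g j)))"
    by (intro sum_mono add_mono mult_right_mono) (auto simp: card_rivals_le)
  also have "\<dots> = real (Ma * Mb) * (\<Sum>j\<in>J. \<rho> j ^ n + real (num_rivals (cls j) Ma Mb) * 2 powr (- (real n * g j)))"
    by simp
  finally show ?thesis using C unfolding codebook_def by blast
qed

text \<open>The letters and the output as a single mass function, because the Chernoff estimate is
  made on one sample space; its nested shape is that of \<open>wsum_Times\<close>.\<close>

definition joint :: "('q \<times> 'u \<times> 'v \<times> 't \<Rightarrow> 'y \<Rightarrow> real) \<Rightarrow> 'q \<times> 'u \<times> 'v \<times> 't \<times> 'y \<Rightarrow> real" where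
  "joint K = (\<lambda>(q, r). pq q * (\<lambda>(u, r). pu q u * (\<lambda>(v, r). pv q v *
     (\<lambda>(t, y). pt q t * K (q, u, v, t) y) r) r) r)"

lemma wsum_joint:
  "wsum (Q \<times> (U \<times> (V \<times> (T \<times> S)))) (joint K) (\<lambda>(q, u, v, t, y). F (q, u, v, t) y)
     = mean (\<lambda>x. wsum S (K x) (F x))"
  unfolding joint_def wsum_Times mean_def by simp

lemma is_pmf_joint:
  assumes "\<And>x. x \<in> Q \<times> U \<times> V \<times> T \<Longrightarrow> is_pmf S (K x)"
  shows "is_pmf (Q \<times> (U \<times> (V \<times> (T \<times> S)))) (joint K)"
  unfolding joint_def by (intro is_pmf_Times Q U V T assms) auto

lemma joint_pos:
  assumes "\<And>x. x \<in> Q \<times> U \<times> V \<times> T \<Longrightarrow> is_pmf S (K x)"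
    and x: "q \<in> Q" "u \<in> U" "v \<in> V" "t \<in> T" "y \<in> S" and p: "0 < joint K (q, u, v, t, y)"
  shows "0 < pq q" "0 < pu q u" "0 < pv q v" "0 < pt q t" "0 < K (q, u, v, t) y"
proof -
  have "joint K (q, u, v, t, y) \<noteq> 0" using p by simp
  then have "pq q \<noteq> 0" "pu q u \<noteq> 0" "pv q v \<noteq> 0" "pt q t \<noteq> 0" "K (q, u, v, t) y \<noteq> 0"
    by (auto simp: joint_def)
  then show "0 < pq q" "0 < pu q u" "0 < pv q v" "0 < pt q t" "0 < K (q, u, v, t) y"
    using is_pmf_nonneg[OF Q x(1)] is_pmf_nonneg[OF U[OF x(1)] x(2)] is_pmf_nonneg[OF V[OF x(1)] x(3)]
      is_pmf_nonneg[OF T[OF x(1)] x(4)] is_pmf_nonneg[OF assms(1), of "(q, u, v, t)" y] x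
    by auto
qed

text \<open>The order of quantifiers is the point: \<rho> comes from the single-letter Chernoff
  estimate of each test and is fixed before the block length and the numbers of messages, so the
  terms \<open>\<rho> j ^ n\<close> do decay.\<close>

lemma good_codebooks:
  fixes K :: "'q \<times> 'u \<times> 'v \<times> 't \<Rightarrow> 'y \<Rightarrow> real" and L :: "'j \<Rightarrow> 'q \<times> 'u \<times> 'v \<times> 't \<Rightarrow> 'y \<Rightarrow> real"
  assumes J: "finite J" and S: "finite S"
    and K: "\<And>x. x \<in> Q \<times> U \<times> V \<times> T \<Longrightarrow> is_pmf S (K x)"
    and L: "\<And>j x y. j \<in> J \<Longrightarrow> 0 \<le> L j x y"
    and pos: "\<And>j q u v t y. j \<in> J \<Longrightarrow> (q, u, v, t) \<in> Q \<times> U \<times> V \<times> T \<Longrightarrow> y \<in> S \<Longrightarrow> 0 < pq q \<Longrightarrow> 0 < pu q u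
       \<Longrightarrow> 0 < pv q v \<Longrightarrow> 0 < pt q t \<Longrightarrow> 0 < K (q, u, v, t) y \<Longrightarrow> 0 < L j (q, u, v, t) y"
    and rate: "\<And>j. j \<in> J \<Longrightarrow> g j < mean (\<lambda>x. wsum S (K x) (\<lambda>y. log 2 (L j x y)))"
    and rival: "\<And>j x y. j \<in> J \<Longrightarrow> x \<in> Q \<times> U \<times> V \<times> T \<Longrightarrow> y \<in> S \<Longrightarrow>
       rival_mean (cls j) x (\<lambda>x'. L j x' y) \<le> 1"
  shows "\<exists>\<rho>. (\<forall>j\<in>J. 0 \<le> \<rho> j \<and> \<rho> j < 1) \<and> (\<forall>n Ma Mb. \<exists>C\<in>codebook n Ma Mb.
      (\<Sum>w\<in>{..<Ma} \<times> {..<Mb}. wsum (Pi\<^sub>E {..<n} (\<lambda>_. S)) (\<lambda>y. \<Prod>k<n. K (word (C k) w) (y k))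
         (\<lambda>y. \<Sum>j\<in>J. of_bool (confusable n (g j) (L j) (\<lambda>k. word (C k)) (rivals (cls j) Ma Mb w) w y)))
      \<le> real (Ma * Mb) * (\<Sum>j\<in>J. \<rho> j ^ n + real (num_rivals (cls j) Ma Mb) * 2 powr (- (real n * g j))))"
proof -
  have "\<exists>s \<rho>. 0 < s \<and> 0 \<le> \<rho> \<and> \<rho> < 1 \<and> mean (\<lambda>x. wsum S (K x) (\<lambda>y. (2 powr g j / L j x y) powr s)) \<le> \<rho>"
    if j: "j \<in> J" for j
  proof -
    let ?\<Omega> = "Q \<times> (U \<times> (V \<times> (T \<times> S)))" and ?L = "\<lambda>(q, u, v, t, y). L j (q, u, v, t) y"
    have "wsum ?\<Omega> (joint K) (\<lambda>\<omega>. log 2 (?L \<omega>)) = mean (\<lambda>x. wsum S (K x) (\<lambda>y. log 2 (L j x y)))"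
      by (subst wsum_joint[symmetric]) (rule wsum_cong, auto)
    then have g: "g j < wsum ?\<Omega> (joint K) (\<lambda>\<omega>. log 2 (?L \<omega>))"
      using rate[OF j] by simp
    have Lpos: "0 < ?L \<omega>" if \<omega>: "\<omega> \<in> ?\<Omega>" "0 < joint K \<omega>" for \<omega>
    proof -
      obtain q u v t y where eq: "\<omega> = (q, u, v, t, y)" by (cases \<omega>)
      then have x: "q \<in> Q" "u \<in> U" "v \<in> V" "t \<in> T" "y \<in> S" using \<omega> by auto
      show ?thesis
        using pos[OF j _ x(5) joint_pos[of S K, OF K x \<omega>(2)[unfolded eq]]] x by (simp add: eq)
    qed
    have "\<exists>s>0. \<exists>\<rho>. 0 \<le> \<rho> \<and> \<rho> < 1 \<and> wsum ?\<Omega> (joint K) (\<lambda>\<omega>. (2 powr g j / ?L \<omega>) powr s) \<le> \<rho>"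
    proof (rule chernoff_exponent[where L="?L"])
      show "is_pmf ?\<Omega> (joint K)" by (rule is_pmf_joint) (rule K)
    qed (fact g, fact Lpos)
    moreover have "wsum ?\<Omega> (joint K) (\<lambda>\<omega>. (2 powr g j / ?L \<omega>) powr s)
        = mean (\<lambda>x. wsum S (K x) (\<lambda>y. (2 powr g j / L j x y) powr s))" for s
      by (subst wsum_joint[symmetric]) (rule wsum_cong, auto)
    ultimately show ?thesis by auto
  qed
  then have "\<forall>j\<in>J. \<exists>s \<rho>. 0 < s \<and> 0 \<le> \<rho> \<and> \<rho> < 1 \<and>
      mean (\<lambda>x. wsum S (K x) (\<lambda>y. (2 powr g j / L j x y) powr s)) \<le> \<rho>" by blast
  from bchoice[OF this] obtain s where
    "\<forall>j\<in>J. \<exists>\<rho>. 0 < s j \<and> 0 \<le> \<rho> \<and> \<rho> < 1 \<and>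
      mean (\<lambda>x. wsum S (K x) (\<lambda>y. (2 powr g j / L j x y) powr s j)) \<le> \<rho>" by (elim exE)
  from bchoice[OF this] obtain \<rho> where \<rho>:
    "\<forall>j\<in>J. 0 < s j \<and> 0 \<le> \<rho> j \<and> \<rho> j < 1 \<and>
      mean (\<lambda>x. wsum S (K x) (\<lambda>y. (2 powr g j / L j x y) powr s j)) \<le> \<rho> j" by (elim exE)
  have s: "0 < s j" and sent: "mean (\<lambda>x. wsum S (K x) (\<lambda>y. (2 powr g j / L j x y) powr s j)) \<le> \<rho> j"
    if "j \<in> J" for j
    using \<rho> that by blast+
  show ?thesis
  proof (intro exI[of _ \<rho>] conjI allI)
    show "\<forall>j\<in>J. 0 \<le> \<rho> j \<and> \<rho> j < 1" using \<rho> by blast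
  qed (rule codebook_exists[OF J S K L pos s sent rival])
qed

end

section \<open>Threshold decoding\<close>

definition passes :: "nat \<Rightarrow> (contention \<Rightarrow> real) \<Rightarrow> (contention \<Rightarrow> 'x \<Rightarrow> 'y \<Rightarrow> real) \<Rightarrow> contention set
    \<Rightarrow> (nat \<Rightarrow> 'w \<Rightarrow> 'x) \<Rightarrow> (nat \<Rightarrow> 'y) \<Rightarrow> 'w \<Rightarrow> bool" where
  "passes n g L cs x y w \<longleftrightarrow> (\<forall>c\<in>cs. 2 powr (real n * g c) \<le> (\<Prod>k<n. L c (x k w) (y k)))"

lemma passes_sent:
  assumes "\<And>c. c \<in> cs \<Longrightarrow> \<not> confusable n (g c) (L c) x (rivals c Ma Mb w) w y"
  shows "passes n g L cs x y w"
  using assms unfolding passes_def confusable_def by force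

lemma not_passes_rival:
  assumes "\<And>c. c \<in> cs \<Longrightarrow> \<not> confusable n (g c) (L c) x (rivals c Ma Mb w) w y"
    and "c \<in> cs" "w' \<in> rivals c Ma Mb w"
  shows "\<not> passes n g L cs x y w'"
  using assms unfolding passes_def confusable_def by blast

text \<open>The three classes together cover all pairs other than the sent one, and a receiver with
  \<open>cs = UNIV\<close> tests against each of them.\<close>

lemma passes_unique:
  assumes nc: "\<And>c. c \<in> cs \<Longrightarrow> \<not> confusable n (g c) (L c) x (rivals c Ma Mb (wa, wb)) (wa, wb) y"
    and cs: "cs = UNIV" and p: "passes n g L cs x y (a, b)" and ab: "a < Ma" "b < Mb"
  shows "a = wa \<and> b = wb"
proof (rule ccontr)
  assume "\<not> (a = wa \<and> b = wb)"
  then have "\<exists>c. (a, b) \<in> rivals c Ma Mb (wa, wb)"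
    using ab by (cases "a = wa"; cases "b = wb")
      (auto intro: exI[of _ First] exI[of _ Second] exI[of _ Both])
  then show False using not_passes_rival[OF nc] p cs by blast
qed

lemma passes_first:
  assumes nc: "\<And>c. c \<in> cs \<Longrightarrow> \<not> confusable n (g c) (L c) x (rivals c Ma Mb (wa, wb)) (wa, wb) y"
    and c: "First \<in> cs" and p: "passes n g L cs x y (a, wb)" and ab: "a < Ma"
  shows "a = wa"
proof (rule ccontr)
  assume "a \<noteq> wa"
  then have "(a, wb) \<in> rivals First Ma Mb (wa, wb)" using ab by auto
  then show False using not_passes_rival[OF nc c] p by blast
qed

lemma passes_second:
  assumes nc: "\<And>c. c \<in> cs \<Longrightarrow> \<not> confusable n (g c) (L c) x (rivals c Ma Mb (wa, wb)) (wa, wb) y"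
    and c: "Second \<in> cs" and p: "passes n g L cs x y (wa, b)" and ab: "b < Mb"
  shows "b = wb"
proof (rule ccontr)
  assume "b \<noteq> wb"
  then have "(wa, b) \<in> rivals Second Ma Mb (wa, wb)" using ab by auto
  then show False using not_passes_rival[OF nc c] p by blast
qed

section \<open>Phase 1: decoding at the relays\<close>

locale mabc =
  fixes m :: nat and X :: "nat \<Rightarrow> 'x set" and Y :: "nat \<Rightarrow> 'y set" and A B :: "nat set"
    and W1 :: "'x \<Rightarrow> 'x \<Rightarrow> (nat \<Rightarrow> 'y) \<Rightarrow> real" and W2 :: "(nat \<Rightarrow> 'x) \<Rightarrow> 'y \<times> 'y \<Rightarrow> real"
    and Qs :: "'q set" and pq :: "'q \<Rightarrow> real" and pa pb :: "'q \<Rightarrow> 'x \<Rightarrow> real"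
    and pAB pAnB pBnA :: "'q \<Rightarrow> (nat \<Rightarrow> 'x) \<Rightarrow> real"
  assumes alph: "\<forall>r\<le>Suc m. finite (X r) \<and> X r \<noteq> {} \<and> finite (Y r) \<and> Y r \<noteq> {}"
    and AR: "A \<subseteq> {1..m}" and BR: "B \<subseteq> {1..m}"
    and ch1: "mabc_channel1 m X Y W1" and ch2: "mabc_channel2 m X Y A B W2"
    and Q: "is_pmf Qs pq"
    and inputs: "\<forall>q\<in>Qs. is_pmf (X 0) (pa q) \<and> is_pmf (X (Suc m)) (pb q)
                   \<and> is_pmf (Pi\<^sub>E (A \<inter> B) X) (pAB q) \<and> is_pmf (Pi\<^sub>E (A - B) X) (pAnB q)
                   \<and> is_pmf (Pi\<^sub>E (B - A) X) (pBnA q)"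
begin

sublocale phase1: ensemble Qs pq "{()}" "\<lambda>_ _. 1" "X 0" pa "X (Suc m)" pb
  by unfold_locales (use Q inputs in \<open>auto simp: is_pmf_def\<close>)

abbreviation "P1 \<equiv> dist1 pq pa pb W1"
abbreviation "\<Omega>1 \<equiv> space1 Qs m X Y"
abbreviation "S1 \<equiv> Pi\<^sub>E {1..m} Y"

lemma W1_pmf: "xa \<in> X 0 \<Longrightarrow> xb \<in> X (Suc m) \<Longrightarrow> is_pmf S1 (W1 xa xb)"
  using ch1 unfolding mabc_channel1_def by blast

lemma dist1_eq: "P1 = (\<lambda>(q, r). pq q * (\<lambda>(xa, r). pa q xa * (\<lambda>(xb, y). pb q xb * W1 xa xb y) r) r)"
  by (auto simp: dist1_def fun_eq_iff)

lemma wsum_space1: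
  "wsum \<Omega>1 P1 G = wsum Qs pq (\<lambda>q. wsum (X 0) (pa q) (\<lambda>xa. wsum (X (Suc m)) (pb q) (\<lambda>xb.
     wsum S1 (W1 xa xb) (\<lambda>y. G (q, xa, xb, y)))))"
  unfolding dist1_eq space1_def wsum_Times ..

lemma wsum_inputs1:
  "wsum \<Omega>1 P1 (\<lambda>(q, xa, xb, y). G q xa xb)
     = wsum Qs pq (\<lambda>q. wsum (X 0) (pa q) (\<lambda>xa. wsum (X (Suc m)) (pb q) (\<lambda>xb. G q xa xb)))"
  unfolding wsum_space1 by (intro wsum_cong) (auto simp: W1_pmf simp del: One_nat_def)

lemma dist1_pmf: "is_pmf \<Omega>1 P1"
  unfolding dist1_eq space1_def by (intro is_pmf_Times Q) (use inputs W1_pmf in auto)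

lemma finite_space1: "finite \<Omega>1"
  by (rule is_pmf_finite[OF dist1_pmf])

lemma dist1_nonneg: "\<omega> \<in> \<Omega>1 \<Longrightarrow> 0 \<le> P1 \<omega>"
  by (rule is_pmf_nonneg[OF dist1_pmf])

text \<open>For \<open>First\<close>, a relay in \<open>B\<close> also decodes the other message; a
  rival in this class has the same \<open>xb\<close>, which may therefore enter the condition. A
  relay outside \<open>B\<close> averages \<open>xb\<close> out as noise. \<open>Second\<close> is
  symmetric. For \<open>Both\<close> nothing is shared but \<open>q\<close>.\<close>

definition relay_dens :: "nat \<Rightarrow> contention \<Rightarrow> 'q \<times> unit \<times> 'x \<times> 'x \<Rightarrow> 'y \<Rightarrow> real" where
  "relay_dens r c = (\<lambda>(q, u, xa, xb) y. case c of
     First \<Rightarrow> if r \<in> B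
       then dens P1 \<Omega>1 (\<lambda>(q, xa, xb, y). xa) (\<lambda>(q, xa, xb, y). y r) (\<lambda>(q, xa, xb, y). (xb, q)) xa y (xb, q)
       else dens P1 \<Omega>1 (\<lambda>(q, xa, xb, y). xa) (\<lambda>(q, xa, xb, y). y r) (\<lambda>(q, xa, xb, y). q) xa y q
   | Second \<Rightarrow> if r \<in> A
       then dens P1 \<Omega>1 (\<lambda>(q, xa, xb, y). xb) (\<lambda>(q, xa, xb, y). y r) (\<lambda>(q, xa, xb, y). (xa, q)) xb y (xa, q)
       else dens P1 \<Omega>1 (\<lambda>(q, xa, xb, y). xb) (\<lambda>(q, xa, xb, y). y r) (\<lambda>(q, xa, xb, y). q) xb y q
   | Both \<Rightarrow>
       dens P1 \<Omega>1 (\<lambda>(q, xa, xb, y). (xa, xb)) (\<lambda>(q, xa, xb, y). y r) (\<lambda>(q, xa, xb, y). q) (xa, xb) y q)"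

definition relay_info :: "nat \<Rightarrow> contention \<Rightarrow> real" where
  "relay_info r c = (case c of
     First \<Rightarrow> if r \<in> B
       then cmi P1 \<Omega>1 (\<lambda>(q, xa, xb, y). xa) (\<lambda>(q, xa, xb, y). y r) (\<lambda>(q, xa, xb, y). (xb, q))
       else cmi P1 \<Omega>1 (\<lambda>(q, xa, xb, y). xa) (\<lambda>(q, xa, xb, y). y r) (\<lambda>(q, xa, xb, y). q)
   | Second \<Rightarrow> if r \<in> A
       then cmi P1 \<Omega>1 (\<lambda>(q, xa, xb, y). xb) (\<lambda>(q, xa, xb, y). y r) (\<lambda>(q, xa, xb, y). (xa, q))
       else cmi P1 \<Omega>1 (\<lambda>(q, xa, xb, y). xb) (\<lambda>(q, xa, xb, y). y r) (\<lambda>(q, xa, xb, y). q)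
   | Both \<Rightarrow> cmi P1 \<Omega>1 (\<lambda>(q, xa, xb, y). (xa, xb)) (\<lambda>(q, xa, xb, y). y r) (\<lambda>(q, xa, xb, y). q))"

lemma relay_info_eq:
  "relay_info r c = phase1.mean (\<lambda>x. wsum S1 ((\<lambda>(q, u, xa, xb). W1 xa xb) x) (\<lambda>y. log 2 (relay_dens r c x (y r))))"
proof -
  have "relay_info r c = wsum \<Omega>1 P1 (\<lambda>(q, xa, xb, y). log 2 (relay_dens r c (q, (), xa, xb) (y r)))"
    unfolding relay_info_def relay_dens_def cmi_eq_wsum_dens
    by (cases c) (auto intro!: wsum_cong)
  then show ?thesis
    unfolding wsum_space1 phase1.mean_def by (simp add: wsum_def)
qed

lemma relay_dens_nonneg: "0 \<le> relay_dens r c x y"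
  unfolding relay_dens_def
  by (cases x; cases c) (simp_all add: dens_nonneg dist1_nonneg)

lemma relay_dens_pos:
  assumes "(q, xa, xb, y) \<in> \<Omega>1" "0 < P1 (q, xa, xb, y)"
  shows "0 < relay_dens r c (q, u, xa, xb) (y r)"
proof -
  note dp = dens_pos[of \<Omega>1 P1 "(q, xa, xb, y)", OF finite_space1 dist1_nonneg assms]
  show ?thesis
    unfolding relay_dens_def
    using dp[of "\<lambda>(q, xa, xb, y). xa" "\<lambda>(q, xa, xb, y). y r" "\<lambda>(q, xa, xb, y). (xb, q)"]
      dp[of "\<lambda>(q, xa, xb, y). xa" "\<lambda>(q, xa, xb, y). y r" "\<lambda>(q, xa, xb, y). q"]
      dp[of "\<lambda>(q, xa, xb, y). xb" "\<lambda>(q, xa, xb, y). y r" "\<lambda>(q, xa, xb, y). (xa, q)"]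
      dp[of "\<lambda>(q, xa, xb, y). xb" "\<lambda>(q, xa, xb, y). y r" "\<lambda>(q, xa, xb, y). q"]
      dp[of "\<lambda>(q, xa, xb, y). (xa, xb)" "\<lambda>(q, xa, xb, y). y r" "\<lambda>(q, xa, xb, y). q"]
    by (cases c) simp_all
qed

lemma marg1:
  "marg P1 \<Omega>1 (\<lambda>(q, xa, xb, y). f q xa xb) v
     = wsum Qs pq (\<lambda>q. wsum (X 0) (pa q) (\<lambda>xa. wsum (X (Suc m)) (pb q) (\<lambda>xb. if f q xa xb = v then 1 else 0)))"
proof -
  have "marg P1 \<Omega>1 (\<lambda>(q, xa, xb, y). f q xa xb) v
      = wsum \<Omega>1 P1 (\<lambda>(q, xa, xb, y). if f q xa xb = v then 1 else 0)"
    unfolding marg_eq_wsum[OF finite_space1] by (rule wsum_cong) auto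
  then show ?thesis by (simp only: wsum_inputs1)
qed

text \<open>Separates the conditions of a joint indicator, so that nested sums over it collapse one
  at a time by \<open>wsum_pick\<close> and \<open>wsum_if\<close>.\<close>

lemma if_conj_nested: "(if P \<and> P' then x else y) = (if P then if P' then x else y else y)"
  by simp

lemma finite_alph: "finite Qs" "finite (X 0)" "finite (X (Suc m))"
  using alph is_pmf_finite[OF Q] by auto

lemmas marg1_simps = if_conj_nested wsum_if wsum_pick finite_alph mult_if_zero

text \<open>The factorisations that \<open>wsum_dens_le_1\<close> asks for, one for each density in
  \<open>relay_dens\<close>. They express that the inputs of the terminals are independent given
  \<open>q\<close>; for \<open>q'\<close> outside \<open>Qs\<close> both sides vanish.\<close>

lemma marg1_indep:
  fixes q' :: 'q
  shows "xa' \<in> X 0 \<Longrightarrow> marg P1 \<Omega>1 (\<lambda>\<omega>. ((\<lambda>(q, xa, xb, y). xa) \<omega>, (\<lambda>(q, xa, xb, y). (xb, q)) \<omega>)) (xa', (xb', q'))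
       = pa q' xa' * marg P1 \<Omega>1 (\<lambda>(q, xa, xb, y). (xb, q)) (xb', q')"
    and "xb' \<in> X (Suc m) \<Longrightarrow> marg P1 \<Omega>1 (\<lambda>\<omega>. ((\<lambda>(q, xa, xb, y). xb) \<omega>, (\<lambda>(q, xa, xb, y). (xa, q)) \<omega>)) (xb', (xa', q'))
       = pb q' xb' * marg P1 \<Omega>1 (\<lambda>(q, xa, xb, y). (xa, q)) (xa', q')"
    and "xa' \<in> X 0 \<Longrightarrow> marg P1 \<Omega>1 (\<lambda>\<omega>. ((\<lambda>(q, xa, xb, y). xa) \<omega>, (\<lambda>(q, xa, xb, y). q) \<omega>)) (xa', q')
       = pa q' xa' * marg P1 \<Omega>1 (\<lambda>(q, xa, xb, y). q) q'"
    and "xb' \<in> X (Suc m) \<Longrightarrow> marg P1 \<Omega>1 (\<lambda>\<omega>. ((\<lambda>(q, xa, xb, y). xb) \<omega>, (\<lambda>(q, xa, xb, y). q) \<omega>)) (xb', q')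
       = pb q' xb' * marg P1 \<Omega>1 (\<lambda>(q, xa, xb, y). q) q'"
    and "xa' \<in> X 0 \<Longrightarrow> xb' \<in> X (Suc m) \<Longrightarrow>
       marg P1 \<Omega>1 (\<lambda>\<omega>. ((\<lambda>(q, xa, xb, y). (xa, xb)) \<omega>, (\<lambda>(q, xa, xb, y). q) \<omega>)) ((xa', xb'), q')
       = pa q' xa' * pb q' xb' * marg P1 \<Omega>1 (\<lambda>(q, xa, xb, y). q) q'"
proof -
  have pm: "is_pmf (X 0) (pa q')" "is_pmf (X (Suc m)) (pb q')" if "q' \<in> Qs"
    using inputs that by auto
  have split: "(\<lambda>\<omega>. ((\<lambda>(q, xa, xb, y). f q xa xb) \<omega>, (\<lambda>(q, xa, xb, y). h q xa xb) \<omega>))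
      = (\<lambda>(q, xa, xb, y). (f q xa xb, h q xa xb))" for f :: "'q \<Rightarrow> 'x \<Rightarrow> 'x \<Rightarrow> 'f" and h :: "'q \<Rightarrow> 'x \<Rightarrow> 'x \<Rightarrow> 'h"
    by auto
  show "xa' \<in> X 0 \<Longrightarrow> marg P1 \<Omega>1 (\<lambda>\<omega>. ((\<lambda>(q, xa, xb, y). xa) \<omega>, (\<lambda>(q, xa, xb, y). (xb, q)) \<omega>)) (xa', (xb', q'))
       = pa q' xa' * marg P1 \<Omega>1 (\<lambda>(q, xa, xb, y). (xb, q)) (xb', q')"
    unfolding split marg1 by (cases "q' \<in> Qs") (simp_all add: marg1_simps pm)
  show "xb' \<in> X (Suc m) \<Longrightarrow> marg P1 \<Omega>1 (\<lambda>\<omega>. ((\<lambda>(q, xa, xb, y). xb) \<omega>, (\<lambda>(q, xa, xb, y). (xa, q)) \<omega>)) (xb', (xa', q'))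
       = pb q' xb' * marg P1 \<Omega>1 (\<lambda>(q, xa, xb, y). (xa, q)) (xa', q')"
    unfolding split marg1 by (cases "q' \<in> Qs") (simp_all add: marg1_simps pm)
  show "xa' \<in> X 0 \<Longrightarrow> marg P1 \<Omega>1 (\<lambda>\<omega>. ((\<lambda>(q, xa, xb, y). xa) \<omega>, (\<lambda>(q, xa, xb, y). q) \<omega>)) (xa', q')
       = pa q' xa' * marg P1 \<Omega>1 (\<lambda>(q, xa, xb, y). q) q'"
    unfolding split marg1 by (cases "q' \<in> Qs") (simp_all add: marg1_simps pm)
  show "xb' \<in> X (Suc m) \<Longrightarrow> marg P1 \<Omega>1 (\<lambda>\<omega>. ((\<lambda>(q, xa, xb, y). xb) \<omega>, (\<lambda>(q, xa, xb, y). q) \<omega>)) (xb', q')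
       = pb q' xb' * marg P1 \<Omega>1 (\<lambda>(q, xa, xb, y). q) q'"
    unfolding split marg1 by (cases "q' \<in> Qs") (simp_all add: marg1_simps pm)
  show "xa' \<in> X 0 \<Longrightarrow> xb' \<in> X (Suc m) \<Longrightarrow>
       marg P1 \<Omega>1 (\<lambda>\<omega>. ((\<lambda>(q, xa, xb, y). (xa, xb)) \<omega>, (\<lambda>(q, xa, xb, y). q) \<omega>)) ((xa', xb'), q')
       = pa q' xa' * pb q' xb' * marg P1 \<Omega>1 (\<lambda>(q, xa, xb, y). q) q'"
    unfolding split marg1 by (cases "q' \<in> Qs") (simp_all add: marg1_simps pm)
qed

text \<open>In each case the fresh letters of the rival follow the conditional law of the tested
  input given the condition of the density, so the change of measure applies. For
  \<open>Both\<close> the two inputs are treated as one variable with a product law.\<close>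

lemma relay_rival_mean:
  assumes "x \<in> Qs \<times> {()} \<times> X 0 \<times> X (Suc m)"
  shows "phase1.rival_mean c x (\<lambda>x'. relay_dens r c x' y) \<le> 1"
proof -
  obtain q xa xb where x: "x = (q, (), xa, xb)" using assms by auto
  have unit: "wsum {()} (\<lambda>_. 1) f = f ()" for f by (simp add: wsum_def)
  note le1 = wsum_dens_le_1[OF finite_space1 dist1_nonneg]
  show ?thesis
  proof (cases c)
    case First
    have "wsum (X 0) (pa q) (\<lambda>xa. dens P1 \<Omega>1 (\<lambda>(q, xa, xb, y). xa) (\<lambda>(q, xa, xb, y). y r)
        (\<lambda>(q, xa, xb, y). (xb, q)) xa y (xb, q)) \<le> 1"
      by (rule le1[OF _ _ marg1_indep(1)]) (auto simp: finite_alph)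
    moreover have "wsum (X 0) (pa q) (\<lambda>xa. dens P1 \<Omega>1 (\<lambda>(q, xa, xb, y). xa) (\<lambda>(q, xa, xb, y). y r)
        (\<lambda>(q, xa, xb, y). q) xa y q) \<le> 1"
      by (rule le1[OF _ _ marg1_indep(3)]) (auto simp: finite_alph)
    ultimately show ?thesis
      by (cases "r \<in> B") (simp_all add: First x relay_dens_def unit)
  next
    case Second
    have "wsum (X (Suc m)) (pb q) (\<lambda>xb. dens P1 \<Omega>1 (\<lambda>(q, xa, xb, y). xb) (\<lambda>(q, xa, xb, y). y r)
        (\<lambda>(q, xa, xb, y). (xa, q)) xb y (xa, q)) \<le> 1"
      by (rule le1[OF _ _ marg1_indep(2)]) (auto simp: finite_alph)
    moreover have "wsum (X (Suc m)) (pb q) (\<lambda>xb. dens P1 \<Omega>1 (\<lambda>(q, xa, xb, y). xb) (\<lambda>(q, xa, xb, y). y r)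
        (\<lambda>(q, xa, xb, y). q) xb y q) \<le> 1"
      by (rule le1[OF _ _ marg1_indep(4)]) (auto simp: finite_alph)
    ultimately show ?thesis
      by (cases "r \<in> A") (simp_all add: Second x relay_dens_def unit)
  next
    case Both
    have "wsum (X 0 \<times> X (Suc m)) (\<lambda>(xa, xb). pa q xa * pb q xb)
        (\<lambda>xx. dens P1 \<Omega>1 (\<lambda>(q, xa, xb, y). (xa, xb)) (\<lambda>(q, xa, xb, y). y r) (\<lambda>(q, xa, xb, y). q) xx y q) \<le> 1"
      by (rule le1) (use marg1_indep(5) finite_alph in auto)
    then show ?thesis
      by (simp add: Both x relay_dens_def unit wsum_Times)
  qed
qed

text \<open>At a relay in \<open>A - B\<close> the density does not depend on \<open>wb\<close>: a
  pair with the right \<open>wa\<close> is as good as the sent one, and a pair with both messages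
  wrong looks like a rival of class \<open>First\<close>. So \<open>First\<close> is its only
  class.\<close>

definition relay_jobs :: "(nat \<times> contention) set" where
  "relay_jobs = {(r, c). r \<in> A \<and> c = First \<or> r \<in> B \<and> c = Second \<or> r \<in> A \<inter> B \<and> c = Both}"

lemma finite_relay_jobs: "finite relay_jobs"
proof (rule finite_subset)
  show "relay_jobs \<subseteq> (A \<union> B) \<times> {First, Second, Both}" unfolding relay_jobs_def by auto
  show "finite ((A \<union> B) \<times> {First, Second, Both})"
    using finite_subset[OF AR] finite_subset[OF BR] by auto
qed

text \<open>One decoder shape serves all relays: a relay outside \<open>A \<inter> B\<close> uses a density that ignores the
  message it does not decode, so any value of that message may accompany the decoded one.\<close>

lemma relay_decoder:
  fixes g :: "nat \<times> contention \<Rightarrow> real"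
  assumes Ma: "0 < Ma" and Mb: "0 < Mb"
  shows "\<exists>dec. (\<forall>r obs. dec r obs \<in> {..<Ma} \<times> {..<Mb}) \<and>
     (\<forall>r\<in>A \<union> B. \<forall>wa<Ma. \<forall>wb<Mb. \<forall>y.
        (\<forall>c. (r, c) \<in> relay_jobs \<longrightarrow> \<not> confusable n (g (r, c)) (relay_dens r c)
            (\<lambda>k. word (C k)) (rivals c Ma Mb (wa, wb)) (wa, wb) y) \<longrightarrow>
        (r \<in> A \<longrightarrow> fst (dec r (\<lambda>k\<in>{..<n}. y k)) = wa) \<and> (r \<in> B \<longrightarrow> snd (dec r (\<lambda>k\<in>{..<n}. y k)) = wb))"
proof -
  define cs where "cs r = {c. (r, c) \<in> relay_jobs}" for r
  define ok where "ok r obs w \<longleftrightarrow> w \<in> {..<Ma} \<times> {..<Mb} \<and>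
      passes n (\<lambda>c. g (r, c)) (relay_dens r) (cs r) (\<lambda>k. word (C k)) obs w" for r obs w
  \<comment> \<open>The default pair keeps the output in the message range for every observation.
    Relays must transmit a legal symbol even when decoding fails, and here the positivity of
    \<open>Ma\<close> and \<open>Mb\<close> enters.\<close>
  define dec where "dec r obs = (if \<exists>w. ok r obs w then SOME w. ok r obs w else (0, 0))" for r obs
  have dec_ok: "ok r obs (dec r obs)" if "ok r obs w" for r obs w
  proof -
    have ex: "\<exists>w. ok r obs w" using that by blast
    show ?thesis unfolding dec_def if_P[OF ex] using ex by (rule someI_ex)
  qed
  \<comment> \<open>The channel model hands over observations restricted to times below
    \<open>n\<close>; the test reads only those times.\<close>
  have restr: "ok r (\<lambda>k\<in>{..<n}. y k) w \<longleftrightarrow> ok r y w" for r y w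
    unfolding ok_def passes_def by simp
  show ?thesis
  proof (intro exI[of _ dec] conjI allI ballI impI)
    fix r obs show "dec r obs \<in> {..<Ma} \<times> {..<Mb}"
      using dec_ok[of r obs] Ma Mb by (cases "\<exists>w. ok r obs w") (auto simp: ok_def dec_def)
  next
    fix r wa wb y
    assume w: "wa < Ma" "wb < Mb" and
      "\<forall>c. (r, c) \<in> relay_jobs \<longrightarrow> \<not> confusable n (g (r, c)) (relay_dens r c)
            (\<lambda>k. word (C k)) (rivals c Ma Mb (wa, wb)) (wa, wb) y"
    then have nc: "\<not> confusable n (g (r, c)) (relay_dens r c) (\<lambda>k. word (C k)) (rivals c Ma Mb (wa, wb)) (wa, wb) y"
      if "c \<in> cs r" for c
      using that unfolding cs_def by blast
    obtain a b where ab: "dec r (\<lambda>k\<in>{..<n}. y k) = (a, b)" by force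
    have "ok r y (wa, wb)"
      unfolding ok_def using w passes_sent[of "cs r" n "\<lambda>c. g (r, c)", OF nc] by auto
    then have "ok r (\<lambda>k\<in>{..<n}. y k) (wa, wb)" by (simp only: restr)
    from dec_ok[OF this] have "ok r y (a, b)" by (simp only: restr ab)
    then have lt: "a < Ma" "b < Mb"
      and p: "passes n (\<lambda>c. g (r, c)) (relay_dens r) (cs r) (\<lambda>k. word (C k)) y (a, b)"
      unfolding ok_def by auto
    have both: "a = wa \<and> b = wb" if "r \<in> A" "r \<in> B"
    proof -
      have "cs r = UNIV"
        using that unfolding cs_def relay_jobs_def by (auto intro: contention.exhaust)
      then show ?thesis using passes_unique[of "cs r" n "\<lambda>c. g (r, c)", OF nc _ p lt] by blast
    qed
    show "fst (dec r (\<lambda>k\<in>{..<n}. y k)) = wa" if r: "r \<in> A"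
    proof (cases "r \<in> B")
      case False
      have cs: "cs r = {First}" using r False unfolding cs_def relay_jobs_def by auto
      have eq: "relay_dens r First (word (C k) (a, b)) = relay_dens r First (word (C k) (a, wb))" for k
        using False by (cases "C k") (simp add: relay_dens_def)
      have "passes n (\<lambda>c. g (r, c)) (relay_dens r) (cs r) (\<lambda>k. word (C k)) y (a, wb)"
        using p unfolding passes_def cs by (simp add: eq)
      from passes_first[of "cs r" n "\<lambda>c. g (r, c)", OF nc _ this lt(1)] show ?thesis
        using cs ab by simp
    qed (use both r ab in auto)
    show "snd (dec r (\<lambda>k\<in>{..<n}. y k)) = wb" if r: "r \<in> B"
    proof (cases "r \<in> A")
      case False
      have cs: "cs r = {Second}" using r False unfolding cs_def relay_jobs_def by auto
      have eq: "relay_dens r Second (word (C k) (a, b)) = relay_dens r Second (word (C k) (wa, b))" for k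
        using False by (cases "C k") (simp add: relay_dens_def)
      have "passes n (\<lambda>c. g (r, c)) (relay_dens r) (cs r) (\<lambda>k. word (C k)) y (wa, b)"
        using p unfolding passes_def cs by (simp add: eq)
      from passes_second[of "cs r" n "\<lambda>c. g (r, c)", OF nc _ this lt(2)] show ?thesis
        using cs ab by simp
    qed (use both r ab in auto)
  qed
qed

definition relay_error :: "(nat \<Rightarrow> (nat \<Rightarrow> 'y) \<Rightarrow> nat \<times> nat) \<Rightarrow> nat \<Rightarrow> nat \<Rightarrow> nat \<Rightarrow> (nat \<Rightarrow> nat \<Rightarrow> 'y) \<Rightarrow> bool" where
  "relay_error dec n wa wb ys \<longleftrightarrow> (\<exists>r\<in>A \<union> B.
     r \<in> A \<and> fst (dec r (\<lambda>k\<in>{..<n}. ys k r)) \<noteq> wa \<or> r \<in> B \<and> snd (dec r (\<lambda>k\<in>{..<n}. ys k r)) \<noteq> wb)"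

text \<open>The output of one channel use is the vector of all relay outputs, and job
  \<open>(r, c)\<close> reads its component \<open>r\<close>. All relays thus become tests on one
  channel, and a relay errs only if one of its own tests is confusable.\<close>

lemma phase1_codes:
  fixes g :: "nat \<times> contention \<Rightarrow> real"
  assumes g: "\<forall>j\<in>relay_jobs. g j < relay_info (fst j) (snd j)"
  shows "\<exists>\<rho>. (\<forall>j\<in>relay_jobs. 0 \<le> \<rho> j \<and> \<rho> j < 1) \<and> (\<forall>n Ma Mb. 0 < Ma \<longrightarrow> 0 < Mb \<longrightarrow>
     (\<exists>ea eb dec. (\<forall>w<Ma. \<forall>k<n. ea w k \<in> X 0) \<and> (\<forall>w<Mb. \<forall>k<n. eb w k \<in> X (Suc m)) \<and>
        (\<forall>r obs. dec r obs \<in> {..<Ma} \<times> {..<Mb}) \<and>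
        (\<Sum>wa<Ma. \<Sum>wb<Mb. wsum (Pi\<^sub>E {..<n} (\<lambda>_. S1)) (\<lambda>ys. \<Prod>k<n. W1 (ea wa k) (eb wb k) (ys k))
            (\<lambda>ys. of_bool (relay_error dec n wa wb ys)))
        \<le> real (Ma * Mb) * (\<Sum>j\<in>relay_jobs. \<rho> j ^ n
              + real (num_rivals (snd j) Ma Mb) * 2 powr (- (real n * g j)))))"
proof -
  let ?K = "\<lambda>(q, u, xa, xb). W1 xa xb"
  let ?L = "\<lambda>j x y. relay_dens (fst j) (snd j) x (y (fst j))"
  have finS1: "finite S1" using alph by (intro finite_PiE) auto
  have "\<exists>\<rho>. (\<forall>j\<in>relay_jobs. 0 \<le> \<rho> j \<and> \<rho> j < 1) \<and> (\<forall>n Ma Mb. \<exists>C\<in>phase1.codebook n Ma Mb.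
      (\<Sum>w\<in>{..<Ma} \<times> {..<Mb}. wsum (Pi\<^sub>E {..<n} (\<lambda>_. S1)) (\<lambda>y. \<Prod>k<n. ?K (word (C k) w) (y k))
         (\<lambda>y. \<Sum>j\<in>relay_jobs. of_bool (confusable n (g j) (?L j) (\<lambda>k. word (C k)) (rivals (snd j) Ma Mb w) w y)))
      \<le> real (Ma * Mb) * (\<Sum>j\<in>relay_jobs. \<rho> j ^ n + real (num_rivals (snd j) Ma Mb) * 2 powr (- (real n * g j))))"
  proof (rule phase1.good_codebooks[OF finite_relay_jobs finS1])
    show "is_pmf S1 (?K x)" if "x \<in> Qs \<times> {()} \<times> X 0 \<times> X (Suc m)" for x
      using that W1_pmf by (auto simp del: One_nat_def)
    show "0 \<le> ?L j x y" for j x y by (rule relay_dens_nonneg)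
    show "0 < ?L j (q, u, xa, xb) y"
      if "(q, u, xa, xb) \<in> Qs \<times> {()} \<times> X 0 \<times> X (Suc m)" "y \<in> S1" "0 < pq q" "0 < (1::real)" "0 < pa q xa"
        "0 < pb q xb" "0 < ?K (q, u, xa, xb) y" for j q u xa xb y
      by (rule relay_dens_pos) (use that in \<open>auto simp: space1_def dist1_def\<close>)
    show "g j < phase1.mean (\<lambda>x. wsum S1 (?K x) (\<lambda>y. log 2 (?L j x y)))" if "j \<in> relay_jobs" for j
      using g that unfolding relay_info_eq by blast
    show "phase1.rival_mean (snd j) x (\<lambda>x'. ?L j x' y) \<le> 1"
      if "x \<in> Qs \<times> {()} \<times> X 0 \<times> X (Suc m)" for j x y
      by (rule relay_rival_mean[OF that])
  qed
  then obtain \<rho> where \<rho>: "\<forall>j\<in>relay_jobs. 0 \<le> \<rho> j \<and> \<rho> j < 1" and cb: "\<forall>n Ma Mb. \<exists>C\<in>phase1.codebook n Ma Mb.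
      (\<Sum>w\<in>{..<Ma} \<times> {..<Mb}. wsum (Pi\<^sub>E {..<n} (\<lambda>_. S1)) (\<lambda>y. \<Prod>k<n. ?K (word (C k) w) (y k))
         (\<lambda>y. \<Sum>j\<in>relay_jobs. of_bool (confusable n (g j) (?L j) (\<lambda>k. word (C k)) (rivals (snd j) Ma Mb w) w y)))
      \<le> real (Ma * Mb) * (\<Sum>j\<in>relay_jobs. \<rho> j ^ n + real (num_rivals (snd j) Ma Mb) * 2 powr (- (real n * g j)))"
    by (elim exE conjE)
  show ?thesis
  proof (intro exI[of _ \<rho>] conjI \<rho> allI impI)
    fix n Ma Mb :: nat assume M: "0 < Ma" "0 < Mb"
    from cb[rule_format, of n Ma Mb] obtain C where C: "C \<in> phase1.codebook n Ma Mb" and le: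
      "(\<Sum>w\<in>{..<Ma} \<times> {..<Mb}. wsum (Pi\<^sub>E {..<n} (\<lambda>_. S1)) (\<lambda>y. \<Prod>k<n. ?K (word (C k) w) (y k))
         (\<lambda>y. \<Sum>j\<in>relay_jobs. of_bool (confusable n (g j) (?L j) (\<lambda>k. word (C k)) (rivals (snd j) Ma Mb w) w y)))
      \<le> real (Ma * Mb) * (\<Sum>j\<in>relay_jobs. \<rho> j ^ n + real (num_rivals (snd j) Ma Mb) * 2 powr (- (real n * g j)))"
      by (elim bexE)
    from relay_decoder[OF M, of n g C] obtain dec where dec: "\<forall>r obs. dec r obs \<in> {..<Ma} \<times> {..<Mb}"
      and good: "\<And>r wa wb y. r \<in> A \<union> B \<Longrightarrow> wa < Ma \<Longrightarrow> wb < Mb \<Longrightarrow>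
        (\<forall>c. (r, c) \<in> relay_jobs \<longrightarrow> \<not> confusable n (g (r, c)) (relay_dens r c)
            (\<lambda>k. word (C k)) (rivals c Ma Mb (wa, wb)) (wa, wb) y) \<Longrightarrow>
        (r \<in> A \<longrightarrow> fst (dec r (\<lambda>k\<in>{..<n}. y k)) = wa) \<and> (r \<in> B \<longrightarrow> snd (dec r (\<lambda>k\<in>{..<n}. y k)) = wb)"
      by blast
    let ?ea = "\<lambda>w k. fst (snd (snd (C k))) w" and ?eb = "\<lambda>w k. snd (snd (snd (C k))) w"
    have Ck: "C k \<in> phase1.letters Ma Mb" if "k < n" for k
      using C that unfolding phase1.codebook_def by auto
    have ea: "?ea w k \<in> X 0" if "w < Ma" "k < n" for w k
      using Ck[OF that(2)] that(1) unfolding phase1.letters_def by auto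
    have eb: "?eb w k \<in> X (Suc m)" if "w < Mb" "k < n" for w k
      using Ck[OF that(2)] that(1) unfolding phase1.letters_def by auto
    have Keq: "?K (word (C k) (wa, wb)) = W1 (?ea wa k) (?eb wb k)" for k wa wb
      by (cases "C k") simp
    have "(\<Sum>wa<Ma. \<Sum>wb<Mb. wsum (Pi\<^sub>E {..<n} (\<lambda>_. S1)) (\<lambda>ys. \<Prod>k<n. W1 (?ea wa k) (?eb wb k) (ys k))
            (\<lambda>ys. of_bool (relay_error dec n wa wb ys)))
        \<le> (\<Sum>wa<Ma. \<Sum>wb<Mb. wsum (Pi\<^sub>E {..<n} (\<lambda>_. S1)) (\<lambda>ys. \<Prod>k<n. W1 (?ea wa k) (?eb wb k) (ys k))
            (\<lambda>y. \<Sum>j\<in>relay_jobs. of_bool (confusable n (g j) (?L j) (\<lambda>k. word (C k))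
               (rivals (snd j) Ma Mb (wa, wb)) (wa, wb) y)))"
    proof (intro sum_mono wsum_mono)
      fix wa wb ys assume w: "wa \<in> {..<Ma}" "wb \<in> {..<Mb}" and ys: "ys \<in> Pi\<^sub>E {..<n} (\<lambda>_. S1)"
      show "0 \<le> (\<Prod>k<n. W1 (?ea wa k) (?eb wb k) (ys k))"
        using w ys ea eb by (intro prod_nonneg ballI is_pmf_nonneg[OF W1_pmf]) auto
      show "of_bool (relay_error dec n wa wb ys) \<le> (\<Sum>j\<in>relay_jobs. of_bool (confusable n (g j) (?L j)
          (\<lambda>k. word (C k)) (rivals (snd j) Ma Mb (wa, wb)) (wa, wb) ys) :: real)"
      proof (cases "relay_error dec n wa wb ys")
        case True
        then obtain r where r: "r \<in> A \<union> B"
          "r \<in> A \<and> fst (dec r (\<lambda>k\<in>{..<n}. ys k r)) \<noteq> wa \<or> r \<in> B \<and> snd (dec r (\<lambda>k\<in>{..<n}. ys k r)) \<noteq> wb"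
          unfolding relay_error_def by blast
        then obtain c where c: "(r, c) \<in> relay_jobs" "confusable n (g (r, c)) (relay_dens r c)
            (\<lambda>k. word (C k)) (rivals c Ma Mb (wa, wb)) (wa, wb) (\<lambda>k. ys k r)"
          using good[OF r(1), of wa wb "\<lambda>k. ys k r"] w by auto
        have "1 \<le> (of_bool (confusable n (g (r, c)) (?L (r, c))
          (\<lambda>k. word (C k)) (rivals (snd (r, c)) Ma Mb (wa, wb)) (wa, wb) ys) :: real)"
          using c(2) unfolding confusable_def by simp
        also have "\<dots> \<le> (\<Sum>j\<in>relay_jobs. of_bool (confusable n (g j) (?L j)
          (\<lambda>k. word (C k)) (rivals (snd j) Ma Mb (wa, wb)) (wa, wb) ys))"
          by (rule member_le_sum[OF c(1)]) (auto simp: finite_relay_jobs)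
        finally show ?thesis by (simp add: True)
      qed (simp add: sum_nonneg)
    qed
    also have "\<dots> = (\<Sum>w\<in>{..<Ma} \<times> {..<Mb}. wsum (Pi\<^sub>E {..<n} (\<lambda>_. S1)) (\<lambda>y. \<Prod>k<n. ?K (word (C k) w) (y k))
         (\<lambda>y. \<Sum>j\<in>relay_jobs. of_bool (confusable n (g j) (?L j) (\<lambda>k. word (C k)) (rivals (snd j) Ma Mb w) w y)))"
      unfolding sum.cartesian_product by (rule sum.cong) (auto simp only: Keq split: prod.splits)
    also note le
    finally have bound: "(\<Sum>wa<Ma. \<Sum>wb<Mb. wsum (Pi\<^sub>E {..<n} (\<lambda>_. S1)) (\<lambda>ys. \<Prod>k<n. W1 (?ea wa k) (?eb wb k) (ys k))
            (\<lambda>ys. of_bool (relay_error dec n wa wb ys))) \<le> real (Ma * Mb) * (\<Sum>j\<in>relay_jobs. \<rho> j ^ n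
              + real (num_rivals (snd j) Ma Mb) * 2 powr (- (real n * g j)))" .
    show "\<exists>ea eb dec. (\<forall>w<Ma. \<forall>k<n. ea w k \<in> X 0) \<and> (\<forall>w<Mb. \<forall>k<n. eb w k \<in> X (Suc m)) \<and>
        (\<forall>r obs. dec r obs \<in> {..<Ma} \<times> {..<Mb}) \<and>
        (\<Sum>wa<Ma. \<Sum>wb<Mb. wsum (Pi\<^sub>E {..<n} (\<lambda>_. S1)) (\<lambda>ys. \<Prod>k<n. W1 (ea wa k) (eb wb k) (ys k))
            (\<lambda>ys. of_bool (relay_error dec n wa wb ys)))
        \<le> real (Ma * Mb) * (\<Sum>j\<in>relay_jobs. \<rho> j ^ n
              + real (num_rivals (snd j) Ma Mb) * 2 powr (- (real n * g j)))"
      by (rule exI[of _ ?ea], rule exI[of _ ?eb], rule exI[of _ dec]) (use ea eb dec bound in blast)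
  qed
qed

end

section \<open>Phase 2: decoding at the terminals\<close>

definition join :: "nat set \<Rightarrow> nat set \<Rightarrow> (nat \<Rightarrow> 'x) \<Rightarrow> (nat \<Rightarrow> 'x) \<Rightarrow> nat \<Rightarrow> 'x" where
  "join I J u v = (\<lambda>r\<in>I \<union> J. if r \<in> I then u r else v r)"

lemma join_in: "u \<in> Pi\<^sub>E I X \<Longrightarrow> v \<in> Pi\<^sub>E J X \<Longrightarrow> join I J u v \<in> Pi\<^sub>E (I \<union> J) X"
  unfolding join_def by auto

lemma restrict_join:
  assumes "u \<in> Pi\<^sub>E I X" "v \<in> Pi\<^sub>E J X"
  shows "restrict (join I J u v) I = u" and "I \<inter> J = {} \<Longrightarrow> restrict (join I J u v) J = v"
  using assms by (auto simp: join_def fun_eq_iff restrict_def PiE_iff extensional_def)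

text \<open>For disjoint groups, \<open>join\<close> is a bijection from pairs of input vectors
  whose inverse is the pair of restrictions. It carries the law in \<open>dist2\<close>, stated on
  joint inputs, to the independent letters of the ensemble.\<close>

lemma wsum_join:
  assumes "I \<inter> J = {}"
  shows "wsum (Pi\<^sub>E (I \<union> J) X) (\<lambda>x. p (restrict x I) * r (restrict x J)) H
       = wsum (Pi\<^sub>E I X) p (\<lambda>u. wsum (Pi\<^sub>E J X) r (\<lambda>v. H (join I J u v)))"
proof -
  have "wsum (Pi\<^sub>E I X) p (\<lambda>u. wsum (Pi\<^sub>E J X) r (\<lambda>v. H (join I J u v)))
      = wsum (Pi\<^sub>E I X \<times> Pi\<^sub>E J X) (\<lambda>(u, v). p u * r v) (\<lambda>(u, v). H (join I J u v))"
    by (simp add: wsum_Times)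
  also have "\<dots> = wsum (Pi\<^sub>E (I \<union> J) X) (\<lambda>x. p (restrict x I) * r (restrict x J)) H"
    unfolding wsum_def
    by (rule sum.reindex_bij_witness[where i="\<lambda>x. (restrict x I, restrict x J)" and j="\<lambda>(u, v). join I J u v"])
       (use assms in \<open>auto simp: join_in restrict_join, auto simp: join_def fun_eq_iff restrict_def PiE_iff extensional_def\<close>)
  finally show ?thesis ..
qed

lemma is_pmf_join:
  fixes I J :: "nat set"
  assumes "I \<inter> J = {}" "is_pmf (Pi\<^sub>E I X) p" "is_pmf (Pi\<^sub>E J X) r"
  shows "is_pmf (Pi\<^sub>E (I \<union> J) X) (\<lambda>x. p (restrict x I) * r (restrict x J))"
proof -
  have "wsum (Pi\<^sub>E (I \<union> J) X) (\<lambda>x. p (restrict x I) * r (restrict x J)) (\<lambda>_. 1) = 1"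
    unfolding wsum_join[OF assms(1)] by (simp add: assms)
  moreover have "0 \<le> p (restrict x I) * r (restrict x J)" if "x \<in> Pi\<^sub>E (I \<union> J) X" for x
    using that by (intro mult_nonneg_nonneg is_pmf_nonneg[OF assms(2)] is_pmf_nonneg[OF assms(3)]) auto
  ultimately show ?thesis unfolding is_pmf_def wsum_def by simp
qed

context mabc
begin

sublocale phase2: ensemble Qs pq "Pi\<^sub>E (A \<inter> B) X" pAB "Pi\<^sub>E (A - B) X" pAnB "Pi\<^sub>E (B - A) X" pBnA
  by unfold_locales (use Q inputs in auto)

abbreviation "P2 \<equiv> dist2 A B pq pAB pAnB pBnA W2"
abbreviation "\<Omega>2 \<equiv> space2 Qs m X Y A B"
abbreviation "S2 \<equiv> Y 0 \<times> Y (Suc m)"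

definition merge :: "(nat \<Rightarrow> 'x) \<Rightarrow> (nat \<Rightarrow> 'x) \<Rightarrow> (nat \<Rightarrow> 'x) \<Rightarrow> nat \<Rightarrow> 'x" where
  "merge u v t = join A (B - A) (join (A \<inter> B) (A - B) u v) t"

text \<open>The conditional law of all inputs of \<open>A\<close> given \<open>q\<close>. It is a
  product because the two groups of relays are independent given \<open>q\<close>, with arbitrary
  dependence inside each group.\<close>

definition pA :: "'q \<Rightarrow> (nat \<Rightarrow> 'x) \<Rightarrow> real" where
  "pA q x = pAB q (restrict x (A \<inter> B)) * pAnB q (restrict x (A - B))"

definition pB :: "'q \<Rightarrow> (nat \<Rightarrow> 'x) \<Rightarrow> real" where
  "pB q x = pAB q (restrict x (A \<inter> B)) * pBnA q (restrict x (B - A))"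

lemma AB_split: "(A \<inter> B) \<union> (A - B) = A" "(A \<inter> B) \<union> (B - A) = B" "A \<union> (B - A) = A \<union> B"
    "(A \<inter> B) \<inter> (A - B) = {}" "(A \<inter> B) \<inter> (B - A) = {}" "A \<inter> (B - A) = {}"
  by auto

lemma wsum_pA:
  "wsum (Pi\<^sub>E A X) (pA q) H
     = wsum (Pi\<^sub>E (A \<inter> B) X) (pAB q) (\<lambda>u. wsum (Pi\<^sub>E (A - B) X) (pAnB q) (\<lambda>v. H (join (A \<inter> B) (A - B) u v)))"
  using wsum_join[OF AB_split(4), of X "pAB q" "pAnB q" H] unfolding pA_def[abs_def] AB_split .

lemma wsum_pB:
  "wsum (Pi\<^sub>E B X) (pB q) H
     = wsum (Pi\<^sub>E (A \<inter> B) X) (pAB q) (\<lambda>u. wsum (Pi\<^sub>E (B - A) X) (pBnA q) (\<lambda>t. H (join (A \<inter> B) (B - A) u t)))"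
  using wsum_join[OF AB_split(5), of X "pAB q" "pBnA q" H] unfolding pB_def[abs_def] AB_split .

lemma pA_pmf: "q \<in> Qs \<Longrightarrow> is_pmf (Pi\<^sub>E A X) (pA q)"
  using is_pmf_join[OF AB_split(4), of X "pAB q" "pAnB q"] inputs unfolding pA_def[abs_def] AB_split by blast

lemma pB_pmf: "q \<in> Qs \<Longrightarrow> is_pmf (Pi\<^sub>E B X) (pB q)"
  using is_pmf_join[OF AB_split(5), of X "pAB q" "pBnA q"] inputs unfolding pB_def[abs_def] AB_split by blast

lemma merge_in:
  assumes "u \<in> Pi\<^sub>E (A \<inter> B) X" "v \<in> Pi\<^sub>E (A - B) X" "t \<in> Pi\<^sub>E (B - A) X"
  shows "merge u v t \<in> Pi\<^sub>E (A \<union> B) X"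
  using join_in[OF join_in[OF assms(1,2), unfolded AB_split(1)] assms(3)]
  unfolding merge_def AB_split .

lemma restrict_merge:
  shows "restrict (merge u v t) A = join (A \<inter> B) (A - B) u v"
    and "restrict (merge u v t) B = join (A \<inter> B) (B - A) u t"
  unfolding merge_def join_def by (auto simp: fun_eq_iff restrict_def)

lemma wsum_space2:
  "wsum \<Omega>2 P2 G = wsum Qs pq (\<lambda>q. wsum (Pi\<^sub>E (A \<inter> B) X) (pAB q) (\<lambda>u. wsum (Pi\<^sub>E (A - B) X) (pAnB q) (\<lambda>v.
     wsum (Pi\<^sub>E (B - A) X) (pBnA q) (\<lambda>t. wsum S2 (W2 (merge u v t)) (\<lambda>z. G (q, merge u v t, z))))))"
proof -
  have eq: "P2 = (\<lambda>(q, r). pq q * (\<lambda>(x, z). (pA q (restrict x A) * pBnA q (restrict x (B - A))) * W2 x z) r)"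
    unfolding pA_def by (auto simp: dist2_def fun_eq_iff Int_absorb1 Int_absorb2 Int_Diff)
  show ?thesis
    unfolding eq space2_def wsum_Times
    by (subst AB_split(3)[symmetric], subst wsum_join[OF AB_split(6)])
       (simp only: wsum_pA merge_def)
qed

lemma W2_pmf: "x \<in> Pi\<^sub>E (A \<union> B) X \<Longrightarrow> is_pmf S2 (W2 x)"
  using ch2 unfolding mabc_channel2_def by blast

lemma wsum_inputs2:
  "wsum \<Omega>2 P2 (\<lambda>(q, x, z). G q x)
     = wsum Qs pq (\<lambda>q. wsum (Pi\<^sub>E (A \<inter> B) X) (pAB q) (\<lambda>u. wsum (Pi\<^sub>E (A - B) X) (pAnB q) (\<lambda>v.
         wsum (Pi\<^sub>E (B - A) X) (pBnA q) (\<lambda>t. G q (merge u v t)))))"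
  unfolding wsum_space2 by (intro wsum_cong) (auto simp: W2_pmf merge_in)

lemma wsum_inputs2_A:
  "wsum \<Omega>2 P2 (\<lambda>(q, x, z). G q (restrict x A)) = wsum Qs pq (\<lambda>q. wsum (Pi\<^sub>E A X) (pA q) (G q))"
  unfolding wsum_inputs2 wsum_pA restrict_merge
  by (rule wsum_cong) (use inputs in auto)

lemma wsum_inputs2_B:
  "wsum \<Omega>2 P2 (\<lambda>(q, x, z). G q (restrict x B)) = wsum Qs pq (\<lambda>q. wsum (Pi\<^sub>E B X) (pB q) (G q))"
  unfolding wsum_inputs2 wsum_pB restrict_merge
  by (rule wsum_cong) (use inputs in auto)

lemma dist2_pmf: "is_pmf \<Omega>2 P2"
proof -
  have "is_pmf (Pi\<^sub>E (A \<union> B) X) (\<lambda>x. pA q (restrict x A) * pBnA q (restrict x (B - A)))" if "q \<in> Qs" for q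
    using is_pmf_join[OF AB_split(6) pA_pmf[OF that]] inputs that unfolding AB_split by blast
  moreover have eq: "P2 = (\<lambda>(q, r). pq q * (\<lambda>(x, z). (pA q (restrict x A) * pBnA q (restrict x (B - A))) * W2 x z) r)"
    unfolding pA_def by (auto simp: dist2_def fun_eq_iff Int_absorb1 Int_absorb2 Int_Diff)
  ultimately show ?thesis
    unfolding eq space2_def by (intro is_pmf_Times Q W2_pmf)
qed

lemma finite_space2: "finite \<Omega>2"
  by (rule is_pmf_finite[OF dist2_pmf])

lemma dist2_nonneg: "\<omega> \<in> \<Omega>2 \<Longrightarrow> 0 \<le> P2 \<omega>"
  by (rule is_pmf_nonneg[OF dist2_pmf])

text \<open>Contention \<open>First\<close> stands for the terminal \<open>b\<close>, which has to find the message of \<open>a\<close>, and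
  \<open>Second\<close> for the terminal \<open>a\<close>.\<close>

definition heard :: "contention \<Rightarrow> 'y \<times> 'y \<Rightarrow> 'y" where
  "heard c = (if c = First then snd else fst)"

definition senders :: "contention \<Rightarrow> nat set" where
  "senders c = (if c = First then A else B)"

text \<open>Only the inputs of \<open>senders c\<close> enter; the third group of relays is averaged
  out as noise. For the terminal \<open>b\<close> this gives I(X_A; Y_b | Q), without X_{B - A} in
  the condition.\<close>

definition terminal_dens :: "contention \<Rightarrow> 'q \<times> (nat \<Rightarrow> 'x) \<times> (nat \<Rightarrow> 'x) \<times> (nat \<Rightarrow> 'x) \<Rightarrow> 'y \<Rightarrow> real" where
  "terminal_dens c = (\<lambda>(q, u, v, t) y.
     dens P2 \<Omega>2 (\<lambda>(q, x, z). restrict x (senders c)) (\<lambda>(q, x, z). heard c z) (\<lambda>(q, x, z). q)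
       (restrict (merge u v t) (senders c)) y q)"

definition terminal_info :: "contention \<Rightarrow> real" where
  "terminal_info c =
     cmi P2 \<Omega>2 (\<lambda>(q, x, z). restrict x (senders c)) (\<lambda>(q, x, z). heard c z) (\<lambda>(q, x, z). q)"

lemma terminal_info_eq:
  "terminal_info c = phase2.mean (\<lambda>x. wsum S2 ((\<lambda>(q, u, v, t). W2 (merge u v t)) x)
     (\<lambda>z. log 2 (terminal_dens c x (heard c z))))"
  unfolding terminal_info_def cmi_eq_wsum_dens wsum_space2 phase2.mean_def terminal_dens_def by simp

lemma terminal_dens_nonneg: "0 \<le> terminal_dens c x y"
  unfolding terminal_dens_def by (cases x) (simp add: dens_nonneg dist2_nonneg)

lemma terminal_dens_pos:
  assumes "(q, merge u v t, z) \<in> \<Omega>2" "0 < P2 (q, merge u v t, z)"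
  shows "0 < terminal_dens c (q, u, v, t) (heard c z)"
  using dens_pos[of \<Omega>2 P2 "(q, merge u v t, z)" "\<lambda>(q, x, z). restrict x (senders c)" "\<lambda>(q, x, z). heard c z"
      "\<lambda>(q, x, z). q", OF finite_space2 dist2_nonneg assms]
  unfolding terminal_dens_def by simp

text \<open>The counterpart of \<open>marg1_indep\<close>: the third group of relays integrates out,
  and what remains of the input law is \<open>pA\<close> or \<open>pB\<close>.\<close>

lemma marg2_indep:
  shows "x' \<in> Pi\<^sub>E A X \<Longrightarrow> marg P2 \<Omega>2 (\<lambda>\<omega>. ((\<lambda>(q, x, z). restrict x A) \<omega>, (\<lambda>(q, x, z). q) \<omega>)) (x', q')
       = pA q' x' * marg P2 \<Omega>2 (\<lambda>(q, x, z). q) q'"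
    and "x' \<in> Pi\<^sub>E B X \<Longrightarrow> marg P2 \<Omega>2 (\<lambda>\<omega>. ((\<lambda>(q, x, z). restrict x B) \<omega>, (\<lambda>(q, x, z). q) \<omega>)) (x', q')
       = pB q' x' * marg P2 \<Omega>2 (\<lambda>(q, x, z). q) q'"
proof -
  have fin: "finite (Pi\<^sub>E A X)" "finite (Pi\<^sub>E B X)" if "q' \<in> Qs"
    using is_pmf_finite[OF pA_pmf[OF that]] is_pmf_finite[OF pB_pmf[OF that]] by auto
  have mA: "marg P2 \<Omega>2 (\<lambda>\<omega>. ((\<lambda>(q, x, z). restrict x A) \<omega>, (\<lambda>(q, x, z). q) \<omega>)) (x', q')
      = wsum Qs pq (\<lambda>q. wsum (Pi\<^sub>E A X) (pA q) (\<lambda>x. if q = q' \<and> x = x' then 1 else 0))"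
    unfolding wsum_inputs2_A[symmetric] marg_eq_wsum[OF finite_space2] by (rule wsum_cong) auto
  have mB: "marg P2 \<Omega>2 (\<lambda>\<omega>. ((\<lambda>(q, x, z). restrict x B) \<omega>, (\<lambda>(q, x, z). q) \<omega>)) (x', q')
      = wsum Qs pq (\<lambda>q. wsum (Pi\<^sub>E B X) (pB q) (\<lambda>x. if q = q' \<and> x = x' then 1 else 0))"
    unfolding wsum_inputs2_B[symmetric] marg_eq_wsum[OF finite_space2] by (rule wsum_cong) auto
  have mq: "marg P2 \<Omega>2 (\<lambda>(q, x, z). q) q'
      = wsum Qs pq (\<lambda>q. wsum (Pi\<^sub>E A X) (pA q) (\<lambda>x. if q = q' then 1 else 0))"
    unfolding wsum_inputs2_A[symmetric] marg_eq_wsum[OF finite_space2] by (rule wsum_cong) auto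
  show "x' \<in> Pi\<^sub>E A X \<Longrightarrow> marg P2 \<Omega>2 (\<lambda>\<omega>. ((\<lambda>(q, x, z). restrict x A) \<omega>, (\<lambda>(q, x, z). q) \<omega>)) (x', q')
       = pA q' x' * marg P2 \<Omega>2 (\<lambda>(q, x, z). q) q'"
    unfolding mA mq by (cases "q' \<in> Qs") (simp_all add: marg1_simps fin pA_pmf)
  show "x' \<in> Pi\<^sub>E B X \<Longrightarrow> marg P2 \<Omega>2 (\<lambda>\<omega>. ((\<lambda>(q, x, z). restrict x B) \<omega>, (\<lambda>(q, x, z). q) \<omega>)) (x', q')
       = pB q' x' * marg P2 \<Omega>2 (\<lambda>(q, x, z). q) q'"
    unfolding mB mq by (cases "q' \<in> Qs") (simp_all add: marg1_simps fin pA_pmf)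
qed

text \<open>A rival of class \<open>First\<close> has fresh \<open>u\<close> and \<open>v\<close>,
  which together are a draw of the inputs of \<open>A\<close> from \<open>pA q\<close>. The retained
  \<open>t\<close> is invisible to the density, which sees the restriction to \<open>A\<close>.
  \<open>Second\<close> exchanges the roles.\<close>

lemma terminal_rival_mean:
  assumes x: "x \<in> Qs \<times> Pi\<^sub>E (A \<inter> B) X \<times> Pi\<^sub>E (A - B) X \<times> Pi\<^sub>E (B - A) X" and c: "c \<in> {First, Second}"
  shows "phase2.rival_mean c x (\<lambda>x'. terminal_dens c x' y) \<le> 1"
proof -
  obtain q u v t where xeq: "x = (q, u, v, t)" and q: "q \<in> Qs" using x by auto
  have fin: "finite (Pi\<^sub>E A X)" "finite (Pi\<^sub>E B X)"
    using is_pmf_finite[OF pA_pmf[OF q]] is_pmf_finite[OF pB_pmf[OF q]] by auto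
  note le1 = wsum_dens_le_1[OF finite_space2 dist2_nonneg]
  show ?thesis
  proof (cases "c = First")
    case True
    have "wsum (Pi\<^sub>E A X) (pA q) (\<lambda>x. dens P2 \<Omega>2 (\<lambda>(q, x, z). restrict x A)
        (\<lambda>(q, x, z). heard c z) (\<lambda>(q, x, z). q) x y q) \<le> 1"
      by (rule le1[OF _ fin(1) marg2_indep(1)])
    then show ?thesis
      by (simp add: True xeq terminal_dens_def senders_def restrict_merge wsum_pA)
  next
    case False
    then have c2: "c = Second" using c by simp
    have "wsum (Pi\<^sub>E B X) (pB q) (\<lambda>x. dens P2 \<Omega>2 (\<lambda>(q, x, z). restrict x B)
        (\<lambda>(q, x, z). heard c z) (\<lambda>(q, x, z). q) x y q) \<le> 1"
      by (rule le1[OF _ fin(2) marg2_indep(2)])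
    then show ?thesis
      by (simp add: c2 xeq terminal_dens_def senders_def restrict_merge wsum_pB)
  qed
qed

text \<open>A terminal inserts its own message and searches only for the other one, so it meets a
  single class of rivals. Where no candidate passes, the choice is arbitrary: such outputs are
  already counted as confusable.\<close>

lemma terminal_decoders:
  fixes g :: "contention \<Rightarrow> real"
  shows "\<exists>da db. \<forall>wa<Ma. \<forall>wb<Mb. \<forall>z.
     (\<not> confusable n (g First) (\<lambda>x z. terminal_dens First x (heard First z)) (\<lambda>k. word (C k))
         (rivals First Ma Mb (wa, wb)) (wa, wb) z \<longrightarrow> db wb (\<lambda>k\<in>{..<n}. snd (z k)) = wa) \<and>
     (\<not> confusable n (g Second) (\<lambda>x z. terminal_dens Second x (heard Second z)) (\<lambda>k. word (C k))
         (rivals Second Ma Mb (wa, wb)) (wa, wb) z \<longrightarrow> da wa (\<lambda>k\<in>{..<n}. fst (z k)) = wb)"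
proof -
  define ok where "ok c obs w \<longleftrightarrow> passes n g terminal_dens {c} (\<lambda>k. word (C k)) obs w" for c obs w
  define db where "db wb obs = (SOME a. a < Ma \<and> ok First obs (a, wb))" for wb obs
  define da where "da wa obs = (SOME b. b < Mb \<and> ok Second obs (wa, b))" for wa obs
  have restr: "ok c (\<lambda>k\<in>{..<n}. y k) w \<longleftrightarrow> ok c y w" for c y w
    unfolding ok_def passes_def by simp
  show ?thesis
  proof (rule exI[of _ da], rule exI[of _ db], intro allI impI conjI)
    fix wa wb z assume w: "wa < Ma" "wb < Mb"
    have conf: "confusable n (g c) (\<lambda>x z. terminal_dens c x (heard c z)) (\<lambda>k. word (C k)) V w z
        \<longleftrightarrow> confusable n (g c) (terminal_dens c) (\<lambda>k. word (C k)) V w (\<lambda>k. heard c (z k))" for c V w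
      unfolding confusable_def ..
    {
      assume "\<not> confusable n (g First) (\<lambda>x z. terminal_dens First x (heard First z)) (\<lambda>k. word (C k))
         (rivals First Ma Mb (wa, wb)) (wa, wb) z"
      then have nc: "\<not> confusable n (g c) (terminal_dens c) (\<lambda>k. word (C k))
         (rivals c Ma Mb (wa, wb)) (wa, wb) (\<lambda>k. snd (z k))" if "c \<in> {First}" for c
        using that unfolding conf by (simp add: heard_def)
      have ok: "wa < Ma \<and> ok First (\<lambda>k\<in>{..<n}. snd (z k)) (wa, wb)"
        unfolding restr using w passes_sent[of "{First}" n g, OF nc] by (simp add: ok_def)
      have "db wb (\<lambda>k\<in>{..<n}. snd (z k)) < Ma \<and> ok First (\<lambda>k\<in>{..<n}. snd (z k)) (db wb (\<lambda>k\<in>{..<n}. snd (z k)), wb)"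
        unfolding db_def by (rule someI[of "\<lambda>a. a < Ma \<and> ok First (\<lambda>k\<in>{..<n}. snd (z k)) (a, wb)", OF ok])
      then show "db wb (\<lambda>k\<in>{..<n}. snd (z k)) = wa"
        unfolding restr unfolding ok_def using passes_first[of "{First}" n g, OF nc] by blast
    }
    {
      assume "\<not> confusable n (g Second) (\<lambda>x z. terminal_dens Second x (heard Second z)) (\<lambda>k. word (C k))
         (rivals Second Ma Mb (wa, wb)) (wa, wb) z"
      then have nc: "\<not> confusable n (g c) (terminal_dens c) (\<lambda>k. word (C k))
         (rivals c Ma Mb (wa, wb)) (wa, wb) (\<lambda>k. fst (z k))" if "c \<in> {Second}" for c
        using that unfolding conf by (simp add: heard_def)
      have ok: "wb < Mb \<and> ok Second (\<lambda>k\<in>{..<n}. fst (z k)) (wa, wb)"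
        unfolding restr using w passes_sent[of "{Second}" n g, OF nc] by (simp add: ok_def)
      have "da wa (\<lambda>k\<in>{..<n}. fst (z k)) < Mb \<and> ok Second (\<lambda>k\<in>{..<n}. fst (z k)) (wa, da wa (\<lambda>k\<in>{..<n}. fst (z k)))"
        unfolding da_def by (rule someI[of "\<lambda>b. b < Mb \<and> ok Second (\<lambda>k\<in>{..<n}. fst (z k)) (wa, b)", OF ok])
      then show "da wa (\<lambda>k\<in>{..<n}. fst (z k)) = wb"
        unfolding restr unfolding ok_def using passes_second[of "{Second}" n g, OF nc] by blast
    }
  qed
qed

text \<open>The errors of both terminals are added inside one sum, so that the same relay codewords
  serve both directions. The letters \<open>q\<close> are frozen along with the codebook, and only
  \<open>u\<close>, \<open>v\<close>, \<open>t\<close> survive as encoders.\<close>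

lemma phase2_codes:
  fixes g :: "contention \<Rightarrow> real"
  assumes g: "\<forall>c\<in>{First, Second}. g c < terminal_info c"
  shows "\<exists>\<rho>. (\<forall>c\<in>{First, Second}. 0 \<le> \<rho> c \<and> \<rho> c < 1) \<and> (\<forall>n Ma Mb. \<exists>u v t da db.
     (\<forall>w\<in>{..<Ma} \<times> {..<Mb}. \<forall>k<n. u w k \<in> Pi\<^sub>E (A \<inter> B) X) \<and> (\<forall>w<Ma. \<forall>k<n. v w k \<in> Pi\<^sub>E (A - B) X) \<and>
     (\<forall>w<Mb. \<forall>k<n. t w k \<in> Pi\<^sub>E (B - A) X) \<and>
     (\<Sum>wa<Ma. \<Sum>wb<Mb. wsum (Pi\<^sub>E {..<n} (\<lambda>_. S2)) (\<lambda>z. \<Prod>k<n. W2 (merge (u (wa, wb) k) (v wa k) (t wb k)) (z k))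
         (\<lambda>z. of_bool (db wb (\<lambda>k\<in>{..<n}. snd (z k)) \<noteq> wa) + of_bool (da wa (\<lambda>k\<in>{..<n}. fst (z k)) \<noteq> wb)))
       \<le> real (Ma * Mb) * (\<Sum>c\<in>{First, Second}. \<rho> c ^ n + real (num_rivals c Ma Mb) * 2 powr (- (real n * g c))))"
proof -
  let ?K = "\<lambda>(q, u, v, t). W2 (merge u v t)"
  let ?L = "\<lambda>c x z. terminal_dens c x (heard c z)"
  let ?X = "Qs \<times> Pi\<^sub>E (A \<inter> B) X \<times> Pi\<^sub>E (A - B) X \<times> Pi\<^sub>E (B - A) X"
  have finS2: "finite S2" using alph by auto
  have "\<exists>\<rho>. (\<forall>c\<in>{First, Second}. 0 \<le> \<rho> c \<and> \<rho> c < 1) \<and> (\<forall>n Ma Mb. \<exists>C\<in>phase2.codebook n Ma Mb.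
      (\<Sum>w\<in>{..<Ma} \<times> {..<Mb}. wsum (Pi\<^sub>E {..<n} (\<lambda>_. S2)) (\<lambda>z. \<Prod>k<n. ?K (word (C k) w) (z k))
         (\<lambda>z. \<Sum>c\<in>{First, Second}. of_bool (confusable n (g c) (?L c) (\<lambda>k. word (C k)) (rivals c Ma Mb w) w z)))
      \<le> real (Ma * Mb) * (\<Sum>c\<in>{First, Second}. \<rho> c ^ n + real (num_rivals c Ma Mb) * 2 powr (- (real n * g c))))"
  proof (rule phase2.good_codebooks[OF _ finS2])
    show "is_pmf S2 (?K x)" if "x \<in> ?X" for x
      using that W2_pmf merge_in by auto
    show "0 \<le> ?L c x y" for c x y by (rule terminal_dens_nonneg)
    show "0 < ?L c (q, u, v, t) z"
      if "(q, u, v, t) \<in> ?X" "z \<in> S2" "0 < pq q" "0 < pAB q u" "0 < pAnB q v"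
        "0 < pBnA q t" "0 < ?K (q, u, v, t) z" for c q u v t z
    proof (rule terminal_dens_pos)
      have eq: "restrict (merge u v t) (A \<inter> B) = u" "restrict (merge u v t) (A - B) = v" "restrict (merge u v t) (B - A) = t"
        using that(1) unfolding merge_def join_def
        by (auto simp: fun_eq_iff restrict_def PiE_iff extensional_def)
      show "(q, merge u v t, z) \<in> \<Omega>2" using that merge_in by (auto simp: space2_def)
      show "0 < P2 (q, merge u v t, z)" using that by (simp add: dist2_def eq)
    qed
    show "g c < phase2.mean (\<lambda>x. wsum S2 (?K x) (\<lambda>y. log 2 (?L c x y)))" if "c \<in> {First, Second}" for c
      using g that unfolding terminal_info_eq by blast
    show "phase2.rival_mean c x (\<lambda>x'. ?L c x' y) \<le> 1" if "c \<in> {First, Second}" "x \<in> ?X" for c x y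
      by (rule terminal_rival_mean[OF that(2,1)])
  qed auto
  then obtain \<rho> where \<rho>: "\<forall>c\<in>{First, Second}. 0 \<le> \<rho> c \<and> \<rho> c < 1" and cb: "\<forall>n Ma Mb. \<exists>C\<in>phase2.codebook n Ma Mb.
      (\<Sum>w\<in>{..<Ma} \<times> {..<Mb}. wsum (Pi\<^sub>E {..<n} (\<lambda>_. S2)) (\<lambda>z. \<Prod>k<n. ?K (word (C k) w) (z k))
         (\<lambda>z. \<Sum>c\<in>{First, Second}. of_bool (confusable n (g c) (?L c) (\<lambda>k. word (C k)) (rivals c Ma Mb w) w z)))
      \<le> real (Ma * Mb) * (\<Sum>c\<in>{First, Second}. \<rho> c ^ n + real (num_rivals c Ma Mb) * 2 powr (- (real n * g c)))"
    by (elim exE conjE)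
  show ?thesis
  proof (intro exI[of _ \<rho>] conjI \<rho> allI)
    fix n Ma Mb :: nat
    from cb[rule_format, of n Ma Mb] obtain C where C: "C \<in> phase2.codebook n Ma Mb" and le:
      "(\<Sum>w\<in>{..<Ma} \<times> {..<Mb}. wsum (Pi\<^sub>E {..<n} (\<lambda>_. S2)) (\<lambda>z. \<Prod>k<n. ?K (word (C k) w) (z k))
         (\<lambda>z. \<Sum>c\<in>{First, Second}. of_bool (confusable n (g c) (?L c) (\<lambda>k. word (C k)) (rivals c Ma Mb w) w z)))
      \<le> real (Ma * Mb) * (\<Sum>c\<in>{First, Second}. \<rho> c ^ n + real (num_rivals c Ma Mb) * 2 powr (- (real n * g c)))"
      by (elim bexE)
    from terminal_decoders[of Ma Mb n g C] obtain da db where dec: "\<forall>wa<Ma. \<forall>wb<Mb. \<forall>z.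
     (\<not> confusable n (g First) (?L First) (\<lambda>k. word (C k))
         (rivals First Ma Mb (wa, wb)) (wa, wb) z \<longrightarrow> db wb (\<lambda>k\<in>{..<n}. snd (z k)) = wa) \<and>
     (\<not> confusable n (g Second) (?L Second) (\<lambda>k. word (C k))
         (rivals Second Ma Mb (wa, wb)) (wa, wb) z \<longrightarrow> da wa (\<lambda>k\<in>{..<n}. fst (z k)) = wb)"
      by (elim exE)
    let ?u = "\<lambda>w k. fst (snd (C k)) w" and ?v = "\<lambda>w k. fst (snd (snd (C k))) w"
      and ?t = "\<lambda>w k. snd (snd (snd (C k))) w"
    have Ck: "C k \<in> phase2.letters Ma Mb" if "k < n" for k
      using C that unfolding phase2.codebook_def by auto
    have u: "?u w k \<in> Pi\<^sub>E (A \<inter> B) X" if "w \<in> {..<Ma} \<times> {..<Mb}" "k < n" for w k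
      by (rule PiE_mem[of "fst (snd (C k))" "{..<Ma} \<times> {..<Mb}" "\<lambda>_. Pi\<^sub>E (A \<inter> B) X"])
         (use Ck[OF that(2)] that(1) in \<open>simp_all add: phase2.letters_def mem_Times_iff\<close>)
    have v: "?v w k \<in> Pi\<^sub>E (A - B) X" if "w < Ma" "k < n" for w k
      by (rule PiE_mem[of "fst (snd (snd (C k)))" "{..<Ma}" "\<lambda>_. Pi\<^sub>E (A - B) X"])
         (use Ck[OF that(2)] that(1) in \<open>simp_all add: phase2.letters_def mem_Times_iff\<close>)
    have t: "?t w k \<in> Pi\<^sub>E (B - A) X" if "w < Mb" "k < n" for w k
      by (rule PiE_mem[of "snd (snd (snd (C k)))" "{..<Mb}" "\<lambda>_. Pi\<^sub>E (B - A) X"])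
         (use Ck[OF that(2)] that(1) in \<open>simp_all add: phase2.letters_def mem_Times_iff\<close>)
    have Keq: "?K (word (C k) (wa, wb)) = W2 (merge (?u (wa, wb) k) (?v wa k) (?t wb k))" for k wa wb
      by (cases "C k") simp
    let ?err = "\<lambda>wa wb z. of_bool (db wb (\<lambda>k\<in>{..<n}. snd (z k)) \<noteq> wa) + of_bool (da wa (\<lambda>k\<in>{..<n}. fst (z k)) \<noteq> wb) :: real"
    have "(\<Sum>wa<Ma. \<Sum>wb<Mb. wsum (Pi\<^sub>E {..<n} (\<lambda>_. S2)) (\<lambda>z. \<Prod>k<n. W2 (merge (?u (wa, wb) k) (?v wa k) (?t wb k)) (z k)) (?err wa wb))
        \<le> (\<Sum>wa<Ma. \<Sum>wb<Mb. wsum (Pi\<^sub>E {..<n} (\<lambda>_. S2)) (\<lambda>z. \<Prod>k<n. W2 (merge (?u (wa, wb) k) (?v wa k) (?t wb k)) (z k))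
            (\<lambda>z. \<Sum>c\<in>{First, Second}. of_bool (confusable n (g c) (?L c) (\<lambda>k. word (C k))
               (rivals c Ma Mb (wa, wb)) (wa, wb) z)))"
    proof (intro sum_mono wsum_mono)
      fix wa wb z assume w: "wa \<in> {..<Ma}" "wb \<in> {..<Mb}" and z: "z \<in> Pi\<^sub>E {..<n} (\<lambda>_. S2)"
      show "0 \<le> (\<Prod>k<n. W2 (merge (?u (wa, wb) k) (?v wa k) (?t wb k)) (z k))"
      proof (intro prod_nonneg ballI is_pmf_nonneg[OF W2_pmf] merge_in)
        fix k assume k: "k \<in> {..<n}"
        show "?u (wa, wb) k \<in> Pi\<^sub>E (A \<inter> B) X" "?v wa k \<in> Pi\<^sub>E (A - B) X" "?t wb k \<in> Pi\<^sub>E (B - A) X"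
          using u[of "(wa, wb)" k] v[of wa k] t[of wb k] w k by auto
        show "z k \<in> S2" using PiE_mem[OF z k] .
      qed
      show "?err wa wb z \<le> (\<Sum>c\<in>{First, Second}. of_bool (confusable n (g c) (?L c)
          (\<lambda>k. word (C k)) (rivals c Ma Mb (wa, wb)) (wa, wb) z))"
        using dec[rule_format, of wa wb z] w by (auto simp: of_bool_def)
    qed
    also have "\<dots> = (\<Sum>w\<in>{..<Ma} \<times> {..<Mb}. wsum (Pi\<^sub>E {..<n} (\<lambda>_. S2)) (\<lambda>z. \<Prod>k<n. ?K (word (C k) w) (z k))
         (\<lambda>z. \<Sum>c\<in>{First, Second}. of_bool (confusable n (g c) (?L c) (\<lambda>k. word (C k)) (rivals c Ma Mb w) w z)))"
      unfolding sum.cartesian_product by (rule sum.cong) (auto simp only: Keq split: prod.splits)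
    also note le
    finally have bound: "(\<Sum>wa<Ma. \<Sum>wb<Mb. wsum (Pi\<^sub>E {..<n} (\<lambda>_. S2))
           (\<lambda>z. \<Prod>k<n. W2 (merge (?u (wa, wb) k) (?v wa k) (?t wb k)) (z k)) (?err wa wb))
       \<le> real (Ma * Mb) * (\<Sum>c\<in>{First, Second}. \<rho> c ^ n + real (num_rivals c Ma Mb) * 2 powr (- (real n * g c)))" .
    show "\<exists>u v t da db.
     (\<forall>w\<in>{..<Ma} \<times> {..<Mb}. \<forall>k<n. u w k \<in> Pi\<^sub>E (A \<inter> B) X) \<and> (\<forall>w<Ma. \<forall>k<n. v w k \<in> Pi\<^sub>E (A - B) X) \<and>
     (\<forall>w<Mb. \<forall>k<n. t w k \<in> Pi\<^sub>E (B - A) X) \<and>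
     (\<Sum>wa<Ma. \<Sum>wb<Mb. wsum (Pi\<^sub>E {..<n} (\<lambda>_. S2)) (\<lambda>z. \<Prod>k<n. W2 (merge (u (wa, wb) k) (v wa k) (t wb k)) (z k))
         (\<lambda>z. of_bool (db wb (\<lambda>k\<in>{..<n}. snd (z k)) \<noteq> wa) + of_bool (da wa (\<lambda>k\<in>{..<n}. fst (z k)) \<noteq> wb)))
       \<le> real (Ma * Mb) * (\<Sum>c\<in>{First, Second}. \<rho> c ^ n + real (num_rivals c Ma Mb) * 2 powr (- (real n * g c)))"
      by (rule exI[of _ ?u], rule exI[of _ ?v], rule exI[of _ ?t], rule exI[of _ da], rule exI[of _ db])
         (use u v t bound in blast)
  qed
qed

end

section \<open>Combining the phases\<close>

fun contention_rate :: "contention \<Rightarrow> real \<Rightarrow> real \<Rightarrow> real" where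
  "contention_rate First Ra Rb = Ra"
| "contention_rate Second Ra Rb = Rb"
| "contention_rate Both Ra Rb = Ra + Rb"

section \<open>Numbers of messages, phase lengths and the decay of the error terms\<close>

lemma msgs_le: "real (msgs n R) \<le> 2 powr (real n * R)"
  unfolding msgs_def by (simp add: of_nat_nat)

lemma msgs_pos: "0 \<le> R \<Longrightarrow> 0 < msgs n R"
  unfolding msgs_def by (simp add: ge_one_powr_ge_zero)

lemma num_rivals_msgs_le:
  "real (num_rivals c (msgs n Ra) (msgs n Rb)) \<le> 2 powr (real n * contention_rate c Ra Rb)"
  by (cases c) (auto simp: msgs_le distrib_left powr_add intro!: mult_mono)

text \<open>Rates are counted per use of the whole block \<open>i\<close>, thresholds per use of the
  phase, which has \<open>n i\<close> uses. The product is at most 2 to the power \<open>i\<close>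
  times \<open>R - n i / i * g\<close>, and this factor tends to \<open>R - D * g\<close>, which is
  negative.\<close>

lemma rival_term_tendsto_0:
  fixes n K :: "nat \<Rightarrow> nat"
  assumes n: "(\<lambda>i. real (n i) / real i) \<longlonglongrightarrow> D" and R: "R < D * g"
    and K: "\<And>i. real (K i) \<le> 2 powr (real i * R)"
  shows "(\<lambda>i. real (K i) * 2 powr (- (real (n i) * g))) \<longlonglongrightarrow> 0"
proof (rule tendsto_sandwich[where f="\<lambda>_. 0"])
  let ?e = "\<lambda>i. (R - real (n i) / real i * g) * real i"
  have "(\<lambda>i. R - real (n i) / real i * g) \<longlonglongrightarrow> R - D * g"
    by (intro tendsto_intros n)
  then have "filterlim ?e at_bot sequentially"
    by (rule filterlim_tendsto_neg_mult_at_bot) (use R filterlim_real_sequentially in auto)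
  then have "filterlim (\<lambda>i. ln 2 * ?e i) at_bot sequentially"
    by (intro filterlim_tendsto_pos_mult_at_bot[OF tendsto_const]) auto
  then have "((\<lambda>i. exp (ln 2 * ?e i)) \<longlongrightarrow> 0) sequentially"
    by (rule filterlim_compose[OF exp_at_bot])
  then show "(\<lambda>i. 2 powr ?e i) \<longlonglongrightarrow> 0" by (simp add: powr_def mult.commute)
  show "\<forall>\<^sub>F i in sequentially. real (K i) * 2 powr (- (real (n i) * g)) \<le> 2 powr ?e i"
    using eventually_gt_at_top[of 0]
  proof eventually_elim
    case (elim i)
    have "real (K i) * 2 powr (- (real (n i) * g)) \<le> 2 powr (real i * R) * 2 powr (- (real (n i) * g))"
      by (intro mult_right_mono K) simp
    also have "\<dots> = 2 powr (real i * R - real (n i) * g)"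
      by (simp add: powr_add[symmetric])
    also have "real i * R - real (n i) * g = ?e i"
      using elim by (simp add: left_diff_distrib)
    finally show ?case .
  qed
qed auto

lemma filterlim_linear_at_top:
  fixes n :: "nat \<Rightarrow> nat"
  assumes n: "(\<lambda>i. real (n i) / real i) \<longlonglongrightarrow> D" and D: "0 < D"
  shows "filterlim n at_top sequentially"
proof -
  have "filterlim (\<lambda>i. real (n i) / real i * real i) at_top sequentially"
    by (rule filterlim_tendsto_pos_mult_at_top[OF n D filterlim_real_sequentially])
  moreover have "\<forall>\<^sub>F i in sequentially. real (n i) / real i * real i = real (n i)"
    using eventually_gt_at_top[of 0] by eventually_elim simp
  ultimately have "filterlim (\<lambda>i. real (n i)) at_top sequentially"
    by (simp add: filterlim_cong)
  then show ?thesis by (simp add: filterlim_sequentially_iff_filterlim_real)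
qed

lemma nat_floor_ratio_tendsto:
  assumes "0 \<le> D"
  shows "(\<lambda>i. real (nat \<lfloor>D * real i\<rfloor>) / real i) \<longlonglongrightarrow> D"
proof (rule tendsto_sandwich)
  show "(\<lambda>i. D - 1 / real i) \<longlonglongrightarrow> D"
    using tendsto_diff[OF tendsto_const lim_1_over_n, of D] by simp
  have fl: "D * real i - 1 \<le> real (nat \<lfloor>D * real i\<rfloor>) \<and> real (nat \<lfloor>D * real i\<rfloor>) \<le> D * real i" for i
    using assms by (simp add: of_nat_nat)
  show "\<forall>\<^sub>F i in sequentially. D - 1 / real i \<le> real (nat \<lfloor>D * real i\<rfloor>) / real i"
    using eventually_gt_at_top[of 0]
  proof eventually_elim
    case (elim i)
    have "D - 1 / real i = (D * real i - 1) / real i" using elim by (simp add: diff_divide_distrib)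
    also have "\<dots> \<le> real (nat \<lfloor>D * real i\<rfloor>) / real i" by (intro divide_right_mono) (use fl in auto)
    finally show ?case .
  qed
  show "\<forall>\<^sub>F i in sequentially. real (nat \<lfloor>D * real i\<rfloor>) / real i \<le> D"
    using eventually_gt_at_top[of 0]
    by eventually_elim (use fl in \<open>simp add: divide_le_eq\<close>)
qed auto

lemma error_terms_tendsto_0:
  fixes n :: "nat \<Rightarrow> nat" and g \<rho> :: "'j \<Rightarrow> real"
  assumes n: "(\<lambda>i. real (n i) / real i) \<longlonglongrightarrow> D" and "0 < D" 
    and \<rho>: "0 \<le> \<rho> j" "\<rho> j < 1" and g: "contention_rate c Ra Rb < D * g j"
  shows "(\<lambda>i. \<rho> j ^ n i + real (num_rivals c (msgs i Ra) (msgs i Rb)) * 2 powr (- (real (n i) * g j))) \<longlonglongrightarrow> 0"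
proof -
  have "(\<lambda>k. \<rho> j ^ k) \<longlonglongrightarrow> 0" using \<rho> by (intro LIMSEQ_realpow_zero)
  from filterlim_compose[OF this filterlim_linear_at_top[OF n \<open>0 < D\<close>]]
    tendsto_add[OF _ rival_term_tendsto_0[OF n g num_rivals_msgs_le]]
  show ?thesis by fastforce
qed

section \<open>The joint code: relays re-encode what they decoded\<close>

context mabc
begin

definition relay_input :: "(nat \<Rightarrow> (nat \<Rightarrow> 'y) \<Rightarrow> nat \<times> nat) \<Rightarrow> (nat \<times> nat \<Rightarrow> nat \<Rightarrow> nat \<Rightarrow> 'x)
    \<Rightarrow> (nat \<Rightarrow> nat \<Rightarrow> nat \<Rightarrow> 'x) \<Rightarrow> (nat \<Rightarrow> nat \<Rightarrow> nat \<Rightarrow> 'x) \<Rightarrow> nat \<Rightarrow> nat \<Rightarrow> (nat \<Rightarrow> 'y) \<Rightarrow> 'x" where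
  "relay_input dec u v t r j obs =
     (if r \<in> A \<inter> B then u (dec r obs) j r else if r \<in> A then v (fst (dec r obs)) j r
      else t (snd (dec r obs)) j r)"

lemma relay_input_good:
  assumes "\<not> relay_error dec n wa wb ys"
  shows "(\<lambda>r\<in>A \<union> B. relay_input dec u v t r j (\<lambda>k\<in>{..<n}. ys k r)) = merge (u (wa, wb) j) (v wa j) (t wb j)"
proof
  fix r
  have "r \<in> A \<Longrightarrow> fst (dec r (\<lambda>k\<in>{..<n}. ys k r)) = wa" "r \<in> B \<Longrightarrow> snd (dec r (\<lambda>k\<in>{..<n}. ys k r)) = wb"
    using assms unfolding relay_error_def by auto
  moreover from this have "r \<in> A \<inter> B \<Longrightarrow> dec r (\<lambda>k\<in>{..<n}. ys k r) = (wa, wb)"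
    by (metis IntD1 IntD2 prod.collapse)
  ultimately show "(\<lambda>r\<in>A \<union> B. relay_input dec u v t r j (\<lambda>k\<in>{..<n}. ys k r)) r
      = merge (u (wa, wb) j) (v wa j) (t wb j) r"
    by (auto simp: merge_def join_def relay_input_def restrict_def)
qed

text \<open>Fix the phase-1 outputs. If all relays decoded correctly, the phase-2 channel law is
  exactly that of relays knowing the messages; otherwise the conditional error is at most 1.
  Averaging over the phase-1 outputs gives the sum of the two error probabilities.\<close>

lemma combined_code:
  assumes ea: "\<forall>w<Ma. \<forall>k<n1. ea w k \<in> X 0" and eb: "\<forall>w<Mb. \<forall>k<n1. eb w k \<in> X (Suc m)"
    and dec: "\<forall>r obs. dec r obs \<in> {..<Ma} \<times> {..<Mb}"
    and u: "\<forall>w\<in>{..<Ma} \<times> {..<Mb}. \<forall>k<n2. u w k \<in> Pi\<^sub>E (A \<inter> B) X"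
    and v: "\<forall>w<Ma. \<forall>k<n2. v w k \<in> Pi\<^sub>E (A - B) X"
    and t: "\<forall>w<Mb. \<forall>k<n2. t w k \<in> Pi\<^sub>E (B - A) X"
  shows "valid_code m X A B n1 n2 Ma Mb ea eb (relay_input dec u v t)"
    and "\<And>wa wb bad. wa < Ma \<Longrightarrow> wb < Mb \<Longrightarrow>
      (\<Sum>ys\<in>Pi\<^sub>E {..<n1} (\<lambda>_. S1). \<Sum>z\<in>Pi\<^sub>E {..<n2} (\<lambda>_. S2).
         if bad z then trans_prob A B W1 W2 n1 n2 ea eb (relay_input dec u v t) wa wb ys z else 0)
      \<le> wsum (Pi\<^sub>E {..<n1} (\<lambda>_. S1)) (\<lambda>ys. \<Prod>k<n1. W1 (ea wa k) (eb wb k) (ys k))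
            (\<lambda>ys. of_bool (relay_error dec n1 wa wb ys))
        + wsum (Pi\<^sub>E {..<n2} (\<lambda>_. S2)) (\<lambda>z. \<Prod>k<n2. W2 (merge (u (wa, wb) k) (v wa k) (t wb k)) (z k))
            (\<lambda>z. of_bool (bad z))"
    and "\<And>wa wb ys z. wa < Ma \<Longrightarrow> wb < Mb \<Longrightarrow> ys \<in> Pi\<^sub>E {..<n1} (\<lambda>_. S1) \<Longrightarrow> z \<in> Pi\<^sub>E {..<n2} (\<lambda>_. S2) \<Longrightarrow>
      0 \<le> trans_prob A B W1 W2 n1 n2 ea eb (relay_input dec u v t) wa wb ys z"
proof -
  let ?fr = "relay_input dec u v t"
  have fr: "?fr r j obs \<in> X r" if r: "r \<in> A \<union> B" and j: "j < n2" for r j obs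
  proof -
    obtain a b where ab: "dec r obs = (a, b)" "a < Ma" "b < Mb" using dec by force
    then have "u (a, b) j \<in> Pi\<^sub>E (A \<inter> B) X" "v a j \<in> Pi\<^sub>E (A - B) X" "t b j \<in> Pi\<^sub>E (B - A) X"
      using u v t j by auto
    then show ?thesis using r ab(1) by (auto simp: relay_input_def)
  qed
  then show "valid_code m X A B n1 n2 Ma Mb ea eb ?fr"
    using ea eb unfolding valid_code_def by blast
  let ?Y = "Pi\<^sub>E {..<n1} (\<lambda>_. S1)" and ?Z = "Pi\<^sub>E {..<n2} (\<lambda>_. S2)"
  let ?p = "\<lambda>wa wb ys. \<Prod>k<n1. W1 (ea wa k) (eb wb k) (ys k)"
  let ?x = "\<lambda>ys j. \<lambda>r\<in>A \<union> B. ?fr r j (\<lambda>k\<in>{..<n1}. ys k r)"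
  let ?r = "\<lambda>ys z. \<Prod>j<n2. W2 (?x ys j) (z j)"
  have pmf1: "is_pmf ?Y (?p wa wb)" if "wa < Ma" "wb < Mb" for wa wb
    using that ea eb by (intro is_pmf_PiE W1_pmf) auto
  have pmf2: "is_pmf ?Z (?r ys)" for ys
  proof (intro is_pmf_PiE W2_pmf)
    fix j assume "j \<in> {..<n2}"
    then show "?x ys j \<in> Pi\<^sub>E (A \<union> B) X"
      unfolding restrict_PiE_iff using fr by blast
  qed auto
  have tp: "trans_prob A B W1 W2 n1 n2 ea eb ?fr wa wb ys z = ?p wa wb ys * ?r ys z" for wa wb ys z
    unfolding trans_prob_def ..
  show "0 \<le> trans_prob A B W1 W2 n1 n2 ea eb ?fr wa wb ys z"
    if "wa < Ma" "wb < Mb" "ys \<in> ?Y" "z \<in> ?Z" for wa wb ys z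
    unfolding tp using is_pmf_nonneg[OF pmf1[OF that(1,2)] that(3)] is_pmf_nonneg[OF pmf2 that(4)]
    by (rule mult_nonneg_nonneg)
  fix wa wb and bad :: "(nat \<Rightarrow> 'y \<times> 'y) \<Rightarrow> bool" assume w: "wa < Ma" "wb < Mb"
  let ?ideal = "\<lambda>z. \<Prod>k<n2. W2 (merge (u (wa, wb) k) (v wa k) (t wb k)) (z k)"
  have ideal_nn: "0 \<le> ?ideal z" if "z \<in> ?Z" for z
    using that w u v t by (intro prod_nonneg ballI is_pmf_nonneg[OF W2_pmf] merge_in) auto
  have "(\<Sum>ys\<in>?Y. \<Sum>z\<in>?Z. if bad z then trans_prob A B W1 W2 n1 n2 ea eb ?fr wa wb ys z else 0)
      = wsum ?Y (?p wa wb) (\<lambda>ys. wsum ?Z (?r ys) (\<lambda>z. of_bool (bad z)))"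
    unfolding tp wsum_def sum_distrib_left by (intro sum.cong) auto
  also have "\<dots> \<le> wsum ?Y (?p wa wb) (\<lambda>ys. of_bool (relay_error dec n1 wa wb ys) + wsum ?Z ?ideal (\<lambda>z. of_bool (bad z)))"
  proof (rule wsum_mono)
    fix ys assume ys: "ys \<in> ?Y"
    show "0 \<le> ?p wa wb ys" by (rule is_pmf_nonneg[OF pmf1[OF w] ys])
    have nn: "0 \<le> wsum ?Z ?ideal (\<lambda>z. of_bool (bad z))"
      by (rule wsum_nonneg) (auto simp: ideal_nn)
    show "wsum ?Z (?r ys) (\<lambda>z. of_bool (bad z))
        \<le> of_bool (relay_error dec n1 wa wb ys) + wsum ?Z ?ideal (\<lambda>z. of_bool (bad z))"
    proof (cases "relay_error dec n1 wa wb ys")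
      case True
      have "wsum ?Z (?r ys) (\<lambda>z. of_bool (bad z)) \<le> wsum ?Z (?r ys) (\<lambda>_. 1)"
        by (rule wsum_mono) (auto intro: is_pmf_nonneg[OF pmf2])
      then show ?thesis using True nn pmf2[of ys] by simp
    next
      case False
      then show ?thesis by (simp add: relay_input_good)
    qed
  qed
  also have "\<dots> = wsum ?Y (?p wa wb) (\<lambda>ys. of_bool (relay_error dec n1 wa wb ys)) + wsum ?Z ?ideal (\<lambda>z. of_bool (bad z))"
    by (simp only: wsum_add wsum_const[OF pmf1[OF w]])
  finally show "(\<Sum>ys\<in>?Y. \<Sum>z\<in>?Z. if bad z then trans_prob A B W1 W2 n1 n2 ea eb ?fr wa wb ys z else 0)
      \<le> wsum ?Y (?p wa wb) (\<lambda>ys. of_bool (relay_error dec n1 wa wb ys)) + wsum ?Z ?ideal (\<lambda>z. of_bool (bad z))" .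
qed

text \<open>\<open>bad\<close> is left generic so that \<open>err_at_a\<close> and
  \<open>err_at_b\<close> are both instances. The function \<open>err\<close> dominates
  \<open>bad\<close> and will be the sum of the two terminal errors that phase 2 controls.\<close>

lemma combined_error_le:
  assumes code: "\<forall>w<Ma. \<forall>k<n1. ea w k \<in> X 0" "\<forall>w<Mb. \<forall>k<n1. eb w k \<in> X (Suc m)"
    "\<forall>r obs. dec r obs \<in> {..<Ma} \<times> {..<Mb}" "\<forall>w\<in>{..<Ma} \<times> {..<Mb}. \<forall>k<n2. u w k \<in> Pi\<^sub>E (A \<inter> B) X"
    "\<forall>w<Ma. \<forall>k<n2. v w k \<in> Pi\<^sub>E (A - B) X" "\<forall>w<Mb. \<forall>k<n2. t w k \<in> Pi\<^sub>E (B - A) X"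
    and M: "0 < Ma" "0 < Mb"
    and E1: "(\<Sum>wa<Ma. \<Sum>wb<Mb. wsum (Pi\<^sub>E {..<n1} (\<lambda>_. S1)) (\<lambda>ys. \<Prod>k<n1. W1 (ea wa k) (eb wb k) (ys k))
            (\<lambda>ys. of_bool (relay_error dec n1 wa wb ys))) \<le> real (Ma * Mb) * e1"
    and E2: "(\<Sum>wa<Ma. \<Sum>wb<Mb. wsum (Pi\<^sub>E {..<n2} (\<lambda>_. S2))
            (\<lambda>z. \<Prod>k<n2. W2 (merge (u (wa, wb) k) (v wa k) (t wb k)) (z k)) (err wa wb)) \<le> real (Ma * Mb) * e2"
    and bad: "\<And>wa wb z. of_bool (bad wa wb z) \<le> (err wa wb z :: real)"
  defines "avg_err \<equiv> (1 / (real Ma * real Mb)) * (\<Sum>wa<Ma. \<Sum>wb<Mb. \<Sum>ys\<in>Pi\<^sub>E {..<n1} (\<lambda>_. S1).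
      \<Sum>z\<in>Pi\<^sub>E {..<n2} (\<lambda>_. S2).
        if bad wa wb z then trans_prob A B W1 W2 n1 n2 ea eb (relay_input dec u v t) wa wb ys z else 0)"
  shows "0 \<le> avg_err \<and> avg_err \<le> e1 + e2"
proof
  show "0 \<le> avg_err"
    unfolding avg_err_def
  proof (intro mult_nonneg_nonneg sum_nonneg)
    fix wa wb ys z
    assume "wa \<in> {..<Ma}" "wb \<in> {..<Mb}" "ys \<in> Pi\<^sub>E {..<n1} (\<lambda>_. S1)" "z \<in> Pi\<^sub>E {..<n2} (\<lambda>_. S2)"
    from combined_code(3)[OF code _ _ this(3,4), of wa wb] this(1,2)
    show "0 \<le> (if bad wa wb z then trans_prob A B W1 W2 n1 n2 ea eb (relay_input dec u v t) wa wb ys z else 0)"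
      by (cases "bad wa wb z") (simp_all only: if_True if_False lessThan_iff order.refl)
  qed auto
  let ?c = "1 / (real Ma * real Mb)"
  let ?e1 = "\<lambda>wa wb. wsum (Pi\<^sub>E {..<n1} (\<lambda>_. S1)) (\<lambda>ys. \<Prod>k<n1. W1 (ea wa k) (eb wb k) (ys k))
            (\<lambda>ys. of_bool (relay_error dec n1 wa wb ys))"
  let ?e2 = "\<lambda>wa wb. wsum (Pi\<^sub>E {..<n2} (\<lambda>_. S2))
            (\<lambda>z. \<Prod>k<n2. W2 (merge (u (wa, wb) k) (v wa k) (t wb k)) (z k))"
  have "avg_err \<le> ?c * (\<Sum>wa<Ma. \<Sum>wb<Mb. ?e1 wa wb + ?e2 wa wb (err wa wb))"
    unfolding avg_err_def
  proof (intro mult_left_mono sum_mono)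
    fix wa wb assume w: "wa \<in> {..<Ma}" "wb \<in> {..<Mb}"
    have "?e2 wa wb (\<lambda>z. of_bool (bad wa wb z)) \<le> ?e2 wa wb (err wa wb)"
    proof (rule wsum_mono)
      fix z assume z: "z \<in> Pi\<^sub>E {..<n2} (\<lambda>_. S2)"
      show "0 \<le> (\<Prod>k<n2. W2 (merge (u (wa, wb) k) (v wa k) (t wb k)) (z k))"
        using z w code(4-6) by (intro prod_nonneg ballI is_pmf_nonneg[OF W2_pmf] merge_in) auto
    qed (rule bad)
    then show "(\<Sum>ys\<in>Pi\<^sub>E {..<n1} (\<lambda>_. S1). \<Sum>z\<in>Pi\<^sub>E {..<n2} (\<lambda>_. S2).
        if bad wa wb z then trans_prob A B W1 W2 n1 n2 ea eb (relay_input dec u v t) wa wb ys z else 0)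
        \<le> ?e1 wa wb + ?e2 wa wb (err wa wb)"
      using combined_code(2)[OF code, of wa wb "bad wa wb"] w by fastforce
  qed auto
  also have "\<dots> \<le> ?c * (real (Ma * Mb) * e1 + real (Ma * Mb) * e2)"
    unfolding sum.distrib by (intro mult_left_mono add_mono E1 E2) auto
  also have "\<dots> = e1 + e2" using M by (simp add: field_simps)
  finally show "avg_err \<le> e1 + e2" .
qed

lemma achievable:
  assumes D: "D1 \<ge> 0" "D2 \<ge> 0" "D1 + D2 = 1" and R: "Ra \<ge> 0" "Rb \<ge> 0"
    and r1: "\<And>r c. (r, c) \<in> relay_jobs \<Longrightarrow> contention_rate c Ra Rb < D1 * relay_info r c"
    and r2: "\<And>c. c \<in> {First, Second} \<Longrightarrow> contention_rate c Ra Rb < D2 * terminal_info c"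
  shows "mabc_achievable m X Y A B W1 W2 D1 D2 Ra Rb"
proof -
  have rate_nn: "0 \<le> contention_rate c Ra Rb" for c using R by (cases c) auto
  \<comment> \<open>A nonnegative rate strictly below \<open>D1 * relay_info r c\<close> excludes
    \<open>D1 = 0\<close>. This is concluded only from an existing job: with no relays to serve,
    phase 1 may be empty.\<close>
  have D1: "0 < D1" if "(r, c) \<in> relay_jobs" for r c
    using r1[OF that] rate_nn[of c] D(1) by (cases "D1 = 0") auto
  have D2: "0 < D2"
    using r2[of First] rate_nn[of First] D(2) by (cases "D2 = 0") auto
  \<comment> \<open>The exponent lies between the rate per phase-1 use, rate divided by
    \<open>D1\<close>, and the mutual information.\<close>
  have "\<exists>g. g < relay_info (fst j) (snd j) \<and> contention_rate (snd j) Ra Rb < D1 * g" if "j \<in> relay_jobs" for j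
  proof -
    have j: "(fst j, snd j) \<in> relay_jobs" using that by simp
    have "contention_rate (snd j) Ra Rb / D1 < relay_info (fst j) (snd j)"
      using r1[OF j] D1[OF j] by (simp add: divide_less_eq mult.commute)
    from dense[OF this] show ?thesis
      using D1[OF j] by (auto simp: divide_less_eq mult.commute)
  qed
  then obtain g1 where g1: "\<And>j. j \<in> relay_jobs \<Longrightarrow> g1 j < relay_info (fst j) (snd j)"
      "\<And>j. j \<in> relay_jobs \<Longrightarrow> contention_rate (snd j) Ra Rb < D1 * g1 j"
    by metis
  have "\<exists>g. g < terminal_info c \<and> contention_rate c Ra Rb < D2 * g" if c: "c \<in> {First, Second}" for c
  proof -
    have "contention_rate c Ra Rb / D2 < terminal_info c"
      using r2[OF c] D2 by (simp add: divide_less_eq mult.commute)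
    from dense[OF this] show ?thesis
      using D2 by (auto simp: divide_less_eq mult.commute)
  qed
  then obtain g2 where g2: "\<And>c. c \<in> {First, Second} \<Longrightarrow> g2 c < terminal_info c"
      "\<And>c. c \<in> {First, Second} \<Longrightarrow> contention_rate c Ra Rb < D2 * g2 c"
    by metis
  \<comment> \<open>Block \<open>i\<close> has length exactly \<open>i\<close>: phase 2 receives
    whatever the rounding in phase 1 leaves.\<close>
  define n1 where "n1 i = nat \<lfloor>D1 * real i\<rfloor>" for i
  define n2 where "n2 i = i - n1 i" for i
  have n1_le: "n1 i \<le> i" for i
  proof -
    have "D1 * real i \<le> 1 * real i" using D by (intro mult_right_mono) auto
    then show ?thesis unfolding n1_def by linarith
  qed
  have lim1: "(\<lambda>i. real (n1 i) / real i) \<longlonglongrightarrow> D1"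
    unfolding n1_def by (rule nat_floor_ratio_tendsto[OF D(1)])
  have "(\<lambda>i. 1 - real (n1 i) / real i) \<longlonglongrightarrow> 1 - D1" by (intro tendsto_intros lim1)
  moreover have "\<forall>\<^sub>F i in sequentially. 1 - real (n1 i) / real i = real (n2 i) / real i"
    using eventually_gt_at_top[of 0]
    by eventually_elim (simp add: n2_def of_nat_diff n1_le diff_divide_distrib)
  ultimately have "(\<lambda>i. real (n2 i) / real i) \<longlonglongrightarrow> 1 - D1"
    by (rule Lim_transform_eventually)
  then have lim2: "(\<lambda>i. real (n2 i) / real i) \<longlonglongrightarrow> D2"
    using D(3) by (simp add: eq_diff_eq[symmetric] diff_eq_eq)
  let ?Ma = "\<lambda>i. msgs i Ra" and ?Mb = "\<lambda>i. msgs i Rb"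
  have M: "0 < ?Ma i" "0 < ?Mb i" for i using R by (simp_all add: msgs_pos)
  have "\<forall>j\<in>relay_jobs. g1 j < relay_info (fst j) (snd j)" using g1(1) by blast
  from phase1_codes[OF this] obtain \<rho>1 where \<rho>1: "\<forall>j\<in>relay_jobs. 0 \<le> \<rho>1 j \<and> \<rho>1 j < 1" and
    c1: "\<forall>n Ma Mb. 0 < Ma \<longrightarrow> 0 < Mb \<longrightarrow>
     (\<exists>ea eb dec. (\<forall>w<Ma. \<forall>k<n. ea w k \<in> X 0) \<and> (\<forall>w<Mb. \<forall>k<n. eb w k \<in> X (Suc m)) \<and>
        (\<forall>r obs. dec r obs \<in> {..<Ma} \<times> {..<Mb}) \<and>
        (\<Sum>wa<Ma. \<Sum>wb<Mb. wsum (Pi\<^sub>E {..<n} (\<lambda>_. S1)) (\<lambda>ys. \<Prod>k<n. W1 (ea wa k) (eb wb k) (ys k))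
            (\<lambda>ys. of_bool (relay_error dec n wa wb ys)))
        \<le> real (Ma * Mb) * (\<Sum>j\<in>relay_jobs. \<rho>1 j ^ n
              + real (num_rivals (snd j) Ma Mb) * 2 powr (- (real n * g1 j))))"
    by (elim exE conjE)
  have "\<forall>c\<in>{First, Second}. g2 c < terminal_info c" using g2(1) by blast
  from phase2_codes[OF this] obtain \<rho>2 where \<rho>2: "\<forall>c\<in>{First, Second}. 0 \<le> \<rho>2 c \<and> \<rho>2 c < 1" and
    c2: "\<forall>n Ma Mb. \<exists>u v t da db.
     (\<forall>w\<in>{..<Ma} \<times> {..<Mb}. \<forall>k<n. u w k \<in> Pi\<^sub>E (A \<inter> B) X) \<and> (\<forall>w<Ma. \<forall>k<n. v w k \<in> Pi\<^sub>E (A - B) X) \<and>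
     (\<forall>w<Mb. \<forall>k<n. t w k \<in> Pi\<^sub>E (B - A) X) \<and>
     (\<Sum>wa<Ma. \<Sum>wb<Mb. wsum (Pi\<^sub>E {..<n} (\<lambda>_. S2)) (\<lambda>z. \<Prod>k<n. W2 (merge (u (wa, wb) k) (v wa k) (t wb k)) (z k))
         (\<lambda>z. of_bool (db wb (\<lambda>k\<in>{..<n}. snd (z k)) \<noteq> wa) + of_bool (da wa (\<lambda>k\<in>{..<n}. fst (z k)) \<noteq> wb)))
       \<le> real (Ma * Mb) * (\<Sum>c\<in>{First, Second}. \<rho>2 c ^ n + real (num_rivals c Ma Mb) * 2 powr (- (real n * g2 c)))"
    by (elim exE conjE)
  define e1 where "e1 i = (\<Sum>j\<in>relay_jobs. \<rho>1 j ^ n1 i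
      + real (num_rivals (snd j) (?Ma i) (?Mb i)) * 2 powr (- (real (n1 i) * g1 j)))" for i
  define e2 where "e2 i = (\<Sum>c\<in>{First, Second}. \<rho>2 c ^ n2 i
      + real (num_rivals c (?Ma i) (?Mb i)) * 2 powr (- (real (n2 i) * g2 c)))" for i
  \<comment> \<open>Positivity of \<open>D1\<close> is supplied job by job; if \<open>D1\<close> is
    zero, the sum has no terms.\<close>
  have "e1 \<longlonglongrightarrow> (\<Sum>j\<in>relay_jobs. 0)"
    unfolding e1_def using \<rho>1 g1(2)
    by (intro tendsto_sum error_terms_tendsto_0[OF lim1]) (auto intro: D1)
  moreover have "e2 \<longlonglongrightarrow> (\<Sum>c\<in>{First, Second}. 0)"
    unfolding e2_def using \<rho>2 g2(2)
    by (intro tendsto_sum error_terms_tendsto_0[OF lim2 D2]) auto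
  ultimately have lim0: "(\<lambda>i. e1 i + e2 i) \<longlonglongrightarrow> 0"
    using tendsto_add by fastforce
  have "\<exists>ea eb fr da db. valid_code m X A B (n1 i) (n2 i) (?Ma i) (?Mb i) ea eb fr \<and>
     (0 \<le> err_at_b m X Y A B W1 W2 (n1 i) (n2 i) (?Ma i) (?Mb i) ea eb fr db \<and>
      err_at_b m X Y A B W1 W2 (n1 i) (n2 i) (?Ma i) (?Mb i) ea eb fr db \<le> e1 i + e2 i) \<and>
     (0 \<le> err_at_a m X Y A B W1 W2 (n1 i) (n2 i) (?Ma i) (?Mb i) ea eb fr da \<and>
      err_at_a m X Y A B W1 W2 (n1 i) (n2 i) (?Ma i) (?Mb i) ea eb fr da \<le> e1 i + e2 i)" for i
  proof -
    from c1[rule_format, OF M(1)[of i] M(2)[of i], of "n1 i"] obtain ea eb dec where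
      k1: "\<forall>w<?Ma i. \<forall>k<n1 i. ea w k \<in> X 0" "\<forall>w<?Mb i. \<forall>k<n1 i. eb w k \<in> X (Suc m)"
        "\<forall>r obs. dec r obs \<in> {..<?Ma i} \<times> {..<?Mb i}" and
      E1: "(\<Sum>wa<?Ma i. \<Sum>wb<?Mb i. wsum (Pi\<^sub>E {..<n1 i} (\<lambda>_. S1)) (\<lambda>ys. \<Prod>k<n1 i. W1 (ea wa k) (eb wb k) (ys k))
            (\<lambda>ys. of_bool (relay_error dec (n1 i) wa wb ys))) \<le> real (?Ma i * ?Mb i) * e1 i"
      unfolding e1_def by (elim exE conjE)
    from c2[rule_format, of "?Ma i" "?Mb i" "n2 i"] obtain u v t da db where
      k2: "\<forall>w\<in>{..<?Ma i} \<times> {..<?Mb i}. \<forall>k<n2 i. u w k \<in> Pi\<^sub>E (A \<inter> B) X"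
        "\<forall>w<?Ma i. \<forall>k<n2 i. v w k \<in> Pi\<^sub>E (A - B) X" "\<forall>w<?Mb i. \<forall>k<n2 i. t w k \<in> Pi\<^sub>E (B - A) X" and
      E2: "(\<Sum>wa<?Ma i. \<Sum>wb<?Mb i. wsum (Pi\<^sub>E {..<n2 i} (\<lambda>_. S2))
            (\<lambda>z. \<Prod>k<n2 i. W2 (merge (u (wa, wb) k) (v wa k) (t wb k)) (z k))
            (\<lambda>z. of_bool (db wb (\<lambda>k\<in>{..<n2 i}. snd (z k)) \<noteq> wa) + of_bool (da wa (\<lambda>k\<in>{..<n2 i}. fst (z k)) \<noteq> wb)))
         \<le> real (?Ma i * ?Mb i) * e2 i"
      unfolding e2_def by (elim exE conjE)
    note le = combined_error_le[OF k1 k2 M E1 E2]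
    show ?thesis
    proof (rule exI[of _ ea], rule exI[of _ eb], rule exI[of _ "relay_input dec u v t"],
        rule exI[of _ da], rule exI[of _ db], intro conjI)
      show "valid_code m X A B (n1 i) (n2 i) (?Ma i) (?Mb i) ea eb (relay_input dec u v t)"
        by (rule combined_code(1)[OF k1 k2])
    qed (use le[of "\<lambda>wa wb z. db wb (\<lambda>j\<in>{..<n2 i}. snd (z j)) \<noteq> wa"]
          le[of "\<lambda>wa wb z. da wa (\<lambda>j\<in>{..<n2 i}. fst (z j)) \<noteq> wb"] in
          \<open>simp_all add: err_at_a_def err_at_b_def\<close>)
  qed
  then obtain ea eb fr da db where
    code: "\<And>i. valid_code m X A B (n1 i) (n2 i) (?Ma i) (?Mb i) (ea i) (eb i) (fr i)" and
    errb: "\<And>i. 0 \<le> err_at_b m X Y A B W1 W2 (n1 i) (n2 i) (?Ma i) (?Mb i) (ea i) (eb i) (fr i) (db i)"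
      "\<And>i. err_at_b m X Y A B W1 W2 (n1 i) (n2 i) (?Ma i) (?Mb i) (ea i) (eb i) (fr i) (db i) \<le> e1 i + e2 i" and
    erra: "\<And>i. 0 \<le> err_at_a m X Y A B W1 W2 (n1 i) (n2 i) (?Ma i) (?Mb i) (ea i) (eb i) (fr i) (da i)"
      "\<And>i. err_at_a m X Y A B W1 W2 (n1 i) (n2 i) (?Ma i) (?Mb i) (ea i) (eb i) (fr i) (da i) \<le> e1 i + e2 i"
    by metis
  show ?thesis
    unfolding mabc_achievable_def
  proof (rule exI[of _ "\<lambda>i. i"], rule exI[of _ n1], rule exI[of _ n2], rule exI[of _ ea], rule exI[of _ eb],
      rule exI[of _ fr], rule exI[of _ da], rule exI[of _ db], intro conjI allI)
    show "filterlim (\<lambda>i::nat. i) at_top sequentially" by (rule filterlim_ident)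
    show "n1 i + n2 i = i" for i unfolding n2_def using n1_le by simp
    show "(\<lambda>i. real (n1 i) / real i) \<longlonglongrightarrow> D1" "(\<lambda>i. real (n2 i) / real i) \<longlonglongrightarrow> D2" by (fact lim1 lim2)+
    show "valid_code m X A B (n1 i) (n2 i) (?Ma i) (?Mb i) (ea i) (eb i) (fr i)" for i by (rule code)
    show "(\<lambda>i. err_at_b m X Y A B W1 W2 (n1 i) (n2 i) (?Ma i) (?Mb i) (ea i) (eb i) (fr i) (db i)) \<longlonglongrightarrow> 0"
      by (rule tendsto_sandwich[OF _ _ tendsto_const lim0]) (auto simp: errb)
    show "(\<lambda>i. err_at_a m X Y A B W1 W2 (n1 i) (n2 i) (?Ma i) (?Mb i) (ea i) (eb i) (fr i) (da i)) \<longlonglongrightarrow> 0"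
      by (rule tendsto_sandwich[OF _ _ tendsto_const lim0]) (auto simp: erra)
  qed
qed

end

theorem theorem4:
  fixes m :: nat and X :: "nat \<Rightarrow> 'x set" and Y :: "nat \<Rightarrow> 'y set" and A B :: "nat set"
    and W1 :: "'x \<Rightarrow> 'x \<Rightarrow> (nat \<Rightarrow> 'y) \<Rightarrow> real" and W2 :: "(nat \<Rightarrow> 'x) \<Rightarrow> 'y \<times> 'y \<Rightarrow> real"
    and D1 D2 Ra Rb :: real
    and Qs :: "'q set" and pq :: "'q \<Rightarrow> real" and pa pb :: "'q \<Rightarrow> 'x \<Rightarrow> real"
    and pAB pAnB pBnA :: "'q \<Rightarrow> (nat \<Rightarrow> 'x) \<Rightarrow> real"
  assumes alph: "\<forall>r\<le>Suc m. finite (X r) \<and> X r \<noteq> {} \<and> finite (Y r) \<and> Y r \<noteq> {}"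
    and AR: "A \<subseteq> {1..m}" and BR: "B \<subseteq> {1..m}"
    and ch1: "mabc_channel1 m X Y W1" and ch2: "mabc_channel2 m X Y A B W2"
    and D: "D1 \<ge> 0" "D2 \<ge> 0" "D1 + D2 = 1"
    and Q: "finite Qs" "card Qs \<le> 3 * m + 2" "is_pmf Qs pq"
    and inputs: "\<forall>q\<in>Qs. is_pmf (X 0) (pa q) \<and> is_pmf (X (Suc m)) (pb q)
                   \<and> is_pmf (Pi\<^sub>E (A \<inter> B) X) (pAB q) \<and> is_pmf (Pi\<^sub>E (A - B) X) (pAnB q)
                   \<and> is_pmf (Pi\<^sub>E (B - A) X) (pBnA q)"
    and R: "Ra \<ge> 0" "Rb \<ge> 0"
    and Ra1: "\<forall>r\<in>A \<inter> B. Ra < D1 * cmi (dist1 pq pa pb W1) (space1 Qs m X Y)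
                   (\<lambda>(q, xa, xb, y). xa) (\<lambda>(q, xa, xb, y). y r) (\<lambda>(q, xa, xb, y). (xb, q))"
    and Ra2: "\<forall>r\<in>A - B. Ra < D1 * cmi (dist1 pq pa pb W1) (space1 Qs m X Y)
                   (\<lambda>(q, xa, xb, y). xa) (\<lambda>(q, xa, xb, y). y r) (\<lambda>(q, xa, xb, y). q)"
    and Ra3: "Ra < D2 * cmi (dist2 A B pq pAB pAnB pBnA W2) (space2 Qs m X Y A B)
                   (\<lambda>(q, x, ya, yb). restrict x A) (\<lambda>(q, x, ya, yb). yb) (\<lambda>(q, x, ya, yb). q)"
    and Rb1: "\<forall>r\<in>A \<inter> B. Rb < D1 * cmi (dist1 pq pa pb W1) (space1 Qs m X Y)
                   (\<lambda>(q, xa, xb, y). xb) (\<lambda>(q, xa, xb, y). y r) (\<lambda>(q, xa, xb, y). (xa, q))"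
    and Rb2: "\<forall>r\<in>B - A. Rb < D1 * cmi (dist1 pq pa pb W1) (space1 Qs m X Y)
                   (\<lambda>(q, xa, xb, y). xb) (\<lambda>(q, xa, xb, y). y r) (\<lambda>(q, xa, xb, y). q)"
    and Rb3: "Rb < D2 * cmi (dist2 A B pq pAB pAnB pBnA W2) (space2 Qs m X Y A B)
                   (\<lambda>(q, x, ya, yb). restrict x B) (\<lambda>(q, x, ya, yb). ya) (\<lambda>(q, x, ya, yb). q)"
    and Rsum: "\<forall>r\<in>A \<inter> B. Ra + Rb < D1 * cmi (dist1 pq pa pb W1) (space1 Qs m X Y)
                   (\<lambda>(q, xa, xb, y). (xa, xb)) (\<lambda>(q, xa, xb, y). y r) (\<lambda>(q, xa, xb, y). q)"
  shows "mabc_achievable m X Y A B W1 W2 D1 D2 Ra Rb"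
proof -
  interpret mabc m X Y A B W1 W2 Qs pq pa pb pAB pAnB pBnA
    by unfold_locales (fact alph AR BR ch1 ch2 Q(3) inputs)+
  show ?thesis
  proof (rule achievable[OF D R])
    show "contention_rate c Ra Rb < D1 * relay_info r c" if "(r, c) \<in> relay_jobs" for r c
      using that Ra1 Ra2 Rb1 Rb2 Rsum by (cases c) (auto simp: relay_jobs_def relay_info_def)
    show "contention_rate c Ra Rb < D2 * terminal_info c" if "c \<in> {First, Second}" for c
    proof -
      \<comment> \<open>The rate conditions destructure the pair of outputs, whereas
        \<open>terminal_info\<close> keeps it as one component \<open>z\<close>.\<close>
      have [simp]: "(\<lambda>(q, x, z). snd z) = (\<lambda>(q, x, ya, yb). yb)" "(\<lambda>(q, x, z). fst z) = (\<lambda>(q, x, ya, yb). ya)"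
        "(\<lambda>(q, x, z). restrict x C) = (\<lambda>(q, x, ya, yb). restrict x C)" "(\<lambda>(q, x, z). q) = (\<lambda>(q, x, ya, yb). q)" for C
        by auto
      show ?thesis
        using that Ra3 Rb3 by (auto simp: terminal_info_def senders_def heard_def)
    qed
  qed
qed

end
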